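(* Let $\alpha,\beta,p\in(0,\infty)$. Consider the approximation problem $\mathrm{APP}=\{\mathrm{APP}_d\}_{d\in\mathbb N}$, $\mathrm{APP}_d:C(\mathbb T^d)\to L_2(\mathbb T^d)$, $\mathrm{APP}_d f=f$, in the average case setting with respect to the zero-mean Gaussian measure $\mu_d$ on $C(\mathbb T^d)$ whose covariance kernel is the Gevrey kernel $$K_{d,\alpha,\beta,p}(\mathbf x,\mathbf y)=\sum_{\mathbf k\in\mathbb Z^d}\exp(-2\beta|\mathbf k|_p^\alpha)\exp(i\,\mathbf k(\mathbf x-\mathbf y)).$$ Then, for the absolute error criterion as well as for the normalized error criterion, the following hold. (i) $\mathrm{APP}$ is ALG-$(s,t)$-WT for all $s>0$ and $t>1$. (ii) For $s>0$ and $0<t\le 1$, the following are equivalent: $\mathrm{APP}$ is ALG-$(s,t)$-WT; $\mathrm{APP}$ is ALG-WT; $\mathrm{APP}$ is ALG-UWT; $\alpha>p$. (iii) $\mathrm{APP}$ is not ALG-QPT, not ALG-PT and not ALG-SPT. (iv) $\mathrm{APP}$ suffers from the curse of dimensionality if and only if $\alpha\le p$.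
   Context: Notation. $\mathbb T^d=[0,2\pi]^d$ is the $d$-dimensional torus, $C(\mathbb T^d)$ is the space of continuous (real-valued) functions on it, and $L_2(\mathbb T^d)$ is taken with respect to the normalized measure $(2\pi)^{-d}d\mathbf x$, with norm $\|\cdot\|_2$. For $\mathbf x,\mathbf y\in\mathbb T^d$ and $\mathbf k\in\mathbb Z^d$, $\mathbf k\mathbf x=\sum_{j=1}^d k_jx_j$ and $|\mathbf k|_p=(\sum_{j=1}^d|k_j|^p)^{1/p}$. That $\mu_d$ has covariance kernel $K_{d,\alpha,\beta,p}$ means $\int_{C(\mathbb T^d)}f(\mathbf x)f(\mathbf y)\,\mu_d(df)=K_{d,\alpha,\beta,p}(\mathbf x,\mathbf y)$. Algorithms and errors. An algorithm using $n\ge1$ pieces of information has the form $A_{n,d}f=\phi_{n,d}(L_1(f),\dots,L_n(f))$ with continuous linear functionals $L_1,\dots,L_n$ on $C(\mathbb T^d)$ and an arbitrary measurable map $\phi_{n,d}:\mathbb R^n\to L_2(\mathbb T^d)$; for $n=0$, $A_{0,d}=0$. Its average case error is $e^{\rm avg}(A_{n,d})=\big(\int_{C(\mathbb T^d)}\|f-A_{n,d}f\|_2^2\,\mu_d(df)\big)^{1/2}$. Put $e^{\rm avg}(n,d)=\inf_{A_{n,d}}e^{\rm avg}(A_{n,d})$ and $e^{\rm avg}(0,d)=\big(\int_{C(\mathbb T^d)}\|f\|_2^2\,\mu_d(df)\big)^{1/2}$ (initial error). Information complexity. For $\varepsilon\in(0,1)$ and $\star\in\{\mathrm{ABS},\mathrm{NOR}\}$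 (absolute, normalized error criterion), $n^\star(\varepsilon,d)=\inf\{n\in\mathbb N_0: e^{\rm avg}(n,d)\le\varepsilon\,\mathrm{CRI}_d\}$, where $\mathrm{CRI}_d=1$ for $\star=\mathrm{ABS}$ and $\mathrm{CRI}_d=e^{\rm avg}(0,d)$ for $\star=\mathrm{NOR}$. Tractability notions (for error criterion $\star$). $\mathrm{APP}$ is: - ALG-SPT if there are $C>0$, $a\ge0$ with $n^\star(\varepsilon,d)\le C\varepsilon^{-a}$ for all $d\in\mathbb N$, $\varepsilon\in(0,1)$; - ALG-PT if there are $C>0$, $a,b\ge0$ with $n^\star(\varepsilon,d)\le Cd^{b}\varepsilon^{-a}$ for all $d\in\mathbb N$, $\varepsilon\in(0,1)$; - ALG-QPT if there are $C>0$, $a\ge0$ with $n^\star(\varepsilon,d)\le C\exp(a(1+\ln d)(1+\ln\varepsilon^{-1}))$ for all $d\in\mathbb N$, $\varepsilon\in(0,1)$; - ALG-$(s,t)$-WT, for fixed $s,t>0$, if $\lim_{\varepsilon^{-1}+d\to\infty}\frac{\ln n^\star(\varepsilon,d)}{\varepsilon^{-s}+d^t}=0$; - ALG-WT if it is ALG-$(1,1)$-WT; - ALG-UWT if it is ALG-$(\sigma,\tau)$-WT for all $\sigma,\tau>0$. $\mathrm{APP}$ suffers from the curse of dimensionality if there are positive numbers $C,\varepsilon_0,\gamma$ such that for all $0<\varepsilon\le\varepsilon_0$ and infinitely many $d\in\mathbb N$, $n^\star(\varepsilon,d)\ge C(1+\gamma)^d$. *)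

theory Defs
  imports "HOL-Probability.Probability" "HOL-Library.Going_To_Filter" "HOL-Library.Extended_Nat"
begin

text \<open>
  The dimension \<open>d\<close> is quantified over inside the theorem, so points of the \<open>d\<close>-dimensional
  torus are extensional functions on \<open>{..<d}\<close>.
\<close>

definition torus :: "nat \<Rightarrow> (nat \<Rightarrow> real) set" where
  "torus d = ({..<d} \<rightarrow>\<^sub>E {0..2*pi})"

text \<open>Two points of the cube are the same point of the torus if they differ only in coordinates
  where one has \<open>0\<close> and the other \<open>2\<pi>\<close>.\<close>

definition torus_eq :: "nat \<Rightarrow> (nat \<Rightarrow> real) \<Rightarrow> (nat \<Rightarrow> real) \<Rightarrow> bool" where
  "torus_eq d x y \<longleftrightarrow> (\<forall>j<d. x j = y j \<or> (x j = 0 \<and> y j = 2*pi) \<or> (x j = 2*pi \<and> y j = 0))"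

text \<open>The Borel sets of a space \<open>V\<close> of real functions with (semi)norm \<open>N\<close>.\<close>

definition seminorm_open ::
    "('a \<Rightarrow> real) set \<Rightarrow> (('a \<Rightarrow> real) \<Rightarrow> real) \<Rightarrow> ('a \<Rightarrow> real) set \<Rightarrow> bool" where
  "seminorm_open V N U \<longleftrightarrow>
     U \<subseteq> V \<and> (\<forall>f\<in>U. \<exists>r>0. \<forall>g\<in>V. N (\<lambda>x. g x - f x) < r \<longrightarrow> g \<in> U)"

definition seminorm_borel ::
    "('a \<Rightarrow> real) set \<Rightarrow> (('a \<Rightarrow> real) \<Rightarrow> real) \<Rightarrow> ('a \<Rightarrow> real) measure" where
  "seminorm_borel V N = sigma V {U. seminorm_open V N U}"

definition C_torus :: "nat \<Rightarrow> ((nat \<Rightarrow> real) \<Rightarrow> real) set" where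
  "C_torus d = {f \<in> extensional (torus d). continuous_on (torus d) f \<and>
     (\<forall>x\<in>torus d. \<forall>y\<in>torus d. torus_eq d x y \<longrightarrow> f x = f y)}"

definition sup_norm :: "nat \<Rightarrow> ((nat \<Rightarrow> real) \<Rightarrow> real) \<Rightarrow> real" where
  "sup_norm d f = (SUP x\<in>torus d. \<bar>f x\<bar>)"

definition continuous_linear_functional ::
    "nat \<Rightarrow> (((nat \<Rightarrow> real) \<Rightarrow> real) \<Rightarrow> real) \<Rightarrow> bool" where
  "continuous_linear_functional d L \<longleftrightarrow>
     (\<forall>f\<in>C_torus d. \<forall>g\<in>C_torus d. \<forall>a b.
        L (\<lambda>x\<in>torus d. a * f x + b * g x) = a * L f + b * L g) \<and>
     (\<exists>B. \<forall>f\<in>C_torus d. \<bar>L f\<bar> \<le> B * sup_norm d f)"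

text \<open>The normalized Lebesgue measure \<open>(2\<pi>)\<^sup>-\<^sup>d dx\<close>; its space is \<^term>\<open>torus d\<close>.\<close>

definition torus_measure :: "nat \<Rightarrow> (nat \<Rightarrow> real) measure" where
  "torus_measure d =
     (\<Pi>\<^sub>M j\<in>{..<d}. uniform_measure (restrict_space lborel {0..2*pi}) {0..2*pi})"

text \<open>
  Elements of \<open>L\<^sub>2\<close> are represented by square integrable functions, without passing to classes
  modulo null sets. As \<open>L2_norm\<close> does not separate members of a class, every set in
  \<^term>\<open>seminorm_borel (L2_torus d) (L2_norm d)\<close> is a union of classes, so measurability of a map
  into this space is Borel measurability of the induced map into the quotient.
\<close>

definition L2_torus :: "nat \<Rightarrow> ((nat \<Rightarrow> real) \<Rightarrow> real) set" where
  "L2_torus d = {f \<in> borel_measurable (torus_measure d). integrable (torus_measure d) (\<lambda>x. (f x)\<^sup>2)}"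

definition L2_norm :: "nat \<Rightarrow> ((nat \<Rightarrow> real) \<Rightarrow> real) \<Rightarrow> real" where
  "L2_norm d f = sqrt (\<integral>x. (f x)\<^sup>2 \<partial>torus_measure d)"

text \<open>Normal distributions on the line, Dirac measures included.\<close>

definition gaussian_real :: "real measure \<Rightarrow> bool" where
  "gaussian_real \<nu> \<longleftrightarrow>
     (\<exists>m. \<nu> = return borel m) \<or>
     (\<exists>m \<sigma>. \<sigma> > 0 \<and> \<nu> = density lborel (\<lambda>x. ennreal (normal_density m \<sigma> x)))"

definition zero_mean_gaussian :: "nat \<Rightarrow> ((nat \<Rightarrow> real) \<Rightarrow> real) measure \<Rightarrow> bool" where
  "zero_mean_gaussian d M \<longleftrightarrow>
     prob_space M \<and> space M = C_torus d \<and>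
     sets M = sets (seminorm_borel (C_torus d) (sup_norm d)) \<and>
     (\<forall>L. continuous_linear_functional d L \<longrightarrow>
        gaussian_real (distr M borel L) \<and> (\<integral>f. L f \<partial>M) = 0)"

definition has_covariance_kernel ::
    "nat \<Rightarrow> ((nat \<Rightarrow> real) \<Rightarrow> real) measure \<Rightarrow> ((nat \<Rightarrow> real) \<Rightarrow> (nat \<Rightarrow> real) \<Rightarrow> complex) \<Rightarrow> bool" where
  "has_covariance_kernel d M K \<longleftrightarrow>
     (\<forall>x\<in>torus d. \<forall>y\<in>torus d. complex_of_real (\<integral>f. f x * f y \<partial>M) = K x y)"

definition p_norm :: "real \<Rightarrow> nat \<Rightarrow> (nat \<Rightarrow> int) \<Rightarrow> real" where
  "p_norm p d k = (\<Sum>j<d. \<bar>real_of_int (k j)\<bar> powr p) powr (1 / p)"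

definition gevrey_kernel ::
    "nat \<Rightarrow> real \<Rightarrow> real \<Rightarrow> real \<Rightarrow> (nat \<Rightarrow> real) \<Rightarrow> (nat \<Rightarrow> real) \<Rightarrow> complex" where
  "gevrey_kernel d \<alpha> \<beta> p x y =
     (\<Sum>\<^sub>\<infinity>k\<in>{..<d} \<rightarrow>\<^sub>E (UNIV :: int set).
        complex_of_real (exp (- 2 * \<beta> * p_norm p d k powr \<alpha>)) *
        exp (\<i> * complex_of_real (\<Sum>j<d. real_of_int (k j) * (x j - y j))))"

definition algorithms ::
    "nat \<Rightarrow> nat \<Rightarrow> (((nat \<Rightarrow> real) \<Rightarrow> real) \<Rightarrow> ((nat \<Rightarrow> real) \<Rightarrow> real)) set" where
  "algorithms d n =
     (if n = 0 then {\<lambda>f x. 0}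
      else {A. \<exists>L \<phi>. (\<forall>i<n. continuous_linear_functional d (L i)) \<and>
                 \<phi> \<in> measurable (\<Pi>\<^sub>M i\<in>{..<n}. borel) (seminorm_borel (L2_torus d) (L2_norm d)) \<and>
                 A = (\<lambda>f. \<phi> (\<lambda>i\<in>{..<n}. L i f))})"

definition ennreal_sqrt :: "ennreal \<Rightarrow> ennreal" where
  "ennreal_sqrt v = (if v = \<infinity> then \<infinity> else ennreal (sqrt (enn2real v)))"

text \<open>The error of a single algorithm may be infinite.\<close>

definition avg_error ::
    "nat \<Rightarrow> ((nat \<Rightarrow> real) \<Rightarrow> real) measure \<Rightarrow>
     (((nat \<Rightarrow> real) \<Rightarrow> real) \<Rightarrow> ((nat \<Rightarrow> real) \<Rightarrow> real)) \<Rightarrow> ennreal" where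
  "avg_error d M A =
     ennreal_sqrt (\<integral>\<^sup>+f. ennreal ((L2_norm d (\<lambda>x. f x - A f x))\<^sup>2) \<partial>M)"

definition min_avg_error :: "nat \<Rightarrow> ((nat \<Rightarrow> real) \<Rightarrow> real) measure \<Rightarrow> nat \<Rightarrow> ennreal" where
  "min_avg_error d M n = (INF A\<in>algorithms d n. avg_error d M A)"

datatype error_criterion = ABS | NOR

fun CRI :: "error_criterion \<Rightarrow> nat \<Rightarrow> ((nat \<Rightarrow> real) \<Rightarrow> real) measure \<Rightarrow> ennreal" where
  "CRI ABS d M = 1"
| "CRI NOR d M = min_avg_error d M 0"

text \<open>The infimum is taken in \<^typ>\<open>enat\<close>, so that the infimum of the empty set is \<open>\<infinity>\<close>.\<close>

definition info_complexity ::
    "error_criterion \<Rightarrow> (nat \<Rightarrow> ((nat \<Rightarrow> real) \<Rightarrow> real) measure) \<Rightarrow> real \<Rightarrow> nat \<Rightarrow> enat" where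
  "info_complexity crit \<mu> \<epsilon> d =
     Inf (enat ` {n. min_avg_error d (\<mu> d) n \<le> ennreal \<epsilon> * CRI crit d (\<mu> d)})"

text \<open>In the following, \<open>n \<epsilon> d\<close> is the information complexity.\<close>

definition ALG_SPT :: "(real \<Rightarrow> nat \<Rightarrow> enat) \<Rightarrow> bool" where
  "ALG_SPT n \<longleftrightarrow> (\<exists>C a. C > 0 \<and> a \<ge> 0 \<and>
     (\<forall>d\<ge>1. \<forall>\<epsilon>\<in>{0<..<1}. ereal_of_enat (n \<epsilon> d) \<le> ereal (C * \<epsilon> powr (- a))))"

definition ALG_PT :: "(real \<Rightarrow> nat \<Rightarrow> enat) \<Rightarrow> bool" where
  "ALG_PT n \<longleftrightarrow> (\<exists>C a b. C > 0 \<and> a \<ge> 0 \<and> b \<ge> 0 \<and>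
     (\<forall>d\<ge>1. \<forall>\<epsilon>\<in>{0<..<1}.
        ereal_of_enat (n \<epsilon> d) \<le> ereal (C * real d powr b * \<epsilon> powr (- a))))"

definition ALG_QPT :: "(real \<Rightarrow> nat \<Rightarrow> enat) \<Rightarrow> bool" where
  "ALG_QPT n \<longleftrightarrow> (\<exists>C a. C > 0 \<and> a \<ge> 0 \<and>
     (\<forall>d\<ge>1. \<forall>\<epsilon>\<in>{0<..<1}.
        ereal_of_enat (n \<epsilon> d) \<le> ereal (C * exp (a * (1 + ln (real d)) * (1 + ln (1 / \<epsilon>))))))"

fun ln_enat :: "enat \<Rightarrow> ereal" where
  "ln_enat (enat m) = (if m = 0 then - \<infinity> else ereal (ln (real m)))"
| "ln_enat \<infinity> = \<infinity>"

definition ALG_WT_st :: "real \<Rightarrow> real \<Rightarrow> (real \<Rightarrow> nat \<Rightarrow> enat) \<Rightarrow> bool" where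
  "ALG_WT_st s t n \<longleftrightarrow>
     ((\<lambda>(\<epsilon>, d). ln_enat (n \<epsilon> d) / ereal (\<epsilon> powr (- s) + real d powr t)) \<longlongrightarrow> 0)
       ((\<lambda>(\<epsilon>, d). 1 / \<epsilon> + real d) going_to at_top within {0<..<1} \<times> {1..})"

definition ALG_WT :: "(real \<Rightarrow> nat \<Rightarrow> enat) \<Rightarrow> bool" where
  "ALG_WT n \<longleftrightarrow> ALG_WT_st 1 1 n"

definition ALG_UWT :: "(real \<Rightarrow> nat \<Rightarrow> enat) \<Rightarrow> bool" where
  "ALG_UWT n \<longleftrightarrow> (\<forall>\<sigma>>0. \<forall>\<tau>>0. ALG_WT_st \<sigma> \<tau> n)"

text \<open>The information complexity is only considered for \<open>\<epsilon> < 1\<close>, whence the extra bound.\<close>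

definition curse_of_dimensionality :: "(real \<Rightarrow> nat \<Rightarrow> enat) \<Rightarrow> bool" where
  "curse_of_dimensionality n \<longleftrightarrow> (\<exists>C \<epsilon>\<^sub>0 \<gamma>. C > 0 \<and> \<epsilon>\<^sub>0 > 0 \<and> \<gamma> > 0 \<and>
     (\<forall>\<epsilon>. 0 < \<epsilon> \<and> \<epsilon> \<le> \<epsilon>\<^sub>0 \<and> \<epsilon> < 1 \<longrightarrow>
        infinite {d. d \<ge> 1 \<and> ereal (C * (1 + \<gamma>) ^ d) \<le> ereal_of_enat (n \<epsilon> d)}))"

end

theory Submission
  imports Defs "HOL-Real_Asymp.Real_Asymp"
begin

text \<open>
  Under the Gaussian measure with the Gevrey kernel the Fourier coefficients of a random function
  are uncorrelated, and the coefficient of frequency \<open>k\<close> has variance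
  \<open>\<lambda>\<^sub>k = exp (-2\<beta> |k|\<^sub>p\<^sup>\<alpha>) \<le> 1\<close>. Hence the squared initial error is
  \<open>A d = \<Sum>\<lambda>\<^sub>k \<ge> 1\<close>, and two estimates of the squared minimal error suffice for the whole theorem.

  \<^item> Upper estimate (\<open>min_avg_error_le\<close>): the real and imaginary parts of the coefficients with
    frequencies in a finite set \<open>F\<close> are \<open>2 |F|\<close> continuous functionals, and the corresponding partial
    Fourier sum has squared error at most \<open>A d - \<Sum>\<^bsub>k \<in> F\<^esub> \<lambda>\<^sub>k\<close>. With \<open>B d = \<Sum>\<surd>\<lambda>\<^sub>k\<close> and \<open>F\<close> the set where
    \<open>\<surd>\<lambda>\<^sub>k\<close> is at least \<open>\<epsilon>\<^sup>2 / B d\<close>, this error is at most \<open>\<epsilon>\<^sup>2\<close>, and \<open>|F| \<le> (B d)\<^sup>2 / \<epsilon>\<^sup>2\<close>.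

  \<^item> Lower estimate (\<open>min_avg_error_ge\<close>): \<open>n\<close> functionals lower the squared error by at most \<open>n\<close>. For
    jointly Gaussian variables the best prediction, even among nonlinear ones, is the orthogonal
    projection; the variance it removes is a sum of \<open>n\<close> Bessel sums against uncorrelated variables
    of variance at most \<open>1\<close>.

  Together, for both error criteria, \<open>(1 - \<epsilon>\<^sup>2) A d \<le> n(\<epsilon>,d) \<le> 2 (B d)\<^sup>2 / \<epsilon>\<^sup>2\<close>
  (\<open>info_complexity_bounds\<close>). The dependence on \<open>\<epsilon>\<close> is thus polynomial, and tractability is decided by
  the growth of two lattice sums of the same form.

  \<^item> Always \<open>ln (B d) = O(d ln d)\<close>, which gives \<open>(s,t)\<close>-weak tractability for \<open>t > 1\<close>.

  \<^item> For \<open>\<alpha> > p\<close> the exponent of the weight contains the power \<open>\<alpha>/p > 1\<close> of the additive quantity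
    \<open>\<Sum>|k\<^sub>j|\<^sup>p\<close>. Such a power dominates every linear function up to a constant, and \<open>ln (B d)\<close> is at most a
    constant multiple of a power of \<open>1 + ln d\<close>.

  \<^item> For \<open>\<alpha> \<le> p\<close> the frequencies with entries in \<open>{-1, 0, 1}\<close> alone make \<open>A d\<close> exponentially large.

  \<^item> Always \<open>A d\<close> is at least a constant times \<open>d choose m\<close>, for every \<open>m\<close>; so \<open>A d\<close> outgrows all
    polynomials, whereas quasi-polynomial tractability, and all the more the two stronger notions,
    would bound \<open>n(1/2, d)\<close> by a polynomial.
\<close>

section \<open>Recovering a law from its linear images\<close>

text \<open>
  Levy's uniqueness theorem for laws with a density. Normalizing the weights by their common
  integral, the hypothesis at \<open>u = 0\<close>, turns both sides into probability measures on the line.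
\<close>

lemma weighted_law_unique:
  fixes w X :: "'a \<Rightarrow> real" and v Y :: "'b \<Rightarrow> real"
  assumes "prob_space P" "prob_space Q"
    and mP [measurable]: "w \<in> borel_measurable P" "X \<in> borel_measurable P"
    and mQ [measurable]: "v \<in> borel_measurable Q" "Y \<in> borel_measurable Q"
    and w: "\<And>x. 0 \<le> w x" "\<And>x. w x \<le> K" and v: "\<And>x. 0 \<le> v x" "\<And>x. v x \<le> K"
    and eq: "\<And>u. (\<integral>x. w x *\<^sub>R iexp (u * X x) \<partial>P) = (\<integral>x. v x *\<^sub>R iexp (u * Y x) \<partial>Q)"
    and B [measurable]: "B \<in> sets borel"
  shows "(\<integral>x. w x * indicator B (X x) \<partial>P) = (\<integral>x. v x * indicator B (Y x) \<partial>Q)"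
proof -
  interpret P: prob_space P by fact
  interpret Q: prob_space Q by fact
  define c where "c = (\<integral>x. w x \<partial>P)"
  have iw: "integrable P w" "integrable Q v"
    using w v by (auto intro!: P.integrable_const_bound[of _ K] Q.integrable_const_bound[of _ K])
  have "complex_of_real (\<integral>x. w x \<partial>P) = complex_of_real (\<integral>x. v x \<partial>Q)"
    using eq[of 0] by (simp add: scaleR_conv_of_real)
  then have c': "c = (\<integral>x. v x \<partial>Q)"
    unfolding c_def of_real_eq_iff .
  have "c \<ge> 0" using w by (simp add: c_def)
  show ?thesis
  proof (cases "c = 0")
    case True
    then have "AE x in P. w x = 0" "AE x in Q. v x = 0"
      using integral_nonneg_eq_0_iff_AE[OF iw(1)] integral_nonneg_eq_0_iff_AE[OF iw(2)] w v c' c_def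
      by auto
    then have "(\<integral>x. w x * indicator B (X x) \<partial>P) = 0" "(\<integral>x. v x * indicator B (Y x) \<partial>Q) = 0"
      by (auto intro!: integral_eq_zero_AE)
    then show ?thesis by simp
  next
    case False
    with \<open>c \<ge> 0\<close> have c: "c > 0" by simp
    have normalized: "real_distribution (distr (density M f) borel Z) \<and>
        char (distr (density M f) borel Z) = (\<lambda>u. (\<integral>x. g x *\<^sub>R iexp (u * Z x) \<partial>M) / c) \<and>
        measure (distr (density M f) borel Z) B = (\<integral>x. g x * indicator B (Z x) \<partial>M) / c"
      if [measurable]: "g \<in> borel_measurable M" "Z \<in> borel_measurable M"
        and M: "prob_space M" and g: "\<And>x. 0 \<le> g x" "\<And>x. g x \<le> K" and gc: "(\<integral>x. g x \<partial>M) = c"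
        and f: "f = (\<lambda>x. ennreal (g x / c))"
      for M :: "'c measure" and g Z f
    proof -
      interpret M: prob_space M by fact
      have ig: "integrable M g"
        using g by (auto intro!: M.integrable_const_bound[of _ K])
      have "(\<integral>\<^sup>+x. ennreal (g x / c) \<partial>M) = ennreal (\<integral>x. g x / c \<partial>M)"
        using ig g c by (intro nn_integral_eq_integral) auto
      also have "(\<integral>x. g x / c \<partial>M) = 1"
        using gc c by simp
      finally have "prob_space (density M f)"
        by (intro prob_spaceI) (simp add: f emeasure_density cong: nn_integral_cong)
      then interpret D: prob_space "density M f" .
      have 1: "real_distribution (distr (density M f) borel Z)"
        by (auto intro!: D.real_distribution_distr)
      have m: "measure (distr (density M f) borel Z) B = (\<integral>x. g x * indicator B (Z x) \<partial>M) / c"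
      proof -
        have "measure (distr (density M f) borel Z) B
            = (\<integral>x. indicator B x \<partial>distr (density M f) borel Z)"
          by simp
        also have "\<dots> = (\<integral>x. indicator B (Z x) \<partial>density M f)"
          by (intro integral_distr) (simp_all add: f)
        also have "\<dots> = (\<integral>x. (g x / c) * indicator B (Z x) \<partial>M)"
          unfolding f using g c by (subst integral_density) auto
        also have "\<dots> = (\<integral>x. g x * indicator B (Z x) \<partial>M) / c"
          by simp
        finally show ?thesis .
      qed
      have "char (distr (density M f) borel Z) u = (\<integral>x. g x *\<^sub>R iexp (u * Z x) \<partial>M) / c" for u
      proof -
        have "char (distr (density M f) borel Z) u = (\<integral>x. iexp (u * Z x) \<partial>density M f)"
          unfolding char_def by (intro integral_distr) (simp_all add: f)
        also have "\<dots> = (\<integral>x. (g x / c) *\<^sub>R iexp (u * Z x) \<partial>M)"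
          unfolding f using g c by (subst integral_density) auto
        also have "\<dots> = (\<integral>x. (g x *\<^sub>R iexp (u * Z x)) / c \<partial>M)"
          by (intro Bochner_Integration.integral_cong) (auto simp: scaleR_conv_of_real)
        also have "\<dots> = (\<integral>x. g x *\<^sub>R iexp (u * Z x) \<partial>M) / c"
          by simp
        finally show ?thesis .
      qed
      with 1 m show ?thesis by auto
    qed
    note P = normalized[OF mP \<open>prob_space P\<close> w c_def[symmetric] refl]
    note Q = normalized[OF mQ \<open>prob_space Q\<close> v c'[symmetric] refl]
    have "distr (density P (\<lambda>x. ennreal (w x / c))) borel X
        = distr (density Q (\<lambda>x. ennreal (v x / c))) borel Y"
      using P Q eq by (intro Levy_uniqueness) auto
    with P Q c show ?thesis by auto
  qed
qed

text \<open>
  The Cramer--Wold device, reduced to Levy's theorem on the line by treating one coordinate at a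
  time: the exponential in coordinate \<open>m\<close> is replaced by the indicator of a Borel set while the
  exponential of the remaining coordinates is kept. Levy's theorem needs nonnegative weights, so
  that exponential is expressed by the weights \<open>1\<close> and \<open>1 + cos (S + c)\<close>, whose
  characteristic functions are combinations of integrals that are already known to agree.
\<close>

lemma cramer_wold:
  fixes P Q :: "(nat \<Rightarrow> real) measure"
  assumes P: "prob_space P" and Q: "prob_space Q"
    and sP: "sets P = sets (\<Pi>\<^sub>M i\<in>{..<n}. borel)" and sQ: "sets Q = sets (\<Pi>\<^sub>M i\<in>{..<n}. borel)"
    and eq: "\<And>t. (\<integral>x. iexp (\<Sum>i<n. t i * x i) \<partial>P) = (\<integral>x. iexp (\<Sum>i<n. t i * x i) \<partial>Q)"
  shows "P = Q"
proof -
  interpret P: prob_space P by fact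
  interpret Q: prob_space Q by fact
  have coord: "(\<lambda>x. x i) \<in> borel_measurable P" "(\<lambda>x. x i) \<in> borel_measurable Q" if "i < n" for i
    using that by (simp_all add: measurable_cong_sets[OF sP refl] measurable_cong_sets[OF sQ refl])
  have sum_meas: "(\<lambda>x. \<Sum>i\<in>{m..<n}. t i * x i) \<in> borel_measurable P"
      "(\<lambda>x. \<Sum>i\<in>{m..<n}. t i * x i) \<in> borel_measurable Q" for m and t :: "nat \<Rightarrow> real"
    using coord by (auto intro!: borel_measurable_sum borel_measurable_times)
  define G where "G B m x = (\<Prod>i<m. indicator (B i) (x i) :: real)" for B m and x :: "nat \<Rightarrow> real"
  have G: "0 \<le> G B m x" "G B m x \<le> 1" for B m x
    unfolding G_def by (auto intro!: prod_nonneg prod_le_1)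
  have G_meas: "G B m \<in> borel_measurable P" "G B m \<in> borel_measurable Q"
    if "m \<le> n" "\<And>i. B i \<in> sets borel" for B m
    unfolding G_def using coord that
    by (auto intro!: borel_measurable_prod borel_measurable_indicator' simp: Int_def)
  have main: "(\<integral>x. G B m x *\<^sub>R iexp (\<Sum>i\<in>{m..<n}. t i * x i) \<partial>P)
      = (\<integral>x. G B m x *\<^sub>R iexp (\<Sum>i\<in>{m..<n}. t i * x i) \<partial>Q)"
    if "m \<le> n" "\<And>i. B i \<in> sets borel" for m B t
    using that
  proof (induction m arbitrary: t)
    case 0
    then show ?case using eq[of t] by (simp add: G_def lessThan_atLeast0)
  next
    case (Suc m)
    then have m: "m < n" and B: "\<And>i. B i \<in> sets borel" and IH: "\<And>t. (\<integral>x. G B m x *\<^sub>R iexp (\<Sum>i\<in>{m..<n}. t i * x i) \<partial>P)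
      = (\<integral>x. G B m x *\<^sub>R iexp (\<Sum>i\<in>{m..<n}. t i * x i) \<partial>Q)" by auto
    define S where "S x = (\<Sum>i\<in>{Suc m..<n}. t i * x i)" for x
    have S_split: "(\<Sum>i\<in>{m..<n}. (if i = m then u else a * t i) * x i) = u * x m + a * S x" for u a x
      unfolding S_def using m by (subst sum.atLeast_Suc_lessThan) (auto simp: sum_distrib_left mult.assoc)
    note [measurable] = coord[OF m] G_meas[OF less_imp_le[OF m] B]
    have [measurable]: "S \<in> borel_measurable P" "S \<in> borel_measurable Q"
      unfolding S_def[abs_def] by (rule sum_meas)+
    have shift: "(\<integral>x. G B m x *\<^sub>R iexp (u * x m + a * S x) \<partial>P) = (\<integral>x. G B m x *\<^sub>R iexp (u * x m + a * S x) \<partial>Q)"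
      for u a
      using IH[of "\<lambda>i. if i = m then u else a * t i"] unfolding S_split .
    \<comment> \<open>The offsets \<open>c = 0\<close> and \<open>c = - pi/2\<close> recover the real and the imaginary part of \<open>iexp (S x)\<close>.\<close>
    define w where "w c x = G B m x * (1 + cos (S x + c))" for c x
    have w: "0 \<le> w c x" "w c x \<le> 2" for c x
    proof -
      have "0 \<le> 1 + cos (S x + c)" "1 + cos (S x + c) \<le> 2"
        using cos_ge_minus_one[of "S x + c"] cos_le_one[of "S x + c"] by linarith+
      then show "0 \<le> w c x" "w c x \<le> 2"
        unfolding w_def using G[of B m x] by (auto intro: order_trans[OF mult_mono[of _ 1 _ 2]])
    qed
    have [measurable]: "w c \<in> borel_measurable P" "w c \<in> borel_measurable Q" for c
      unfolding w_def[abs_def] by measurable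
    have w_exp: "w c x *\<^sub>R iexp (u * x m) = G B m x *\<^sub>R iexp (u * x m + 0 * S x)
        + (iexp c / 2) * (G B m x *\<^sub>R iexp (u * x m + 1 * S x))
        + (iexp (- c) / 2) * (G B m x *\<^sub>R iexp (u * x m + (-1) * S x))" for c u x
    proof -
      have cos_cis: "complex_of_real (cos y) = (cis y + cis (- y)) / 2" for y
        by (simp add: complex_eq_iff)
      have split: "cis (S x + c) = cis (S x) * cis c" "cis (- (S x + c)) = cis (- S x) * cis (- c)"
          "cis (u * x m + 0 * S x) = cis (u * x m)" "cis (u * x m + 1 * S x) = cis (u * x m) * cis (S x)"
          "cis (u * x m + (-1) * S x) = cis (u * x m) * cis (- S x)"
        by (simp_all add: cis_mult)
      show ?thesis
        unfolding cis_conv_exp[symmetric]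
        unfolding w_def scaleR_conv_of_real of_real_mult of_real_add of_real_1 cos_cis split
        by (simp add: algebra_simps add_divide_distrib)
    qed
    have int: "integrable P (\<lambda>x. G B m x *\<^sub>R iexp (u * x m + a * S x))"
       "integrable Q (\<lambda>x. G B m x *\<^sub>R iexp (u * x m + a * S x))" for u a
      using G by (auto intro!: P.integrable_const_bound[of _ 1] Q.integrable_const_bound[of _ 1] simp: norm_exp_i_times)
    have w_eq: "(\<integral>x. w c x *\<^sub>R iexp (u * x m) \<partial>P) = (\<integral>x. w c x *\<^sub>R iexp (u * x m) \<partial>Q)" for c u
    proof -
      have lin: "(\<integral>x. f x + a * g x + b * h x \<partial>M) = (\<integral>x. f x \<partial>M) + a * (\<integral>x. g x \<partial>M) + b * (\<integral>x. h x \<partial>M)"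
        if "integrable M f" "integrable M g" "integrable M h"
        for a b and f g h :: "(nat \<Rightarrow> real) \<Rightarrow> complex" and M
        using that by simp
      show ?thesis
        unfolding w_exp lin[OF int(1) int(1) int(1)] lin[OF int(2) int(2) int(2)] shift ..
    qed
    have law: "(\<integral>x. w c x * indicator (B m) (x m) \<partial>P) = (\<integral>x. w c x * indicator (B m) (x m) \<partial>Q)" for c
      by (rule weighted_law_unique[where K=2, OF P Q]) (use w w_eq B in auto)
    have law0: "(\<integral>x. G B m x * indicator (B m) (x m) \<partial>P) = (\<integral>x. G B m x * indicator (B m) (x m) \<partial>Q)"
      by (rule weighted_law_unique[where K=1, OF P Q]) (use G B shift[of _ 0] in auto)
    note [measurable] = B
    have Gs: "G B (Suc m) x = G B m x * indicator (B m) (x m)" for x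
      by (simp add: G_def)
    have [measurable]: "G B (Suc m) \<in> borel_measurable P" "G B (Suc m) \<in> borel_measurable Q"
      using G_meas[OF _ B, of "Suc m"] m by auto
    have i1: "integrable P (\<lambda>x. G B (Suc m) x * cos (S x + c))" "integrable Q (\<lambda>x. G B (Suc m) x * cos (S x + c))"
         "integrable P (G B (Suc m))" "integrable Q (G B (Suc m))" for c
      using G[of B "Suc m"]
      by (auto intro!: P.integrable_const_bound[of _ 1] Q.integrable_const_bound[of _ 1] AE_I2 mult_le_one
          simp: abs_mult)
    have wG: "w c x * indicator (B m) (x m) = G B (Suc m) x + G B (Suc m) x * cos (S x + c)" for c x
      by (simp add: w_def Gs algebra_simps)
    have cos_eq: "(\<integral>x. G B (Suc m) x * cos (S x + c) \<partial>P) = (\<integral>x. G B (Suc m) x * cos (S x + c) \<partial>Q)" for c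
      using law[of c] law0 i1 unfolding wG by (simp add: Gs[symmetric])
    have e: "G B (Suc m) x *\<^sub>R iexp (S x) = of_real (G B (Suc m) x * cos (S x + 0)) + \<i> * of_real (G B (Suc m) x * cos (S x + (- (pi/2))))" for x
    proof -
      have "cos (S x + (- (pi/2))) = sin (S x)"
        by (simp add: cos_diff flip: diff_conv_add_uminus)
      then show ?thesis
        unfolding cis_conv_exp[symmetric] by (simp add: complex_eq_iff)
    qed
    have "(\<integral>x. G B (Suc m) x *\<^sub>R iexp (S x) \<partial>P) = (\<integral>x. G B (Suc m) x *\<^sub>R iexp (S x) \<partial>Q)"
    proof -
      have lin: "(\<integral>x. complex_of_real (f x) + \<i> * complex_of_real (g x) \<partial>M)
          = complex_of_real (\<integral>x. f x \<partial>M) + \<i> * complex_of_real (\<integral>x. g x \<partial>M)"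
        if "integrable M f" "integrable M g" for f g :: "(nat \<Rightarrow> real) \<Rightarrow> real" and M
        using that by simp
      show ?thesis
        unfolding e lin[OF i1(1) i1(1)] lin[OF i1(2) i1(2)] cos_eq ..
    qed
    then show ?case unfolding S_def .
  qed
  show ?thesis
  proof (rule measure_eqI_PiM_finite[where I="{..<n}" and M="\<lambda>_. borel" and A="\<lambda>_. \<Pi>\<^sub>E i\<in>{..<n}. UNIV"])
    fix A :: "nat \<Rightarrow> real set"
    assume A: "\<And>i. i \<in> {..<n} \<Longrightarrow> A i \<in> sets borel"
    define B where "B i = (if i < n then A i else {})" for i
    have B: "B i \<in> sets borel" for i using A by (simp add: B_def)
    have AB: "Pi\<^sub>E {..<n} A = Pi\<^sub>E {..<n} B" by (auto simp: B_def PiE_def Pi_def)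
    have "Pi\<^sub>E {..<n} B \<in> sets (\<Pi>\<^sub>M i\<in>{..<n}. borel)"
      using B by (intro sets_PiM_I_finite) auto
    then have S: "Pi\<^sub>E {..<n} B \<in> sets P" "Pi\<^sub>E {..<n} B \<in> sets Q" by (simp_all add: sP sQ)
    have GI: "G B n x = indicator (Pi\<^sub>E {..<n} B) x" if "x \<in> extensional {..<n}" for x
    proof (cases "\<forall>i<n. x i \<in> B i")
      case True then show ?thesis using that by (auto simp: G_def PiE_def indicator_def)
    next
      case False then show ?thesis using that by (auto simp: G_def PiE_def indicator_def Pi_def)
    qed
    have sp: "space P \<subseteq> extensional {..<n}" "space Q \<subseteq> extensional {..<n}"
      using sets_eq_imp_space_eq[OF sP] sets_eq_imp_space_eq[OF sQ] by (auto simp: space_PiM PiE_def)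
    have "complex_of_real (\<integral>x. G B n x \<partial>P) = complex_of_real (\<integral>x. G B n x \<partial>Q)"
      using main[OF _ B, of n] by (simp add: scaleR_conv_of_real)
    then have "(\<integral>x. G B n x \<partial>P) = (\<integral>x. G B n x \<partial>Q)" unfolding of_real_eq_iff .
    also have "(\<integral>x. G B n x \<partial>P) = (\<integral>x. indicator (Pi\<^sub>E {..<n} B) x \<partial>P)"
      using sp GI by (intro Bochner_Integration.integral_cong) auto
    also have "(\<integral>x. G B n x \<partial>Q) = (\<integral>x. indicator (Pi\<^sub>E {..<n} B) x \<partial>Q)"
      using sp GI by (intro Bochner_Integration.integral_cong) auto
    finally have "measure P (Pi\<^sub>E {..<n} B) = measure Q (Pi\<^sub>E {..<n} B)"
      using S by simp
    then show "P (Pi\<^sub>E {..<n} A) = Q (Pi\<^sub>E {..<n} A)"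
      unfolding AB by (simp add: P.emeasure_eq_measure Q.emeasure_eq_measure)
  next
    show "range (\<lambda>_::nat. \<Pi>\<^sub>E i\<in>{..<n}. UNIV) \<subseteq> prod_algebra {..<n} (\<lambda>_. borel :: real measure)"
      by (auto intro!: prod_algebraI_finite)
  qed (auto simp: sP sQ space_PiM)
qed

section \<open>Lattice sums of Gevrey weights\<close>

abbreviation lattice :: "nat \<Rightarrow> (nat \<Rightarrow> int) set" where
  "lattice d \<equiv> {..<d} \<rightarrow>\<^sub>E (UNIV :: int set)"

text \<open>
  The rate is a parameter of its own: \<open>c = 2\<beta>\<close> gives the variances of the Fourier coefficients and
  \<open>c = \<beta>\<close> their square roots.
\<close>

definition gevrey_weight :: "real \<Rightarrow> real \<Rightarrow> real \<Rightarrow> nat \<Rightarrow> (nat \<Rightarrow> int) \<Rightarrow> real" where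
  "gevrey_weight \<alpha> c p d k = exp (- c * p_norm p d k powr \<alpha>)"

abbreviation gevrey_sum :: "real \<Rightarrow> real \<Rightarrow> real \<Rightarrow> nat \<Rightarrow> real" where
  "gevrey_sum \<alpha> c p d \<equiv> infsum (gevrey_weight \<alpha> c p d) (lattice d)"

lemma gevrey_weight_pos: "0 < gevrey_weight \<alpha> c p d k"
  by (simp add: gevrey_weight_def)

lemma gevrey_weight_le_1: "c \<ge> 0 \<Longrightarrow> gevrey_weight \<alpha> c p d k \<le> 1"
  by (simp add: gevrey_weight_def)

text \<open>
  A finite set of lattice points lies in a box, and over a box the sum of a product factors.
\<close>

lemma lattice_sum_le_product:
  fixes f :: "int \<Rightarrow> real"
  assumes f: "\<And>j. 0 \<le> f j" and \<theta>: "\<And>m::nat. (\<Sum>j\<in>{- int m..int m}. f j) \<le> \<theta>" and c: "c \<ge> 0"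
    and g: "\<And>k. k \<in> lattice d \<Longrightarrow> 0 \<le> g k" "\<And>k. k \<in> lattice d \<Longrightarrow> g k \<le> c * (\<Prod>j<d. f (k j))"
  shows "g summable_on lattice d" "infsum g (lattice d) \<le> c * \<theta> ^ d"
proof -
  have fin: "sum g F \<le> c * \<theta> ^ d" if F: "finite F" "F \<subseteq> lattice d" for F
  proof -
    define m where "m = nat (Max (insert 0 ((\<lambda>(k, j). \<bar>k j\<bar>) ` (F \<times> {..<d}))))"
    have m: "\<bar>k j\<bar> \<le> int m" if "k \<in> F" "j < d" for k j
    proof -
      have "\<bar>k j\<bar> \<le> Max (insert 0 ((\<lambda>(k, j). \<bar>k j\<bar>) ` (F \<times> {..<d})))"
        using F that by (intro Max_ge) auto
      then show ?thesis unfolding m_def by linarith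
    qed
    have sub: "F \<subseteq> {..<d} \<rightarrow>\<^sub>E {- int m..int m}"
    proof
      fix k assume k: "k \<in> F"
      have "k j \<in> {- int m..int m}" if "j < d" for j
        using m[OF k that] by auto
      then show "k \<in> {..<d} \<rightarrow>\<^sub>E {- int m..int m}"
        using F k by (auto simp: PiE_def)
    qed
    have "sum g F \<le> (\<Sum>k\<in>F. c * (\<Prod>j<d. f (k j)))"
      using F g by (intro sum_mono) auto
    also have "\<dots> \<le> (\<Sum>k\<in>{..<d} \<rightarrow>\<^sub>E {- int m..int m}. c * (\<Prod>j<d. f (k j)))"
      using sub f c by (intro sum_mono2 finite_PiE) (auto intro!: mult_nonneg_nonneg prod_nonneg)
    also have "\<dots> = c * (\<Prod>j<d. \<Sum>i\<in>{- int m..int m}. f i)"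
      by (subst prod_sum_PiE) (auto simp: sum_distrib_left)
    also have "\<dots> \<le> c * (\<Prod>j<d. \<theta>)"
      using f \<theta> c by (intro mult_left_mono prod_mono) (auto intro!: sum_nonneg)
    finally show ?thesis by simp
  qed
  show s: "g summable_on lattice d"
    using g fin by (intro nonneg_bdd_above_summable_on) (auto intro!: bdd_aboveI2)
  show "infsum g (lattice d) \<le> c * \<theta> ^ d"
    using infsum_le_finite_sums[OF s fin] .
qed

lemma sum_symmetric_int:
  fixes h :: "real \<Rightarrow> real"
  shows "(\<Sum>j\<in>{- int m..int m}. h \<bar>real_of_int j\<bar>) = h 0 + 2 * (\<Sum>i=1..m. h (real i))"
proof (induction m)
  case (Suc m)
  have "{- int (Suc m)..int (Suc m)} = insert (- int (Suc m)) (insert (int (Suc m)) {- int m..int m})"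
    by auto
  then show ?case using Suc by (simp add: add.commute)
qed simp

lemma sum_inverse_squares_le: "(\<Sum>i=1..m. 1 / (real i)\<^sup>2) \<le> 2"
proof -
  have "(\<Sum>i=1..m. 1 / (real i)\<^sup>2) \<le> 2 - 1 / real m"
  proof (induction m)
    case (Suc m)
    show ?case
    proof (cases "m = 0")
      case False
      then have "1 / (real (Suc m))\<^sup>2 \<le> 1 / real m - 1 / real (Suc m)"
        by (simp add: divide_simps power2_eq_square)
      then show ?thesis using Suc by simp
    qed simp
  qed simp
  moreover have "1 / real m \<ge> 0" by simp
  ultimately show ?thesis by linarith
qed

text \<open>
  This is \<open>exp x = exp (x/N)\<^sup>N \<ge> (x/N)\<^sup>N\<close>. It serves to compare a stretched exponential with \<open>1 / i\<^sup>2\<close>,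
  keeping the dependence on the scale explicit.
\<close>

lemma exp_minus_le_power:
  assumes "x > 0" "N > 0"
  shows "exp (- x) \<le> (real N / x) ^ N"
proof -
  have "(x / real N) ^ N \<le> (exp (x / real N)) ^ N"
    using assms exp_ge_add_one_self[of "x / real N"]
    by (intro power_mono) (auto intro: order_trans[OF _ exp_ge_add_one_self])
  also have "\<dots> = exp x" using assms by (simp flip: exp_of_nat_mult)
  finally have "inverse (exp x) \<le> inverse ((x / real N) ^ N)"
    using assms by (intro le_imp_inverse_le) auto
  then show ?thesis by (simp add: exp_minus power_divide)
qed

lemma sum_exp_powr_le:
  fixes a b :: real
  assumes "a > 0" "b > 0" "N > 0" "real N * a \<ge> 2"
  shows "(\<Sum>i=1..m. exp (- b * real i powr a)) \<le> 2 * (real N / b) ^ N"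
proof -
  have "exp (- b * real i powr a) \<le> (real N / b) ^ N * (1 / (real i)\<^sup>2)" if "i \<in> {1..m}" for i
  proof -
    have i: "real i \<ge> 1" using that by auto
    have "exp (- (b * real i powr a)) \<le> (real N / (b * real i powr a)) ^ N"
      using assms i by (intro exp_minus_le_power) auto
    also have "\<dots> = (real N / b) ^ N * (1 / real i powr (real N * a))"
      using i by (simp add: power_divide power_mult_distrib powr_powr mult.commute flip: powr_realpow)
    also have "\<dots> \<le> (real N / b) ^ N * (1 / real i powr 2)"
      using assms i by (intro mult_left_mono divide_left_mono powr_mono) auto
    also have "real i powr 2 = (real i)\<^sup>2" using i by simp
    finally show ?thesis by simp
  qed
  then have "(\<Sum>i=1..m. exp (- b * real i powr a)) \<le> (\<Sum>i=1..m. (real N / b) ^ N * (1 / (real i)\<^sup>2))"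
    by (rule sum_mono)
  also have "\<dots> \<le> (real N / b) ^ N * 2"
    unfolding sum_distrib_left[symmetric] using assms sum_inverse_squares_le by (intro mult_left_mono) auto
  finally show ?thesis by simp
qed

lemma lattice_exponent_exists: "\<exists>N::nat. N > 0 \<and> real N * a \<ge> 2" if "a > 0" for a :: real
proof -
  obtain N :: nat where N: "2 / a \<le> real N" using real_arch_simple by blast
  moreover have "2 / a > 0" using that by simp
  ultimately have "real N > 0" by linarith
  then have "N > 0" by simp
  then show ?thesis using N that by (intro exI[of _ N]) (simp add: field_simps)
qed

lemma p_norm_ge_coordinate:
  assumes "p > 0" "j < d"
  shows "\<bar>real_of_int (k j)\<bar> \<le> p_norm p d k"
proof -
  have "\<bar>real_of_int (k j)\<bar> = (\<bar>real_of_int (k j)\<bar> powr p) powr (1 / p)"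
    using assms by (simp add: powr_powr)
  also have "\<dots> \<le> p_norm p d k"
    unfolding p_norm_def using assms by (intro powr_mono2 member_le_sum) auto
  finally show ?thesis .
qed

lemma sum_powr_le_p_norm:
  assumes "p > 0" "\<alpha> > 0"
  shows "(\<Sum>j<d. \<bar>real_of_int (k j)\<bar> powr \<alpha>) \<le> real d * p_norm p d k powr \<alpha>"
proof -
  have "(\<Sum>j<d. \<bar>real_of_int (k j)\<bar> powr \<alpha>) \<le> (\<Sum>j<d. p_norm p d k powr \<alpha>)"
    using assms p_norm_ge_coordinate by (intro sum_mono powr_mono2) auto
  then show ?thesis by simp
qed

text \<open>
  Every coordinate is at most the \<open>p\<close>-norm, so \<open>|k|\<^sub>p\<^sup>\<alpha>\<close> is at least the average of the \<open>|k\<^sub>j|\<^sup>\<alpha>\<close>. This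
  bounds the weight by a product of one-dimensional weights with rate \<open>c / d\<close>, at the price of a
  one-dimensional sum that grows like \<open>d\<^sup>N\<close>.
\<close>

lemma gevrey_sum_le:
  assumes "\<alpha> > 0" "c > 0" "p > 0" "d \<ge> 1" and N: "N > 0" "real N * \<alpha> \<ge> 2"
  shows "gevrey_weight \<alpha> c p d summable_on lattice d"
    "gevrey_sum \<alpha> c p d \<le> ((1 + 4 * (real N / c) ^ N) * real d ^ N) ^ d"
proof -
  define \<theta> where "\<theta> = (1 + 4 * (real N / c) ^ N) * real d ^ N"
  have \<theta>: "(\<Sum>j\<in>{- int m..int m}. exp (- (c / d) * \<bar>real_of_int j\<bar> powr \<alpha>)) \<le> \<theta>" for m
  proof -
    have "(\<Sum>j\<in>{- int m..int m}. exp (- (c / d) * \<bar>real_of_int j\<bar> powr \<alpha>))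
        = 1 + 2 * (\<Sum>i=1..m. exp (- (c / d) * real i powr \<alpha>))"
      using sum_symmetric_int[of "\<lambda>x. exp (- (c / d) * x powr \<alpha>)" m] by simp
    also have "\<dots> \<le> 1 + 2 * (2 * (real N / (c / d)) ^ N)"
      using assms by (intro add_left_mono mult_left_mono sum_exp_powr_le) auto
    also have "\<dots> = 1 + 4 * (real N / c) ^ N * real d ^ N"
      by (simp add: power_divide power_mult_distrib)
    also have "\<dots> \<le> \<theta>"
      unfolding \<theta>_def using assms by (simp add: algebra_simps)
    finally show ?thesis .
  qed
  have le: "gevrey_weight \<alpha> c p d k \<le> 1 * (\<Prod>j<d. exp (- (c / d) * \<bar>real_of_int (k j)\<bar> powr \<alpha>))" for k
  proof -
    have "(c / d) * (\<Sum>j<d. \<bar>real_of_int (k j)\<bar> powr \<alpha>) \<le> (c / d) * (real d * p_norm p d k powr \<alpha>)"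
      using assms by (intro mult_left_mono sum_powr_le_p_norm) auto
    also have "\<dots> = c * p_norm p d k powr \<alpha>" using assms by simp
    finally show ?thesis
      unfolding gevrey_weight_def by (simp add: sum_negf sum_distrib_left flip: exp_sum)
  qed
  note * = lattice_sum_le_product[where f="\<lambda>j. exp (- (c / d) * \<bar>real_of_int j\<bar> powr \<alpha>)" and c=1
      and g="gevrey_weight \<alpha> c p d" and d=d, OF _ \<theta> _ _ le]
  show "gevrey_weight \<alpha> c p d summable_on lattice d"
    by (rule *(1)) (auto intro: less_imp_le[OF gevrey_weight_pos])
  have "gevrey_sum \<alpha> c p d \<le> 1 * \<theta> ^ d"
    by (rule *(2)) (auto intro: less_imp_le[OF gevrey_weight_pos])
  then show "gevrey_sum \<alpha> c p d \<le> ((1 + 4 * (real N / c) ^ N) * real d ^ N) ^ d"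
    by (simp add: \<theta>_def)
qed

text \<open>
  The linear function exceeds the power only to the left of their crossing point
  \<open>(b / \<beta>)\<^bsup>1/(q-1)\<^esup>\<close>, where it is at most \<open>b\<close> times that point.
\<close>

lemma linear_le_powr:
  fixes b \<beta> q x :: real
  assumes "q > 1" "\<beta> > 0" "b > 0" "x \<ge> 0"
  shows "b * x \<le> \<beta> * x powr q + b * (b / \<beta>) powr (1 / (q - 1))"
proof (cases "x \<le> (b / \<beta>) powr (1 / (q - 1))")
  case True
  then have "b * x \<le> b * (b / \<beta>) powr (1 / (q - 1))" using assms by (intro mult_left_mono) auto
  moreover have "\<beta> * x powr q \<ge> 0" using assms by auto
  ultimately show ?thesis by linarith
next
  case False
  then have "((b / \<beta>) powr (1 / (q - 1))) powr (q - 1) \<le> x powr (q - 1)"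
    using assms by (intro powr_mono2) auto
  then have "b \<le> \<beta> * x powr (q - 1)" using assms by (simp add: powr_powr field_simps)
  then have "b * x \<le> \<beta> * x powr (q - 1) * x" using assms by (intro mult_right_mono) auto
  also have "\<dots> = \<beta> * x powr q"
    using False assms le_less_trans[OF powr_ge_zero[of "b / \<beta>" "1 / (q - 1)"], of x] by (simp add: powr_diff)
  finally show ?thesis using assms by (simp add: add_increasing2)
qed

text \<open>
  The previous inequality replaces the exponent \<open>c (\<Sum>|k\<^sub>j|\<^sup>p)\<^bsup>\<alpha>/p\<^esup>\<close> by \<open>b \<Sum>|k\<^sub>j|\<^sup>p\<close> minus a constant, and the
  latter factors over the coordinates. For the rate \<open>b = 1 + ln d\<close> each one-dimensional sum is
  \<open>1 + O(1/d)\<close>, so that their \<open>d\<close>-fold product stays bounded; only the constant depends on \<open>d\<close>, as a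
  power of \<open>b\<close>.
\<close>

lemma gevrey_sum_le_superlinear:
  assumes "p > 0" "\<alpha> > p" "c > 0" "d \<ge> 1" and N: "N > 0" "real N * p \<ge> 2"
  defines "b \<equiv> 1 + ln (real d)"
  shows "gevrey_sum \<alpha> c p d
      \<le> exp (b * (b / c) powr (1 / (\<alpha> / p - 1)) + 4 * real N ^ N)"
proof -
  define q where "q = \<alpha> / p"
  define S where "S = 4 * real N ^ N"
  define C where "C = b * (b / c) powr (1 / (q - 1))"
  have q: "q > 1" using assms by (simp add: q_def)
  have b: "b \<ge> 1" using assms by (simp add: b_def)
  have \<theta>: "(\<Sum>j\<in>{- int m..int m}. exp (- b * \<bar>real_of_int j\<bar> powr p)) \<le> 1 + S / d" for m
  proof -
    \<comment> \<open>The factor \<open>exp (1 - b) = 1/d\<close> keeps the \<open>d\<close>-fold product bounded, and rate \<open>1\<close> remains for convergence.\<close>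
    have one: "exp (- b * real i powr p) \<le> exp (1 - b) * exp (- 1 * real i powr p)" if "i \<in> {1..m}" for i
    proof -
      have "real i powr p \<ge> 1" using that assms by (intro ge_one_powr_ge_zero) auto
      then have "(b - 1) * (real i powr p - 1) \<ge> 0" using b by auto
      then show ?thesis by (simp flip: exp_add add: algebra_simps)
    qed
    have "(\<Sum>j\<in>{- int m..int m}. exp (- b * \<bar>real_of_int j\<bar> powr p))
        = 1 + 2 * (\<Sum>i=1..m. exp (- b * real i powr p))"
      using sum_symmetric_int[of "\<lambda>x. exp (- b * x powr p)" m] by simp
    also have "\<dots> \<le> 1 + 2 * (\<Sum>i=1..m. exp (1 - b) * exp (- 1 * real i powr p))"
      using one by (intro add_left_mono mult_left_mono sum_mono) auto
    also have "\<dots> \<le> 1 + 2 * (exp (1 - b) * (2 * (real N / 1) ^ N))"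
      unfolding sum_distrib_left[symmetric] using assms
      by (intro add_left_mono mult_left_mono sum_exp_powr_le) auto
    also have "exp (1 - b) = 1 / d" using assms by (simp add: b_def exp_minus field_simps)
    finally show ?thesis by (simp add: S_def)
  qed
  have le: "gevrey_weight \<alpha> c p d k \<le> exp C * (\<Prod>j<d. exp (- b * \<bar>real_of_int (k j)\<bar> powr p))" for k
  proof -
    define x where "x = (\<Sum>j<d. \<bar>real_of_int (k j)\<bar> powr p)"
    have "x \<ge> 0" unfolding x_def by (intro sum_nonneg) auto
    then have "b * x \<le> c * x powr q + C"
      unfolding C_def using q b assms(3) by (intro linear_le_powr) auto
    moreover have "p_norm p d k powr \<alpha> = x powr q"
      by (simp add: p_norm_def x_def powr_powr q_def)
    moreover have "(\<Prod>j<d. exp (- b * \<bar>real_of_int (k j)\<bar> powr p)) = exp (- b * x)"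
      unfolding x_def by (simp add: sum_distrib_left flip: exp_sum)
    ultimately show ?thesis
      by (simp add: gevrey_weight_def flip: exp_add)
  qed
  have "gevrey_sum \<alpha> c p d \<le> exp C * (1 + S / d) ^ d"
    by (rule lattice_sum_le_product(2)[where f="\<lambda>j. exp (- b * \<bar>real_of_int j\<bar> powr p)", OF _ \<theta> _ _ le])
      (auto intro: less_imp_le[OF gevrey_weight_pos])
  also have "(1 + S / d) ^ d \<le> (exp (S / d)) ^ d"
    using exp_ge_add_one_self[of "S / d"] by (intro power_mono) (auto simp: S_def)
  also have "\<dots> = exp S" using assms by (simp flip: exp_of_nat_mult)
  finally show ?thesis by (simp add: C_def S_def q_def flip: exp_add)
qed

lemma gevrey_sum_ge_1:
  assumes "\<alpha> > 0" "c > 0" "p > 0" "d \<ge> 1"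
  shows "1 \<le> gevrey_sum \<alpha> c p d"
proof -
  obtain N where N: "N > 0" "real N * \<alpha> \<ge> 2" using lattice_exponent_exists assms by metis
  have "sum (gevrey_weight \<alpha> c p d) {\<lambda>j\<in>{..<d}. 0} \<le> gevrey_sum \<alpha> c p d"
    using gevrey_sum_le(1)[OF assms N]
    by (intro finite_sum_le_infsum) (auto intro: less_imp_le[OF gevrey_weight_pos])
  then show ?thesis using assms by (simp add: gevrey_weight_def p_norm_def)
qed

lemma ln_gevrey_sum_small_o:
  assumes "\<alpha> > 0" "c > 0" "p > 0" and t: "t > 1 \<or> (\<alpha> > p \<and> t > 0)"
  shows "((\<lambda>d. ln (gevrey_sum \<alpha> c p d) / real d powr t) \<longlongrightarrow> 0) sequentially"
proof -
  let ?M = "\<lambda>d. gevrey_sum \<alpha> c p d"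
  have "\<exists>h. (\<forall>d\<ge>1. ln (?M d) \<le> h d) \<and> ((\<lambda>d. h d / real d powr t) \<longlongrightarrow> 0) sequentially"
    using t
  proof
    assume t: "t > 1"
    obtain N where N: "N > 0" "real N * \<alpha> \<ge> 2" using lattice_exponent_exists assms by metis
    define C where "C = 1 + 4 * (real N / c) ^ N"
    have C: "C > 0" unfolding C_def using assms by (intro add_pos_nonneg) auto
    have "ln (?M d) \<le> real d * (ln C + real N * ln (real d))" if d: "d \<ge> 1" for d
    proof -
      have "?M d \<ge> 1" using gevrey_sum_ge_1 assms d by auto
      then have "ln (?M d) \<le> ln ((C * real d ^ N) ^ d)"
        using gevrey_sum_le(2)[OF assms(1-3) d N] unfolding C_def by simp
      also have "\<dots> = real d * (ln C + real N * ln (real d))"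
        using C d by (simp add: ln_realpow ln_mult)
      finally show ?thesis .
    qed
    moreover have "((\<lambda>d. real d * (ln C + real N * ln (real d)) / real d powr t) \<longlongrightarrow> 0) sequentially"
    proof -
      have "((\<lambda>d. real d / real d powr t) \<longlongrightarrow> 0) sequentially"
          "((\<lambda>d. real d * ln (real d) / real d powr t) \<longlongrightarrow> 0) sequentially"
        using t by real_asymp+
      from tendsto_add[OF tendsto_mult_right_zero[OF this(1), of "ln C"] tendsto_mult_right_zero[OF this(2), of "real N"]]
      show ?thesis by (simp add: algebra_simps add_divide_distrib)
    qed
    ultimately show ?thesis
      by (intro exI[of _ "\<lambda>d. real d * (ln C + real N * ln (real d))"] conjI allI impI)
  next
    assume t: "\<alpha> > p \<and> t > 0"
    obtain N where N: "N > 0" "real N * p \<ge> 2" using lattice_exponent_exists assms by metis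
    define r where "r = 1 / (\<alpha> / p - 1)"
    have r: "r > 0" using t assms by (simp add: r_def)
    have "ln (?M d) \<le> (1 + ln (real d)) * ((1 + ln (real d)) / c) powr r + 4 * real N ^ N" if d: "d \<ge> 1" for d
    proof -
      have "?M d \<ge> 1" using gevrey_sum_ge_1 assms d by auto
      then have "ln (?M d) \<le> ln (exp ((1 + ln (real d)) * ((1 + ln (real d)) / c) powr r + 4 * real N ^ N))"
        using gevrey_sum_le_superlinear[OF assms(3) conjunct1[OF t] assms(2) d N] unfolding r_def
        by (intro iffD2[OF ln_le_cancel_iff]) auto
      then show ?thesis by simp
    qed
    moreover have "((\<lambda>d. ((1 + ln (real d)) * ((1 + ln (real d)) / c) powr r + K) / real d powr t) \<longlongrightarrow> 0) sequentially" for K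
    proof -
      have "((\<lambda>d. (1 + ln (real d)) powr (1 + r) / real d powr t) \<longlongrightarrow> 0) sequentially"
        using t r by real_asymp
      moreover have "((\<lambda>d. 1 / real d powr t) \<longlongrightarrow> 0) sequentially"
        using t by real_asymp
      ultimately have "((\<lambda>d. (1 / c) powr r * ((1 + ln (real d)) powr (1 + r) / real d powr t) + K * (1 / real d powr t))
          \<longlongrightarrow> (1 / c) powr r * 0 + K * 0) sequentially"
        by (intro tendsto_intros)
      then have "((\<lambda>d. (1 / c) powr r * ((1 + ln (real d)) powr (1 + r) / real d powr t) + K * (1 / real d powr t))
          \<longlongrightarrow> 0) sequentially" by simp
      then show ?thesis
      proof (rule Lim_transform_eventually)
        show "\<forall>\<^sub>F d in sequentially. (1 / c) powr r * ((1 + ln (real d)) powr (1 + r) / real d powr t) + K * (1 / real d powr t)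
            = ((1 + ln (real d)) * ((1 + ln (real d)) / c) powr r + K) / real d powr t"
          using eventually_ge_at_top[of 1]
        proof eventually_elim
          case (elim d)
          define b where "b = 1 + ln (real d)"
          have "b > 0" using elim by (simp add: b_def add_pos_nonneg)
          then show ?case
            using \<open>c > 0\<close> unfolding b_def[symmetric] by (simp add: powr_add powr_divide add_divide_distrib)
        qed
      qed
    qed
    ultimately show ?thesis
      by (intro exI[of _ "\<lambda>d. (1 + ln (real d)) * ((1 + ln (real d)) / c) powr r + 4 * real N ^ N"] conjI allI impI)
  qed
  then obtain h where h: "\<And>d. d \<ge> 1 \<Longrightarrow> ln (?M d) \<le> h d" "((\<lambda>d. h d / real d powr t) \<longlongrightarrow> 0) sequentially"
    by blast
  show ?thesis
  proof (rule tendsto_sandwich[OF _ _ tendsto_const h(2)])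
    show "\<forall>\<^sub>F d in sequentially. 0 \<le> ln (?M d) / real d powr t"
      using eventually_ge_at_top[of 1] by eventually_elim (use gevrey_sum_ge_1 assms in auto)
    show "\<forall>\<^sub>F d in sequentially. ln (?M d) / real d powr t \<le> h d / real d powr t"
      using eventually_ge_at_top[of 1] by eventually_elim (use h in \<open>auto intro!: divide_right_mono\<close>)
  qed
qed

text \<open>
  On frequencies with entries in \<open>{-1, 0, 1}\<close> the exponent is \<open>c m\<^bsup>\<alpha>/p\<^esup> \<le> c m\<close>, where \<open>m\<close> is the number of nonzero
  entries, and \<open>exp (- c m)\<close> is a product over the coordinates.
\<close>

lemma gevrey_sum_exponential:
  assumes "\<alpha> > 0" "c > 0" "p > 0" "d \<ge> 1" "\<alpha> \<le> p"
  shows "(1 + 2 * exp (- c)) ^ d \<le> gevrey_sum \<alpha> c p d"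
proof -
  obtain N where N: "N > 0" "real N * \<alpha> \<ge> 2" using lattice_exponent_exists assms by metis
  let ?K = "{..<d} \<rightarrow>\<^sub>E {-1, 0, 1::int}"
  have le: "(\<Prod>j<d. exp (- c * \<bar>real_of_int (k j)\<bar>)) \<le> gevrey_weight \<alpha> c p d k" if k: "k \<in> ?K" for k
  proof -
    define m where "m = (\<Sum>j<d. \<bar>k j\<bar>)"
    have "(\<Sum>j<d. \<bar>real_of_int (k j)\<bar> powr p) = (\<Sum>j<d. \<bar>real_of_int (k j)\<bar>)"
    proof (intro sum.cong refl)
      fix j assume "j \<in> {..<d}"
      then have "k j \<in> {-1, 0, 1}" using k by auto
      then show "\<bar>real_of_int (k j)\<bar> powr p = \<bar>real_of_int (k j)\<bar>" by auto
    qed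
    also have "\<dots> = real_of_int m" by (simp add: m_def)
    finally have "p_norm p d k powr \<alpha> = real_of_int m powr (\<alpha> / p)"
      by (simp add: p_norm_def powr_powr)
    also have "\<dots> \<le> real_of_int m"
    proof (cases "m = 0")
      case False
      have "m \<ge> 0" unfolding m_def by (intro sum_nonneg) auto
      with False have "m \<ge> 1" by linarith
      then have "real_of_int m powr (\<alpha> / p) \<le> real_of_int m powr 1"
        using assms by (intro powr_mono) auto
      then show ?thesis using \<open>m \<ge> 1\<close> by simp
    qed simp
    finally have "- c * (\<Sum>j<d. \<bar>real_of_int (k j)\<bar>) \<le> - c * p_norm p d k powr \<alpha>"
      using assms by (simp add: m_def)
    then show ?thesis by (simp add: gevrey_weight_def sum_distrib_left flip: exp_sum)
  qed
  have "(1 + 2 * exp (- c)) ^ d = (\<Prod>j<d. \<Sum>i\<in>{-1, 0, 1::int}. exp (- c * \<bar>real_of_int i\<bar>))"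
    by (simp add: add.commute)
  also have "\<dots> = (\<Sum>k\<in>?K. \<Prod>j<d. exp (- c * \<bar>real_of_int (k j)\<bar>))"
    by (rule prod_sum_PiE) auto
  also have "\<dots> \<le> sum (gevrey_weight \<alpha> c p d) ?K"
    using le by (intro sum_mono) auto
  also have "\<dots> \<le> gevrey_sum \<alpha> c p d"
    using gevrey_sum_le(1)[OF assms(1-4) N]
    by (intro finite_sum_le_infsum finite_PiE) (auto intro: less_imp_le[OF gevrey_weight_pos])
  finally show ?thesis .
qed

text \<open>
  The indicators of the \<open>m\<close>-element sets of coordinates are frequencies of equal weight.
\<close>

lemma gevrey_sum_ge_binomial:
  assumes "\<alpha> > 0" "c > 0" "p > 0" "d \<ge> 1"
  shows "real (d choose m) * exp (- c * real m powr (\<alpha> / p)) \<le> gevrey_sum \<alpha> c p d"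
proof -
  obtain N where N: "N > 0" "real N * \<alpha> \<ge> 2" using lattice_exponent_exists assms by metis
  define S where "S = {A. A \<subseteq> {..<d} \<and> card A = m}"
  define e where "e A = (\<lambda>j\<in>{..<d}. if j \<in> A then 1 else 0 :: int)" for A
  have fS: "finite S" unfolding S_def by (rule finite_subset[of _ "Pow {..<d}"]) auto
  have "inj_on e S"
  proof (rule inj_onI)
    fix A B assume A: "A \<in> S" and B: "B \<in> S" and eq: "e A = e B"
    have "j \<in> A \<longleftrightarrow> j \<in> B" for j
    proof (cases "j < d")
      case True
      then show ?thesis
        using fun_cong[OF eq, of j] by (simp add: e_def split: if_splits)
    next
      case False
      then show ?thesis
        using A B by (auto simp: S_def)
    qed
    then show "A = B" by blast
  qed
  have w: "gevrey_weight \<alpha> c p d (e A) = exp (- c * real m powr (\<alpha> / p))" if "A \<in> S" for A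
  proof -
    have "(\<Sum>j<d. \<bar>real_of_int (e A j)\<bar> powr p) = (\<Sum>j<d. if j \<in> A then 1 else 0)"
      by (intro sum.cong) (auto simp: e_def)
    also have "\<dots> = real m"
      using that by (simp add: S_def sum.If_cases Int_absorb1)
    finally show ?thesis by (simp add: gevrey_weight_def p_norm_def powr_powr)
  qed
  have "real (d choose m) * exp (- c * real m powr (\<alpha> / p)) = (\<Sum>A\<in>S. gevrey_weight \<alpha> c p d (e A))"
    using w n_subsets[of "{..<d}" m] by (simp add: S_def)
  also have "\<dots> = sum (gevrey_weight \<alpha> c p d) (e ` S)"
    using \<open>inj_on e S\<close> by (simp add: sum.reindex)
  also have "\<dots> \<le> gevrey_sum \<alpha> c p d"
  proof (rule finite_sum_le_infsum[OF gevrey_sum_le(1)[OF assms N]])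
    show "e ` S \<subseteq> lattice d"
      unfolding e_def by (intro image_subsetI) simp
  qed (use fS in \<open>auto intro: less_imp_le[OF gevrey_weight_pos]\<close>)
  finally show ?thesis .
qed

section \<open>Continuous and square integrable functions on the torus\<close>

lemma torus_UNIV: "torus d = (\<Pi>\<^sub>E j\<in>UNIV. if j < d then {0..2*pi} else {undefined})"
  by (auto simp: torus_def PiE_def Pi_def extensional_def split: if_splits)

lemma compact_torus: "compact (torus d)"
proof -
  have "compactin (product_topology (\<lambda>i. euclidean) UNIV) (torus d)"
    unfolding torus_UNIV compactin_PiE by auto
  then show ?thesis by (simp add: euclidean_product_topology compactin_euclidean_iff)
qed

lemma torus_nonempty: "torus d \<noteq> {}"
  by (auto simp: torus_def PiE_eq_empty_iff)

lemma C_torus_continuous: "f \<in> C_torus d \<Longrightarrow> continuous_on (torus d) f"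
  by (simp add: C_torus_def)

lemma C_torus_bdd_above:
  assumes "f \<in> C_torus d" shows "bdd_above ((\<lambda>x. \<bar>f x\<bar>) ` torus d)"
  by (intro compact_imp_bounded[THEN bounded_imp_bdd_above] compact_continuous_image
      continuous_intros C_torus_continuous[OF assms] compact_torus)

lemma abs_le_sup_norm: "f \<in> C_torus d \<Longrightarrow> x \<in> torus d \<Longrightarrow> \<bar>f x\<bar> \<le> sup_norm d f"
  unfolding sup_norm_def by (intro cSUP_upper C_torus_bdd_above)

lemma sup_norm_nonneg: "f \<in> C_torus d \<Longrightarrow> 0 \<le> sup_norm d f"
proof -
  assume f: "f \<in> C_torus d"
  obtain x where "x \<in> torus d" using torus_nonempty by blast
  from abs_le_sup_norm[OF f this] show ?thesis by linarith
qed

lemma C_torus_lincomb: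
  assumes "f \<in> C_torus d" "g \<in> C_torus d"
  shows "(\<lambda>x\<in>torus d. a * f x + b * g x) \<in> C_torus d"
proof -
  have "continuous_on (torus d) (\<lambda>x. a * f x + b * g x)"
    using assms by (intro continuous_intros C_torus_continuous)
  then have "continuous_on (torus d) (\<lambda>x\<in>torus d. a * f x + b * g x)"
    by (rule continuous_on_eq) auto
  moreover have "a * f x + b * g x = a * f y + b * g y"
    if "x \<in> torus d" "y \<in> torus d" "torus_eq d x y" for x y
  proof -
    have "f x = f y" "g x = g y"
      using assms that unfolding C_torus_def by blast+
    then show ?thesis by simp
  qed
  ultimately show ?thesis by (auto simp: C_torus_def)
qed

definition circle_measure :: "real measure" where
  "circle_measure = uniform_measure (restrict_space lborel {0..2*pi}) {0..2*pi}"

lemma space_circle_measure [simp]: "space circle_measure = {0..2*pi}"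
  by (simp add: circle_measure_def space_restrict_space)

lemma sets_circle_measure: "sets circle_measure = sets (restrict_space borel {0..2*pi})"
  using sets_restrict_space_cong[OF sets_lborel] by (simp add: circle_measure_def)

lemma emeasure_circle: "emeasure (restrict_space lborel {0..2*pi}) {0..2*pi} = ennreal (2 * pi)"
  by (simp add: emeasure_restrict_space)

lemma prob_space_circle_measure: "prob_space circle_measure"
  unfolding circle_measure_def by (rule prob_space_uniform_measure) (simp_all add: emeasure_circle)

lemma torus_measure_PiM: "torus_measure d = (\<Pi>\<^sub>M j\<in>{..<d}. circle_measure)"
  by (simp add: torus_measure_def circle_measure_def)

lemma prob_space_torus_measure: "prob_space (torus_measure d)"
  unfolding torus_measure_PiM by (intro prob_space_PiM prob_space_circle_measure)

lemma space_torus_measure [simp]: "space (torus_measure d) = torus d"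
  by (simp add: torus_measure_PiM space_PiM torus_def)

lemma measurable_torus_coordinate [measurable]:
  "j < d \<Longrightarrow> (\<lambda>x. x j) \<in> borel_measurable (torus_measure d)"
proof -
  assume j: "j < d"
  have "(\<lambda>x. x) \<in> measurable circle_measure borel"
    unfolding measurable_cong_sets[OF sets_circle_measure refl] by (intro measurable_restrict_space1) simp
  from measurable_compose[OF measurable_component_singleton[of j "{..<d}" "\<lambda>_. circle_measure"] this] j
  show ?thesis unfolding torus_measure_PiM by auto
qed

lemma measurable_torus_inclusion: "(\<lambda>x. x) \<in> measurable (torus_measure d) (restrict_space borel (torus d))"
proof (rule measurable_restrict_space2)
  show "(\<lambda>x. x) \<in> borel_measurable (torus_measure d)"
  proof (rule measurable_coordinatewise_then_product)
    fix j :: nat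
    show "(\<lambda>x. x j) \<in> borel_measurable (torus_measure d)"
    proof (cases "j < d")
      case False
      then have "x j = undefined" if "x \<in> space (torus_measure d)" for x
        using that by (auto simp: torus_def PiE_def extensional_def)
      then show ?thesis
        using measurable_cong[of "torus_measure d" "\<lambda>x. x j" "\<lambda>_. undefined" borel] by simp
    qed measurable
  qed
qed simp

lemma continuous_torus_measurable:
  "continuous_on (torus d) f \<Longrightarrow> f \<in> borel_measurable (torus_measure d)"
  using measurable_compose[OF measurable_torus_inclusion borel_measurable_continuous_on_restrict] by blast

lemma C_torus_measurable: "f \<in> C_torus d \<Longrightarrow> f \<in> borel_measurable (torus_measure d)"
  by (intro continuous_torus_measurable C_torus_continuous)

lemma bounded_L2_torus:
  assumes "f \<in> borel_measurable (torus_measure d)" "\<And>x. x \<in> torus d \<Longrightarrow> \<bar>f x\<bar> \<le> B"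
  shows "f \<in> L2_torus d"
proof -
  interpret prob_space "torus_measure d" by (rule prob_space_torus_measure)
  have "\<bar>f x\<bar>\<^sup>2 \<le> B\<^sup>2" if "x \<in> torus d" for x
    using assms(2)[OF that] by (intro power_mono) auto
  then show ?thesis
    unfolding L2_torus_def using assms(1)
    by (auto intro!: integrable_const_bound[of _ "B\<^sup>2"] AE_I2)
qed

lemma C_torus_L2: "f \<in> C_torus d \<Longrightarrow> f \<in> L2_torus d"
  by (rule bounded_L2_torus[OF C_torus_measurable abs_le_sup_norm])

lemma L2_torusD:
  assumes "f \<in> L2_torus d"
  shows "f \<in> borel_measurable (torus_measure d)" "integrable (torus_measure d) (\<lambda>x. (f x)\<^sup>2)"
    "integrable (torus_measure d) f"
proof -
  interpret prob_space "torus_measure d" by (rule prob_space_torus_measure)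
  show 1: "f \<in> borel_measurable (torus_measure d)" "integrable (torus_measure d) (\<lambda>x. (f x)\<^sup>2)"
    using assms by (auto simp: L2_torus_def)
  then show "integrable (torus_measure d) f"
    by (rule square_integrable_imp_integrable)
qed

lemma L2_torus_diff:
  assumes "f \<in> L2_torus d" "g \<in> L2_torus d"
  shows "(\<lambda>x. f x - g x) \<in> L2_torus d"
proof -
  have [measurable]: "f \<in> borel_measurable (torus_measure d)" "g \<in> borel_measurable (torus_measure d)"
    using assms by (auto simp: L2_torus_def)
  have "integrable (torus_measure d) (\<lambda>x. 2 * (f x)\<^sup>2 + 2 * (g x)\<^sup>2)"
    using L2_torusD[OF assms(1)] L2_torusD[OF assms(2)] by auto
  then have "integrable (torus_measure d) (\<lambda>x. (f x - g x)\<^sup>2)"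
  proof (rule Bochner_Integration.integrable_bound)
    have "(f x - g x)\<^sup>2 \<le> 2 * (f x)\<^sup>2 + 2 * (g x)\<^sup>2" for x
      using sum_squares_ge_zero[of "f x + g x" 0] by (simp add: power2_eq_square algebra_simps)
    then show "AE x in torus_measure d. norm ((f x - g x)\<^sup>2) \<le> norm (2 * (f x)\<^sup>2 + 2 * (g x)\<^sup>2)"
      by auto
  qed measurable
  then show ?thesis by (simp add: L2_torus_def)
qed

lemma L2_norm_power2: "f \<in> L2_torus d \<Longrightarrow> (L2_norm d f)\<^sup>2 = (\<integral>x. (f x)\<^sup>2 \<partial>torus_measure d)"
  by (simp add: L2_norm_def)

definition character :: "nat \<Rightarrow> (nat \<Rightarrow> int) \<Rightarrow> (nat \<Rightarrow> real) \<Rightarrow> complex" where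
  "character d k x = cis (\<Sum>j<d. real_of_int (k j) * x j)"

lemma norm_character [simp]: "norm (character d k x) = 1"
  by (simp add: character_def)

lemma measurable_cis [measurable]: "cis \<in> borel_measurable borel"
  by (intro borel_measurable_continuous_onI continuous_intros)

lemma character_measurable [measurable]: "character d k \<in> borel_measurable (torus_measure d)"
  unfolding character_def[abs_def] by measurable

lemma integral_circle_cis:
  "(\<integral>x. cis (real_of_int m * x) \<partial>circle_measure) = (if m = 0 then 1 else 0)"
proof (cases "m = 0")
  case True
  interpret prob_space circle_measure by (rule prob_space_circle_measure)
  show ?thesis using True prob_space by simp
next
  case False
  let ?R = "restrict_space lborel {0..2*pi}"
  have um: "circle_measure = density ?R (\<lambda>x. ennreal (1 / (2 * pi)))"
    unfolding circle_measure_def uniform_measure_def emeasure_circle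
    by (intro density_cong measurable_restrict_space1)
       (auto simp: space_restrict_space divide_ennreal[symmetric] intro!: AE_I2)
  have "(\<integral>x. cis (real_of_int m * x) \<partial>circle_measure) = (\<integral>x. (1 / (2 * pi)) *\<^sub>R cis (real_of_int m * x) \<partial>?R)"
    unfolding um by (subst integral_density) (auto intro!: measurable_restrict_space1)
  also have "\<dots> = (1 / (2 * pi)) *\<^sub>R (\<integral>x. indicator {0..2*pi} x *\<^sub>R cis (real_of_int m * x) \<partial>lborel)"
    by (simp add: integral_restrict_space)
  also have "(\<integral>x. indicator {0..2*pi} x *\<^sub>R cis (real_of_int m * x) \<partial>lborel)
      = cis (real_of_int m * (2*pi)) / (\<i> * m) - cis (real_of_int m * 0) / (\<i> * m)"
  proof (rule integral_FTC_Icc)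
    fix x :: real
    have "((\<lambda>z. exp (\<i> * m * z) / (\<i> * m)) has_field_derivative exp (\<i> * m * z)) (at z within S)" for z S
      using False by (auto intro!: derivative_eq_intros)
    then have "((\<lambda>z. exp (\<i> * m * z) / (\<i> * m)) \<circ> complex_of_real has_vector_derivative
        1 * exp (\<i> * m * complex_of_real x)) (at x within {0..2*pi})"
      by (intro field_vector_diff_chain_within) (auto intro!: derivative_eq_intros)
    then show "((\<lambda>x. cis (real_of_int m * x) / (\<i> * m)) has_vector_derivative cis (real_of_int m * x))
        (at x within {0..2*pi})"
      by (simp add: o_def cis_conv_exp mult.assoc)
  qed (auto intro!: continuous_intros)
  also have "\<dots> = 0"
    using cis_multiple_2pi[of "real_of_int m"] by (simp add: mult.commute)
  finally show ?thesis using False by simp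
qed

lemma integral_character:
  "(\<integral>x. character d k x * cnj (character d l x) \<partial>torus_measure d) = (if \<forall>j<d. k j = l j then 1 else 0)"
proof -
  interpret product_prob_space "\<lambda>_::nat. circle_measure"
    by (intro product_prob_spaceI prob_space_circle_measure)
  have int: "integrable circle_measure (\<lambda>x. cis (real_of_int m * x))" for m
  proof -
    have "(\<lambda>x. cis (real_of_int m * x)) \<in> borel_measurable circle_measure"
      unfolding measurable_cong_sets[OF sets_circle_measure refl]
      by (intro measurable_restrict_space1) measurable
    then show ?thesis
      by (intro finite_measure.integrable_const_bound[where B=1] prob_space.finite_measure prob_space_circle_measure) simp_all
  qed
  have "character d k x * cnj (character d l x) = (\<Prod>j\<in>{..<d}. cis (real_of_int (k j - l j) * x j))" for x
  proof -
    have prod: "(\<Prod>j<n. cis (g j)) = cis (\<Sum>j<n. g j)" for n :: nat and g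
      by (induction n) (auto simp: cis_mult)
    show ?thesis
      unfolding prod character_def
      by (simp add: cis_cnj cis_mult sum_subtractf algebra_simps)
  qed
  then have "(\<integral>x. character d k x * cnj (character d l x) \<partial>torus_measure d)
      = (\<Prod>j\<in>{..<d}. \<integral>x. cis (real_of_int (k j - l j) * x) \<partial>circle_measure)"
    unfolding torus_measure_PiM using int by (simp only:) (rule product_integral_prod, simp_all only: finite_lessThan)
  also have "\<dots> = (\<Prod>j<d. if k j = l j then 1 else 0)"
    unfolding integral_circle_cis by simp
  also have "\<dots> = (if \<forall>j<d. k j = l j then 1 else 0)"
    by (auto simp: prod_zero_iff)
  finally show ?thesis .
qed

lemma lattice_eq_iff: "k \<in> lattice d \<Longrightarrow> l \<in> lattice d \<Longrightarrow> (\<forall>j<d. k j = l j) \<longleftrightarrow> k = l"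
  using PiE_ext[of k "{..<d}" "\<lambda>_. UNIV" l] by auto

definition fourier :: "nat \<Rightarrow> ((nat \<Rightarrow> real) \<Rightarrow> real) \<Rightarrow> (nat \<Rightarrow> int) \<Rightarrow> complex" where
  "fourier d f k = (\<integral>x. complex_of_real (f x) * cnj (character d k x) \<partial>torus_measure d)"

lemma integrable_fourier:
  assumes "f \<in> L2_torus d"
  shows "integrable (torus_measure d) (\<lambda>x. complex_of_real (f x) * cnj (character d k x))"
proof (rule Bochner_Integration.integrable_bound[OF L2_torusD(3)[OF assms]])
  have [measurable]: "f \<in> borel_measurable (torus_measure d)" by (rule L2_torusD[OF assms])
  show "(\<lambda>x. complex_of_real (f x) * cnj (character d k x)) \<in> borel_measurable (torus_measure d)"
    by (intro borel_measurable_times borel_measurable_of_real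
      borel_measurable_continuous_on[of cnj] continuous_intros) measurable
qed (simp add: norm_mult)

lemma fourier_lincomb:
  assumes "f \<in> L2_torus d" "g \<in> L2_torus d"
    and h: "\<And>x. x \<in> torus d \<Longrightarrow> h x = a * f x + b * g x"
  shows "fourier d h k = complex_of_real a * fourier d f k + complex_of_real b * fourier d g k"
proof -
  have "fourier d h k = (\<integral>x. complex_of_real a * (complex_of_real (f x) * cnj (character d k x))
      + complex_of_real b * (complex_of_real (g x) * cnj (character d k x)) \<partial>torus_measure d)"
    unfolding fourier_def using h by (intro Bochner_Integration.integral_cong) (auto simp: algebra_simps)
  also have "\<dots> = complex_of_real a * fourier d f k + complex_of_real b * fourier d g k"
    unfolding fourier_def using integrable_fourier assms
    by (subst Bochner_Integration.integral_add) auto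
  finally show ?thesis .
qed

lemma norm_fourier_le:
  assumes "f \<in> L2_torus d"
  shows "norm (fourier d f k) \<le> (\<integral>x. \<bar>f x\<bar> \<partial>torus_measure d)"
proof -
  have "norm (fourier d f k) \<le> (\<integral>x. norm (complex_of_real (f x) * cnj (character d k x)) \<partial>torus_measure d)"
    unfolding fourier_def by (rule integral_norm_bound)
  then show ?thesis by (simp add: norm_mult)
qed

lemma norm_fourier_le_L2:
  assumes "f \<in> L2_torus d"
  shows "norm (fourier d f k) \<le> L2_norm d f"
proof -
  interpret prob_space "torus_measure d" by (rule prob_space_torus_measure)
  have "(\<integral>x. \<bar>f x\<bar> \<partial>torus_measure d) \<le> L2_norm d f"
  proof -
    have "(expectation (\<lambda>x. \<bar>f x\<bar>))\<^sup>2 \<le> expectation (\<lambda>x. \<bar>f x\<bar>\<^sup>2)"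
      using variance_positive[of "\<lambda>x. \<bar>f x\<bar>"] L2_torusD[OF assms] by (subst (asm) variance_eq) auto
    then show ?thesis unfolding L2_norm_def by (intro real_le_rsqrt) simp
  qed
  then show ?thesis using norm_fourier_le[OF assms, of k] by linarith
qed

text \<open>
  Pythagoras for the orthonormal characters, with complex coefficients although \<open>f\<close> is real; this
  avoids choosing one frequency from each pair \<open>\<plusminus>k\<close> to obtain real trigonometric functions.
\<close>

lemma fourier_residual:
  assumes f: "f \<in> L2_torus d" and F: "finite F" "F \<subseteq> lattice d"
  shows "(\<integral>x. (cmod (complex_of_real (f x) - (\<Sum>k\<in>F. fourier d f k * character d k x)))\<^sup>2 \<partial>torus_measure d)
     = (\<integral>x. (f x)\<^sup>2 \<partial>torus_measure d) - (\<Sum>k\<in>F. (cmod (fourier d f k))\<^sup>2)"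
proof -
  interpret prob_space "torus_measure d" by (rule prob_space_torus_measure)
  note [measurable] = L2_torusD(1)[OF f]
  define a where "a k = fourier d f k" for k
  define S where "S x = (\<Sum>k\<in>F. a k * character d k x)" for x
  let ?T = "torus_measure d"
  have cnj_meas [measurable]: "(\<lambda>x. cnj (character d k x)) \<in> borel_measurable ?T" for k
    by (intro borel_measurable_continuous_on[of cnj] continuous_intros) measurable
  have expand: "complex_of_real ((cmod (complex_of_real (f x) - S x))\<^sup>2)
     = complex_of_real ((f x)\<^sup>2) - (\<Sum>k\<in>F. cnj (a k) * (complex_of_real (f x) * cnj (character d k x)))
       - (\<Sum>k\<in>F. a k * cnj (complex_of_real (f x) * cnj (character d k x)))
       + (\<Sum>k\<in>F. \<Sum>l\<in>F. a k * cnj (a l) * (character d k x * cnj (character d l x)))" for x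
  proof -
    have SS: "(\<Sum>k\<in>F. \<Sum>l\<in>F. a k * cnj (a l) * (character d k x * cnj (character d l x))) = S x * cnj (S x)"
      unfolding S_def cnj_sum sum_product by (intro sum.cong refl) (simp add: algebra_simps)
    have 1: "(\<Sum>k\<in>F. cnj (a k) * (complex_of_real (f x) * cnj (character d k x))) = complex_of_real (f x) * cnj (S x)"
      unfolding S_def cnj_sum sum_distrib_left by (intro sum.cong refl) (simp add: algebra_simps)
    have 2: "(\<Sum>k\<in>F. a k * cnj (complex_of_real (f x) * cnj (character d k x))) = complex_of_real (f x) * S x"
      unfolding S_def sum_distrib_left by (intro sum.cong refl) (simp add: algebra_simps)
    show ?thesis
      unfolding SS 1 2 complex_norm_square
      by (simp add: algebra_simps power2_eq_square)
  qed
  have i1: "integrable ?T (\<lambda>x. complex_of_real (f x) * cnj (character d k x))" for k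
    by (rule integrable_fourier[OF f])
  have i2: "integrable ?T (\<lambda>x. cnj (complex_of_real (f x) * cnj (character d k x)))" for k
    using i1[of k] by (rule integrable_cnj)
  have i3: "integrable ?T (\<lambda>x. character d k x * cnj (character d l x))" for k l
    by (rule integrable_const_bound[of _ 1]) (auto simp: norm_mult)
  have i0: "integrable ?T (\<lambda>x. complex_of_real ((f x)\<^sup>2))"
    using L2_torusD(2)[OF f] by (simp del: of_real_power)
  have "complex_of_real (\<integral>x. (cmod (complex_of_real (f x) - S x))\<^sup>2 \<partial>?T)
      = (\<integral>x. complex_of_real ((cmod (complex_of_real (f x) - S x))\<^sup>2) \<partial>?T)"
    by (rule integral_complex_of_real[symmetric])
  also have "\<dots> = complex_of_real (\<integral>x. (f x)\<^sup>2 \<partial>?T) - (\<Sum>k\<in>F. cnj (a k) * a k) - (\<Sum>k\<in>F. a k * cnj (a k))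
      + (\<Sum>k\<in>F. \<Sum>l\<in>F. a k * cnj (a l) * (if k = l then 1 else 0))"
  proof -
    have l: "(\<integral>x. p x - q x - r x + s x \<partial>?T) = (\<integral>x. p x \<partial>?T) - (\<integral>x. q x \<partial>?T) - (\<integral>x. r x \<partial>?T) + (\<integral>x. s x \<partial>?T)"
      if "integrable ?T p" "integrable ?T q" "integrable ?T r" "integrable ?T s" for p q r s :: "_ \<Rightarrow> complex"
      using that by simp
    have c: "(\<integral>x. cnj (complex_of_real (f x) * cnj (character d k x)) \<partial>?T) = cnj (a k)" for k
      unfolding a_def fourier_def Bochner_Integration.integral_cnj ..
    have ch: "(\<integral>x. character d k x * cnj (character d l x) \<partial>?T) = (if k = l then 1 else 0)" if "k \<in> F" "l \<in> F" for k l
      using F that by (simp add: integral_character lattice_eq_iff[of k d l] subset_iff)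
    have "(\<integral>x. complex_of_real ((cmod (complex_of_real (f x) - S x))\<^sup>2) \<partial>?T)
      = complex_of_real (\<integral>x. (f x)\<^sup>2 \<partial>?T) - (\<Sum>k\<in>F. cnj (a k) * a k) - (\<Sum>k\<in>F. a k * cnj (a k))
      + (\<Sum>k\<in>F. \<Sum>l\<in>F. a k * cnj (a l) * (\<integral>x. character d k x * cnj (character d l x) \<partial>?T))"
    proof -
      have I1: "integrable ?T (\<lambda>x. \<Sum>k\<in>F. cnj (a k) * (complex_of_real (f x) * cnj (character d k x)))"
        by (intro Bochner_Integration.integrable_sum integrable_mult_right i1)
      have I2: "integrable ?T (\<lambda>x. \<Sum>k\<in>F. a k * cnj (complex_of_real (f x) * cnj (character d k x)))"
        by (intro Bochner_Integration.integrable_sum integrable_mult_right i2)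
      have I3: "integrable ?T (\<lambda>x. \<Sum>k\<in>F. \<Sum>l\<in>F. a k * cnj (a l) * (character d k x * cnj (character d l x)))"
        by (intro Bochner_Integration.integrable_sum integrable_mult_right i3)
      have E1: "(\<integral>x. (\<Sum>k\<in>F. cnj (a k) * (complex_of_real (f x) * cnj (character d k x))) \<partial>?T) = (\<Sum>k\<in>F. cnj (a k) * a k)"
        unfolding Bochner_Integration.integral_sum[OF integrable_mult_right[OF i1]]
          integral_mult_right_zero fourier_def[symmetric] a_def[symmetric] ..
      have E2: "(\<integral>x. (\<Sum>k\<in>F. a k * cnj (complex_of_real (f x) * cnj (character d k x))) \<partial>?T) = (\<Sum>k\<in>F. a k * cnj (a k))"
        unfolding Bochner_Integration.integral_sum[OF integrable_mult_right[OF i2]]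
          integral_mult_right_zero c ..
      have E3: "(\<integral>x. (\<Sum>k\<in>F. \<Sum>l\<in>F. a k * cnj (a l) * (character d k x * cnj (character d l x))) \<partial>?T)
          = (\<Sum>k\<in>F. \<Sum>l\<in>F. a k * cnj (a l) * (\<integral>x. character d k x * cnj (character d l x) \<partial>?T))"
        unfolding Bochner_Integration.integral_sum[OF Bochner_Integration.integrable_sum[OF integrable_mult_right[OF i3]]]
          Bochner_Integration.integral_sum[OF integrable_mult_right[OF i3]] integral_mult_right_zero ..
      show ?thesis
        unfolding expand l[OF i0 I1 I2 I3] E1 E2 E3 integral_complex_of_real ..
    qed
    also have "(\<Sum>k\<in>F. \<Sum>l\<in>F. a k * cnj (a l) * (\<integral>x. character d k x * cnj (character d l x) \<partial>?T))
      = (\<Sum>k\<in>F. \<Sum>l\<in>F. a k * cnj (a l) * (if k = l then 1 else 0))"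
      using ch by (intro sum.cong refl) auto
    finally show ?thesis .
  qed
  also have "\<dots> = complex_of_real ((\<integral>x. (f x)\<^sup>2 \<partial>?T) - (\<Sum>k\<in>F. (cmod (a k))\<^sup>2))"
    using F by (simp add: if_distrib[of "\<lambda>z. _ * z"] cong: if_cong)
       (simp add: complex_norm_square mult.commute flip: of_real_power)
  finally show ?thesis unfolding of_real_eq_iff S_def a_def .
qed

lemma fourier_bessel:
  assumes f: "f \<in> L2_torus d" and F: "finite F" "F \<subseteq> lattice d"
  shows "(\<Sum>k\<in>F. (cmod (fourier d f k))\<^sup>2) \<le> (\<integral>x. (f x)\<^sup>2 \<partial>torus_measure d)"
proof -
  have "0 \<le> (\<integral>x. (cmod (complex_of_real (f x) - (\<Sum>k\<in>F. fourier d f k * character d k x)))\<^sup>2 \<partial>torus_measure d)"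
    by (intro integral_nonneg_AE) auto
  then show ?thesis unfolding fourier_residual[OF assms] by simp
qed

lemma fourier_functionals:
  "continuous_linear_functional d (\<lambda>f. Re (fourier d f k))"
  "continuous_linear_functional d (\<lambda>f. Im (fourier d f k))"
proof -
  interpret prob_space "torus_measure d" by (rule prob_space_torus_measure)
  have lin: "fourier d (\<lambda>x\<in>torus d. a * f x + b * g x) k
      = complex_of_real a * fourier d f k + complex_of_real b * fourier d g k"
    if "f \<in> C_torus d" "g \<in> C_torus d" for f g a b
    using that by (intro fourier_lincomb C_torus_L2) auto
  have bound: "norm (fourier d f k) \<le> 1 * sup_norm d f" if "f \<in> C_torus d" for f
  proof -
    have "norm (fourier d f k) \<le> (\<integral>x. \<bar>f x\<bar> \<partial>torus_measure d)"
      using that by (intro norm_fourier_le C_torus_L2)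
    also have "\<dots> \<le> (\<integral>x. sup_norm d f \<partial>torus_measure d)"
      using that L2_torusD(3)[OF C_torus_L2[OF that]] abs_le_sup_norm
      by (intro integral_mono) auto
    finally show ?thesis using prob_space by simp
  qed
  show "continuous_linear_functional d (\<lambda>f. Re (fourier d f k))"
    unfolding continuous_linear_functional_def
    using lin order_trans[OF abs_Re_le_cmod bound] by (auto simp del: mult_1 intro!: exI[of _ 1])
  show "continuous_linear_functional d (\<lambda>f. Im (fourier d f k))"
    unfolding continuous_linear_functional_def
    using lin order_trans[OF abs_Im_le_cmod bound] by (auto simp del: mult_1 intro!: exI[of _ 1])
qed

lemma evaluation_functional:
  assumes "x \<in> torus d"
  shows "continuous_linear_functional d (\<lambda>f. f x)"
  unfolding continuous_linear_functional_def
  using assms abs_le_sup_norm by (auto intro!: exI[of _ 1])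

lemma functional_lincomb:
  assumes "continuous_linear_functional d L" "continuous_linear_functional d L'"
  shows "continuous_linear_functional d (\<lambda>f. a * L f + b * L' f)"
proof -
  from assms obtain B B' where
    B: "\<And>f. f \<in> C_torus d \<Longrightarrow> \<bar>L f\<bar> \<le> B * sup_norm d f" "\<And>f. f \<in> C_torus d \<Longrightarrow> \<bar>L' f\<bar> \<le> B' * sup_norm d f"
    unfolding continuous_linear_functional_def by blast
  have "\<bar>a * L f + b * L' f\<bar> \<le> (\<bar>a\<bar> * B + \<bar>b\<bar> * B') * sup_norm d f" if "f \<in> C_torus d" for f
  proof -
    have "\<bar>a * L f + b * L' f\<bar> \<le> \<bar>a\<bar> * \<bar>L f\<bar> + \<bar>b\<bar> * \<bar>L' f\<bar>"
      by (metis abs_mult abs_triangle_ineq)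
    also have "\<dots> \<le> \<bar>a\<bar> * (B * sup_norm d f) + \<bar>b\<bar> * (B' * sup_norm d f)"
      using B that by (intro add_mono mult_left_mono) auto
    finally show ?thesis by (simp add: algebra_simps)
  qed
  moreover have "a * L (\<lambda>x\<in>torus d. u * f x + v * g x) + b * L' (\<lambda>x\<in>torus d. u * f x + v * g x)
      = u * (a * L f + b * L' f) + v * (a * L g + b * L' g)"
    if "f \<in> C_torus d" "g \<in> C_torus d" for f g u v
  proof -
    have "L (\<lambda>x\<in>torus d. u * f x + v * g x) = u * L f + v * L g"
        "L' (\<lambda>x\<in>torus d. u * f x + v * g x) = u * L' f + v * L' g"
      using assms that unfolding continuous_linear_functional_def by blast+
    then show ?thesis by (simp add: algebra_simps)
  qed
  ultimately show ?thesis
    unfolding continuous_linear_functional_def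
    by (intro conjI ballI allI exI[of _ "\<bar>a\<bar> * B + \<bar>b\<bar> * B'"])
qed

lemma functional_zero: "continuous_linear_functional d (\<lambda>f. 0)"
  by (auto simp: continuous_linear_functional_def intro!: exI[of _ 0])

lemma functional_sum:
  assumes "finite I" "\<And>i. i \<in> I \<Longrightarrow> continuous_linear_functional d (L i)"
  shows "continuous_linear_functional d (\<lambda>f. \<Sum>i\<in>I. c i * L i f)"
  using assms
proof (induction I rule: finite_induct)
  case (insert i I)
  then have "continuous_linear_functional d (\<lambda>f. c i * L i f + 1 * (\<Sum>i\<in>I. c i * L i f))"
    by (intro functional_lincomb) auto
  then show ?case using insert by simp
qed (simp add: functional_zero)

section \<open>Gaussian measures on the continuous functions\<close>

lemma seminorm_borel_space: "space (seminorm_borel V N) = V"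
  unfolding seminorm_borel_def by (rule space_measure_of) (auto simp: seminorm_open_def)

lemma seminorm_open_sets: "seminorm_open V N U \<Longrightarrow> U \<in> sets (seminorm_borel V N)"
  unfolding seminorm_borel_def by (subst sets_measure_of) (auto simp: seminorm_open_def)

text \<open>
  Stated for an arbitrary seminorm because it is applied twice: to the continuous functionals on
  the space of continuous functions, and to the Fourier coefficients on \<open>L\<^sub>2\<close>, the target of the
  algorithms.
\<close>

lemma lipschitz_seminorm_measurable:
  fixes L :: "('a \<Rightarrow> real) \<Rightarrow> real"
  assumes "\<And>f g. f \<in> V \<Longrightarrow> g \<in> V \<Longrightarrow> \<bar>L g - L f\<bar> \<le> B * N (\<lambda>x. g x - f x)"
    and N: "\<And>f g. f \<in> V \<Longrightarrow> g \<in> V \<Longrightarrow> 0 \<le> N (\<lambda>x. g x - f x)"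
  shows "L \<in> borel_measurable (seminorm_borel V N)"
proof (rule borel_measurableI)
  fix S :: "real set" assume S: "open S"
  have "seminorm_open V N (L -` S \<inter> V)"
    unfolding seminorm_open_def
  proof (intro conjI ballI)
    fix f assume f: "f \<in> L -` S \<inter> V"
    then obtain e where e: "e > 0" "\<And>y. \<bar>y - L f\<bar> < e \<Longrightarrow> y \<in> S"
      using S by (force simp: open_dist dist_real_def)
    show "\<exists>r>0. \<forall>g\<in>V. N (\<lambda>x. g x - f x) < r \<longrightarrow> g \<in> L -` S \<inter> V"
    proof (intro exI[of _ "e / (\<bar>B\<bar> + 1)"] conjI ballI impI)
      show "0 < e / (\<bar>B\<bar> + 1)" using e by (simp add: add_nonneg_pos)
    next
      fix g assume g: "g \<in> V" "N (\<lambda>x. g x - f x) < e / (\<bar>B\<bar> + 1)"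
      have "\<bar>L g - L f\<bar> \<le> B * N (\<lambda>x. g x - f x)" using assms(1) f g by auto
      also have "\<dots> \<le> (\<bar>B\<bar> + 1) * N (\<lambda>x. g x - f x)"
        using N[of f g] f g by (intro mult_right_mono) auto
      also have "\<dots> < e" using g(2) by (simp add: field_simps add_nonneg_pos)
      finally show "g \<in> L -` S \<inter> V" using e g by auto
    qed
  qed auto
  then show "L -` S \<inter> space (seminorm_borel V N) \<in> sets (seminorm_borel V N)"
    by (simp add: seminorm_borel_space seminorm_open_sets)
qed

lemma sup_norm_restrict: "sup_norm d (restrict h (torus d)) = sup_norm d h"
  unfolding sup_norm_def by (intro SUP_cong) auto

lemma functional_lipschitz:
  assumes "continuous_linear_functional d L"
  shows "\<exists>B. \<forall>f\<in>C_torus d. \<forall>g\<in>C_torus d. \<bar>L g - L f\<bar> \<le> B * sup_norm d (\<lambda>x. g x - f x)"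
proof -
  from assms obtain B where B: "\<And>f. f \<in> C_torus d \<Longrightarrow> \<bar>L f\<bar> \<le> B * sup_norm d f"
    and lin: "\<And>f g a b. f \<in> C_torus d \<Longrightarrow> g \<in> C_torus d \<Longrightarrow>
        L (\<lambda>x\<in>torus d. a * f x + b * g x) = a * L f + b * L g"
    unfolding continuous_linear_functional_def by blast
  have "\<bar>L g - L f\<bar> \<le> B * sup_norm d (\<lambda>x. g x - f x)" if "f \<in> C_torus d" "g \<in> C_torus d" for f g
  proof -
    have "L g - L f = L (\<lambda>x\<in>torus d. 1 * g x + (-1) * f x)"
      by (subst lin) (use that in auto)
    also have "\<bar>\<dots>\<bar> \<le> B * sup_norm d (\<lambda>x\<in>torus d. 1 * g x + (-1) * f x)"
      using that by (intro B C_torus_lincomb)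
    also have "\<dots> = B * sup_norm d (\<lambda>x. g x - f x)"
      unfolding sup_norm_restrict by simp
    finally show ?thesis .
  qed
  then show ?thesis by blast
qed

lemma functional_measurable:
  assumes "continuous_linear_functional d L"
  shows "L \<in> borel_measurable (seminorm_borel (C_torus d) (sup_norm d))"
proof -
  obtain B where B: "\<And>f g. f \<in> C_torus d \<Longrightarrow> g \<in> C_torus d \<Longrightarrow> \<bar>L g - L f\<bar> \<le> B * sup_norm d (\<lambda>x. g x - f x)"
    using functional_lipschitz[OF assms] by blast
  have "0 \<le> sup_norm d (\<lambda>x. g x - f x)" if "f \<in> C_torus d" "g \<in> C_torus d" for f g
    using sup_norm_nonneg[OF C_torus_lincomb[OF that(2,1), of 1 "-1"]] by (simp add: sup_norm_restrict)
  with B show ?thesis by (rule lipschitz_seminorm_measurable)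
qed

lemma fourier_measurable_L2:
  "(\<lambda>g. Re (fourier d g k)) \<in> borel_measurable (seminorm_borel (L2_torus d) (L2_norm d))"
  "(\<lambda>g. Im (fourier d g k)) \<in> borel_measurable (seminorm_borel (L2_torus d) (L2_norm d))"
proof -
  have diff: "fourier d g k - fourier d f k = fourier d (\<lambda>x. g x - f x) k"
    if "f \<in> L2_torus d" "g \<in> L2_torus d" for f g
    using fourier_lincomb[OF that(2,1), of "\<lambda>x. g x - f x" 1 "-1"] by simp
  have bound: "cmod (fourier d g k - fourier d f k) \<le> 1 * L2_norm d (\<lambda>x. g x - f x)"
    if "f \<in> L2_torus d" "g \<in> L2_torus d" for f g
    unfolding diff[OF that] using norm_fourier_le_L2[OF L2_torus_diff[OF that(2,1)]] by simp
  have pos: "0 \<le> L2_norm d h" for h unfolding L2_norm_def by (intro real_sqrt_ge_zero integral_nonneg_AE) auto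
  show "(\<lambda>g. Re (fourier d g k)) \<in> borel_measurable (seminorm_borel (L2_torus d) (L2_norm d))"
    by (rule lipschitz_seminorm_measurable[where B=1])
      (use order_trans[OF abs_Re_le_cmod bound] pos in \<open>auto simp flip: minus_complex.sel\<close>)
  show "(\<lambda>g. Im (fourier d g k)) \<in> borel_measurable (seminorm_borel (L2_torus d) (L2_norm d))"
    by (rule lipschitz_seminorm_measurable[where B=1])
      (use order_trans[OF abs_Im_le_cmod bound] pos in \<open>auto simp flip: minus_complex.sel\<close>)
qed

lemma gaussian_real_cases:
  assumes "gaussian_real \<nu>"
  obtains m s where "s \<ge> 0" "\<nu> = (if s = 0 then return borel m else density lborel (\<lambda>x. ennreal (normal_density m s x)))"
    "sets \<nu> = sets borel" "integrable \<nu> (\<lambda>x. x)" "integrable \<nu> (\<lambda>x. x\<^sup>2)"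
    "(\<integral>x. x \<partial>\<nu>) = m" "(\<integral>x. x\<^sup>2 \<partial>\<nu>) = m\<^sup>2 + s\<^sup>2"
proof -
  from assms consider m where "\<nu> = return borel m"
    | m s where "s > 0" "\<nu> = density lborel (\<lambda>x. ennreal (normal_density m s x))"
    unfolding gaussian_real_def by blast
  then show thesis
  proof cases
    case 1
    interpret prob_space \<nu> unfolding 1 by (rule prob_space_return) simp
    have "AE x in return borel m. x = m" by (subst AE_return) auto
    then have "AE x in \<nu>. norm x \<le> \<bar>m\<bar>" "AE x in \<nu>. norm (x\<^sup>2) \<le> m\<^sup>2"
      unfolding 1 by (eventually_elim, simp)+
    note bounds = this
    have m1: "(\<lambda>x. x) \<in> borel_measurable \<nu>"
      unfolding 1 by simp
    have i1: "integrable \<nu> (\<lambda>x. x)"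
      by (rule integrable_const_bound[where f="\<lambda>x. x", OF bounds(1) m1])
    have i2: "integrable \<nu> (\<lambda>x. x\<^sup>2)"
      by (rule integrable_const_bound[where f="\<lambda>x. x\<^sup>2", OF bounds(2) borel_measurable_power[OF m1]])
    show thesis
    proof (rule that[of 0 m])
      show "(\<integral>x. x \<partial>\<nu>) = m" "(\<integral>x. x\<^sup>2 \<partial>\<nu>) = m\<^sup>2 + 0\<^sup>2"
        unfolding 1 by (simp_all add: integral_return)
    qed (use 1 i1 i2 in \<open>simp_all only: if_True sets_return refl order_refl\<close>)
  next
    case 2
    note s = \<open>s > 0\<close>
    have i1: "has_bochner_integral lborel (\<lambda>x. normal_density m s x * x) m"
      by (rule normal_moment_nz_1[OF s])
    have i0: "has_bochner_integral lborel (\<lambda>x. normal_density m s x) 1"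
      using s by (simp add: has_bochner_integral_iff)
    have "has_bochner_integral lborel (\<lambda>x. normal_density m s x * (x - m) ^ (2 * 1)) (s\<^sup>2)"
      using normal_moment_even[OF s, of m 1] by (simp add: fact_2)
    from has_bochner_integral_add[OF has_bochner_integral_add[OF this has_bochner_integral_mult_right[OF i1, of "2 * m"]]
        has_bochner_integral_mult_right[OF i0, of "- m\<^sup>2"]]
    have i2: "has_bochner_integral lborel (\<lambda>x. normal_density m s x * x\<^sup>2) (m\<^sup>2 + s\<^sup>2)"
      by (rule has_bochner_integral_cong[THEN iffD1, rotated 3])
        (auto simp: power2_eq_square algebra_simps)
    have "integrable \<nu> (\<lambda>x. x)" "integrable \<nu> (\<lambda>x. x\<^sup>2)" "(\<integral>x. x \<partial>\<nu>) = m" "(\<integral>x. x\<^sup>2 \<partial>\<nu>) = m\<^sup>2 + s\<^sup>2"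
      unfolding 2 using i1 i2 by (simp_all add: integrable_density integral_density has_bochner_integral_iff)
    then show thesis
      using s by (intro that[of s m]) (simp_all add: 2(2))
  qed
qed

text \<open>
  Mean and second moment determine a Gaussian law; a vanishing second moment forces the Dirac
  measure.
\<close>

lemma centered_gaussian_eqI:
  assumes "gaussian_real \<nu>" "gaussian_real \<nu>'"
    and "(\<integral>x. x \<partial>\<nu>) = 0" "(\<integral>x. x \<partial>\<nu>') = 0" "(\<integral>x. x\<^sup>2 \<partial>\<nu>) = (\<integral>x. x\<^sup>2 \<partial>\<nu>')"
  shows "\<nu> = \<nu>'"
proof -
  obtain m s where 1: "s \<ge> 0" "\<nu> = (if s = 0 then return borel m else density lborel (\<lambda>x. ennreal (normal_density m s x)))"
     "(\<integral>x. x \<partial>\<nu>) = m" "(\<integral>x. x\<^sup>2 \<partial>\<nu>) = m\<^sup>2 + s\<^sup>2"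
    using gaussian_real_cases[OF assms(1)] by metis
  obtain m' s' where 2: "s' \<ge> 0" "\<nu>' = (if s' = 0 then return borel m' else density lborel (\<lambda>x. ennreal (normal_density m' s' x)))"
     "(\<integral>x. x \<partial>\<nu>') = m'" "(\<integral>x. x\<^sup>2 \<partial>\<nu>') = m'\<^sup>2 + s'\<^sup>2"
    using gaussian_real_cases[OF assms(2)] by metis
  have "m = 0" "m' = 0" using 1 2 assms by auto
  moreover have "s = s'"
    using assms(5) unfolding 1(4) 2(4) \<open>m = 0\<close> \<open>m' = 0\<close> using 1(1) 2(1) by simp
  ultimately show ?thesis using 1(2) 2(2) by simp
qed

locale gaussian_C_torus =
  fixes d :: nat and M :: "((nat \<Rightarrow> real) \<Rightarrow> real) measure"
  assumes gaussian: "zero_mean_gaussian d M"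
begin

abbreviation functional :: "(((nat \<Rightarrow> real) \<Rightarrow> real) \<Rightarrow> real) \<Rightarrow> bool" where
  "functional \<equiv> continuous_linear_functional d"

sublocale prob_space M
  using gaussian by (simp add: zero_mean_gaussian_def)

lemma space_M [simp]: "space M = C_torus d"
  using gaussian by (simp add: zero_mean_gaussian_def)

lemma sets_M: "sets M = sets (seminorm_borel (C_torus d) (sup_norm d))"
  using gaussian by (simp add: zero_mean_gaussian_def)

lemma measurable_functional: "functional L \<Longrightarrow> L \<in> borel_measurable M"
  using functional_measurable measurable_cong_sets[OF sets_M refl] by blast

lemma functional_gaussian: "functional L \<Longrightarrow> gaussian_real (distr M borel L)"
  using gaussian by (auto simp: zero_mean_gaussian_def)

lemma functional_mean: "functional L \<Longrightarrow> (\<integral>f. L f \<partial>M) = 0"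
  using gaussian by (auto simp: zero_mean_gaussian_def)

lemma integrable_functional_power2:
  assumes "functional L" shows "integrable M (\<lambda>f. (L f)\<^sup>2)"
proof -
  note [measurable] = measurable_functional[OF assms]
  have "integrable (distr M borel L) (\<lambda>x. x\<^sup>2)"
    using gaussian_real_cases[OF functional_gaussian[OF assms]] by metis
  then show ?thesis by (subst (asm) integrable_distr_eq) auto
qed

lemma functional_law_eqI:
  assumes "functional L" "functional L'" "(\<integral>f. (L f)\<^sup>2 \<partial>M) = (\<integral>f. (L' f)\<^sup>2 \<partial>M)"
  shows "distr M borel L = distr M borel L'"
proof (rule centered_gaussian_eqI)
  note [measurable] = measurable_functional[OF assms(1)] measurable_functional[OF assms(2)]
  show "(\<integral>x. x \<partial>distr M borel L) = 0" "(\<integral>x. x \<partial>distr M borel L') = 0"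
    "(\<integral>x. x\<^sup>2 \<partial>distr M borel L) = (\<integral>x. x\<^sup>2 \<partial>distr M borel L')"
    using assms functional_mean by (simp_all add: integral_distr)
qed (use assms functional_gaussian in auto)

lemma integrable_mult_square:
  fixes X Y :: "_ \<Rightarrow> real"
  assumes [measurable]: "X \<in> borel_measurable M" "Y \<in> borel_measurable M"
    and "integrable M (\<lambda>f. (X f)\<^sup>2)" "integrable M (\<lambda>f. (Y f)\<^sup>2)"
  shows "integrable M (\<lambda>f. X f * Y f)"
proof (rule Bochner_Integration.integrable_bound[of _ "\<lambda>f. (X f)\<^sup>2 + (Y f)\<^sup>2"])
  have "\<bar>X f * Y f\<bar> \<le> (X f)\<^sup>2 + (Y f)\<^sup>2" for f
  proof -
    have "2 * (\<bar>X f\<bar> * \<bar>Y f\<bar>) \<le> (X f)\<^sup>2 + (Y f)\<^sup>2"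
      using zero_le_power2[of "\<bar>X f\<bar> - \<bar>Y f\<bar>"] by (simp add: power2_eq_square algebra_simps)
    moreover have "0 \<le> \<bar>X f\<bar> * \<bar>Y f\<bar>" by simp
    ultimately show ?thesis unfolding abs_mult by linarith
  qed
  then show "AE f in M. norm (X f * Y f) \<le> norm ((X f)\<^sup>2 + (Y f)\<^sup>2)" by auto
qed (use assms in auto)

definition covariance :: "(((nat \<Rightarrow> real) \<Rightarrow> real) \<Rightarrow> real) \<Rightarrow> (((nat \<Rightarrow> real) \<Rightarrow> real) \<Rightarrow> real) \<Rightarrow> real" where
  "covariance X Y = (\<integral>f. X f * Y f \<partial>M)"

lemma integrable_functional_mult:
  "functional X \<Longrightarrow> functional Y \<Longrightarrow> integrable M (\<lambda>f. X f * Y f)"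
  by (intro integrable_mult_square measurable_functional integrable_functional_power2)

lemma covariance_commute: "covariance X Y = covariance Y X"
  by (simp add: covariance_def mult.commute)

lemma covariance_self: "covariance X X = (\<integral>f. (X f)\<^sup>2 \<partial>M)"
  by (simp add: covariance_def power2_eq_square)

lemma covariance_lincomb:
  assumes "functional X" "functional Y" "functional Z"
  shows "covariance (\<lambda>f. a * X f + b * Y f) Z = a * covariance X Z + b * covariance Y Z"
proof -
  have "covariance (\<lambda>f. a * X f + b * Y f) Z = (\<integral>f. a * (X f * Z f) + b * (Y f * Z f) \<partial>M)"
    unfolding covariance_def by (simp add: algebra_simps)
  also have "\<dots> = a * covariance X Z + b * covariance Y Z"
    unfolding covariance_def using assms integrable_functional_mult by simp
  finally show ?thesis .
qed

lemma covariance_lincomb_right: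
  assumes "functional X" "functional Y" "functional Z"
  shows "covariance Z (\<lambda>f. a * X f + b * Y f) = a * covariance Z X + b * covariance Z Y"
  using covariance_lincomb[OF assms, of a b] by (simp only: covariance_commute[of Z])

lemma covariance_sum:
  assumes "finite I" "\<And>i. i \<in> I \<Longrightarrow> functional (X i)" "functional Z"
  shows "covariance (\<lambda>f. \<Sum>i\<in>I. c i * X i f) Z = (\<Sum>i\<in>I. c i * covariance (X i) Z)"
  using assms(1,2)
proof (induction I rule: finite_induct)
  case empty
  then show ?case by (simp add: covariance_def)
next
  case (insert i I)
  have "covariance (\<lambda>f. c i * X i f + 1 * (\<Sum>i\<in>I. c i * X i f)) Z
      = c i * covariance (X i) Z + 1 * covariance (\<lambda>f. \<Sum>i\<in>I. c i * X i f) Z"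
    using insert assms by (intro covariance_lincomb functional_sum) auto
  then show ?case using insert by simp
qed

lemma covariance_zero:
  assumes "functional X" "functional Y" "covariance Y Y = 0"
  shows "covariance X Y = 0"
proof -
  have "AE f in M. (Y f)\<^sup>2 = 0"
    using assms integrable_functional_power2[of Y]
    by (subst integral_nonneg_eq_0_iff_AE[symmetric]) (auto simp: covariance_self)
  then have "AE f in M. X f * Y f = 0" by eventually_elim simp
  then show ?thesis unfolding covariance_def by (rule integral_eq_zero_AE)
qed

abbreviation residual where
  "residual n Z X \<equiv> (\<lambda>f. X f - (\<Sum>i<n. covariance X (Z i) * Z i f))" for n :: nat

text \<open>
  Gram--Schmidt with respect to the covariance. The form may be degenerate: when the residual of
  the next functional has variance \<open>0\<close>, division by \<open>\<sigma> = 0\<close> makes the new vector \<open>0\<close>, and the residual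
  itself is uncorrelated with everything by \<open>covariance_zero\<close>. This is why the \<open>Z i\<close> have variance at most
  \<open>1\<close> instead of exactly \<open>1\<close>.
\<close>

lemma gram_schmidt:
  fixes L :: "nat \<Rightarrow> ((nat \<Rightarrow> real) \<Rightarrow> real) \<Rightarrow> real"
  assumes "\<And>j. j < n \<Longrightarrow> functional (L j)"
  shows "\<exists>Z. (\<forall>i<n. functional (Z i) \<and> covariance (Z i) (Z i) \<le> 1) \<and>
    (\<forall>X. functional X \<longrightarrow>
      (\<forall>j<n. covariance (residual n Z X) (Z j) = 0 \<and>
             covariance (residual n Z X) (L j) = 0))"
  using assms
proof (induction n)
  case (Suc n)
  have "\<exists>Z. (\<forall>i<n. functional (Z i) \<and> covariance (Z i) (Z i) \<le> 1) \<and>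
    (\<forall>X. functional X \<longrightarrow>
      (\<forall>j<n. covariance (residual n Z X) (Z j) = 0 \<and>
             covariance (residual n Z X) (L j) = 0))"
    using Suc.prems by (intro Suc.IH) simp
  then obtain Z where Z0: "(\<forall>i<n. functional (Z i) \<and> covariance (Z i) (Z i) \<le> 1) \<and>
    (\<forall>X. functional X \<longrightarrow>
      (\<forall>j<n. covariance (residual n Z X) (Z j) = 0 \<and>
             covariance (residual n Z X) (L j) = 0))"
    by (rule exE)
  have Z: "functional (Z i)" "covariance (Z i) (Z i) \<le> 1" if "i < n" for i
    using Z0 that by simp_all
  define P where "P X = residual n Z X" for X
  have P_fun: "functional (P X)" if "functional X" for X
    using functional_lincomb[OF that functional_sum[of "{..<n}" d Z "\<lambda>i. covariance X (Z i)"], of 1 "-1"] Z(1)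
    by (simp add: P_def)
  have orthZ: "covariance (P X) (Z j) = 0" and orthL: "covariance (P X) (L j) = 0" if "functional X" "j < n" for X j
    using Z0 that unfolding P_def by simp_all
  have csum: "covariance (\<lambda>f. \<Sum>i<n. c i * Z i f) Y = (\<Sum>i<n. c i * covariance (Z i) Y)" if "functional Y" for c Y
    by (rule covariance_sum) (use Z that in auto)
  define R where "R = P (L n)"
  define \<sigma> where "\<sigma> = sqrt (covariance R R)"
  have Ln: "functional (L n)" using Suc by simp
  have R: "functional R" unfolding R_def by (intro P_fun Ln)
  have RR: "covariance R R \<ge> 0" by (simp add: covariance_self)
  have \<sigma>: "\<sigma> \<ge> 0" "\<sigma>\<^sup>2 = covariance R R" using RR by (auto simp: \<sigma>_def)
  define Zn where "Zn = (\<lambda>f. (1 / \<sigma>) * R f + 0 * R f)"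
  have Zn: "functional Zn" unfolding Zn_def by (intro functional_lincomb R)
  have cZn: "covariance Zn Y = covariance R Y / \<sigma>" if "functional Y" for Y
    unfolding Zn_def using covariance_lincomb[OF R R that, of "1 / \<sigma>" 0] by simp
  have ZnZ: "covariance Zn (Z j) = 0" "covariance Zn (L j) = 0" if "j < n" for j
    using cZn orthZ[OF Ln that] orthL[OF Ln that] Z(1)[OF that] Suc.prems[of j] that by (auto simp: R_def)
  have ZnZn: "covariance Zn Zn = (if \<sigma> = 0 then 0 else 1)"
  proof -
    have "covariance Zn Zn = \<sigma>\<^sup>2 / \<sigma> / \<sigma>"
      unfolding cZn[OF Zn] covariance_commute[of R Zn] cZn[OF R] \<sigma>(2) ..
    then show ?thesis by (simp add: power2_eq_square)
  qed
  define Z' where "Z' = Z(n := Zn)"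
  have P': "residual (Suc n) Z' X = (\<lambda>f. 1 * P X f + (- covariance X Zn) * Zn f)" for X
    by (auto simp: Z'_def P_def)
  have PXZn: "covariance (P X) Zn = covariance X Zn" if "functional X" for X
  proof -
    have "covariance (P X) Zn = covariance (\<lambda>f. 1 * X f + (-1) * (\<Sum>i<n. covariance X (Z i) * Z i f)) Zn"
      by (simp add: P_def)
    also have "\<dots> = covariance X Zn - (\<Sum>i<n. covariance X (Z i) * covariance (Z i) Zn)"
      using that Z(1) Zn by (subst covariance_lincomb) (auto simp: csum intro!: functional_sum)
    also have "\<dots> = covariance X Zn"
      using ZnZ(1) by (simp add: covariance_commute[of _ Zn])
    finally show ?thesis .
  qed
  have deg: "covariance X Zn = 0" if "functional X" "\<sigma> = 0" for X
    using covariance_zero[OF that(1) Zn] ZnZn that by simp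
  have new: "covariance (\<lambda>f. 1 * P X f + (- covariance X Zn) * Zn f) Y = covariance (P X) Y - covariance X Zn * covariance Zn Y"
    if "functional X" "functional Y" for X Y
    using covariance_lincomb[OF P_fun[OF that(1)] Zn that(2), of 1 "- covariance X Zn"] by simp
  have "covariance (\<lambda>f. 1 * P X f + (- covariance X Zn) * Zn f) (Z' j) = 0" if X: "functional X" and j: "j < Suc n" for X j
  proof (cases "j = n")
    case True
    then show ?thesis using new[OF X Zn] PXZn[OF X] ZnZn deg[OF X] by (auto simp: Z'_def)
  next
    case False
    then have "j < n" using j by simp
    then show ?thesis using new[OF X Z(1)] orthZ[OF X] ZnZ(1) False by (simp add: Z'_def)
  qed
  moreover have "covariance (\<lambda>f. 1 * P X f + (- covariance X Zn) * Zn f) (L j) = 0" if X: "functional X" and j: "j < Suc n" for X j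
  proof (cases "j = n")
    case False
    then have "j < n" using j by simp
    then show ?thesis using new[OF X Suc.prems[of j]] orthL[OF X] ZnZ(2) by simp
  next
    case True
    have PX_Ln: "covariance (P X) (L n) = covariance (P X) R"
    proof -
      have "covariance (P X) R = covariance (\<lambda>f. 1 * L n f + (-1) * (\<Sum>i<n. covariance (L n) (Z i) * Z i f)) (P X)"
        by (simp add: R_def P_def covariance_commute[of "P X", unfolded P_def])
      also have "\<dots> = covariance (L n) (P X) - (\<Sum>i<n. covariance (L n) (Z i) * covariance (Z i) (P X))"
        using Ln Z(1) P_fun[OF X] by (subst covariance_lincomb) (auto simp: csum intro!: functional_sum)
      also have "\<dots> = covariance (P X) (L n)"
        using orthZ[OF X] by (simp add: covariance_commute[of _ "P X"])
      finally show ?thesis by simp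
    qed
    have Zn_Ln: "covariance Zn (L n) = \<sigma>"
    proof -
      have "covariance (L n) Zn = covariance R Zn" using PXZn[OF Ln] by (simp add: R_def)
      also have "\<dots> = covariance R R / \<sigma>" using cZn[OF R] by (simp add: covariance_commute)
      also have "\<dots> = \<sigma>" unfolding \<sigma>(2)[symmetric] by (simp add: power2_eq_square)
      finally show ?thesis by (simp add: covariance_commute)
    qed
    have "covariance (P X) R = covariance X Zn * \<sigma>"
    proof (cases "\<sigma> = 0")
      case True
      then show ?thesis using covariance_zero[OF P_fun[OF X] R] \<sigma> by simp
    next
      case False
      have "covariance X Zn = covariance R (P X) / \<sigma>"
        using PXZn[OF X] cZn[OF P_fun[OF X]] by (simp add: covariance_commute)
      then show ?thesis using False by (simp add: covariance_commute)
    qed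
    then show ?thesis using True new[OF X Ln] PX_Ln Zn_Ln by simp
  qed
  moreover have "functional (Z' i)" "covariance (Z' i) (Z' i) \<le> 1" if "i < Suc n" for i
    using that Z Zn ZnZn by (auto simp: Z'_def less_Suc_eq)
  ultimately show ?case
    by (intro exI[of _ Z'] conjI allI impI) (simp_all only: P')
qed auto

end

section \<open>Covariances of the Fourier coefficients\<close>

lemma tendsto_coordinatewise:
  fixes u :: "'b \<Rightarrow> 'a \<Rightarrow> 'c::topological_space"
  assumes "\<And>i. ((\<lambda>n. u n i) \<longlongrightarrow> l i) F"
  shows "(u \<longlongrightarrow> l) F"
proof -
  have "limitin (product_topology (\<lambda>i. euclidean) UNIV) u l F"
    unfolding limitin_componentwise using assms by (simp add: limitin_canonical_iff)
  then show ?thesis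
    unfolding euclidean_product_topology limitin_canonical_iff .
qed

text \<open>
  Joint measurability is what makes Fubini's theorem available for the random field. Rounding
  \<open>x\<close> down to a grid leaves countably many evaluation functionals, and the rounded evaluations converge
  by continuity of \<open>f\<close>.
\<close>

lemma (in gaussian_C_torus) evaluation_jointly_measurable:
  "(\<lambda>(f, x). f x) \<in> borel_measurable (M \<Otimes>\<^sub>M torus_measure d)"
proof -
  define cell where "cell m x = (\<lambda>j\<in>{..<d}. \<lfloor>real (Suc m) * (x j / (2 * pi))\<rfloor>)" for m and x :: "nat \<Rightarrow> real"
  define grid where "grid m v = (\<lambda>j\<in>{..<d}. 2 * pi * (real_of_int (v j) / real (Suc m)))" for m and v :: "nat \<Rightarrow> int"
  have eval: "(\<lambda>f. f x) \<in> borel_measurable M" for x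
  proof (cases "x \<in> torus d")
    case True
    then show ?thesis by (intro measurable_functional evaluation_functional)
  next
    case False
    then have "f x = undefined" if "f \<in> space M" for f
      using that by (auto simp: C_torus_def extensional_def)
    then show ?thesis
      using measurable_cong[of M "\<lambda>f. f x" "\<lambda>_. undefined" borel] by simp
  qed
  have cell_meas: "(\<lambda>(f, x). cell m x) \<in> measurable (M \<Otimes>\<^sub>M torus_measure d) (count_space (lattice d))" for m
  proof -
    have "cell m \<in> measurable (torus_measure d) (count_space (lattice d))"
    proof (subst measurable_count_space_eq_countable)
      show "countable (lattice d)" by (intro countable_PiE) auto
      show "cell m \<in> space (torus_measure d) \<rightarrow> lattice d \<and>
        (\<forall>v\<in>lattice d. cell m -` {v} \<inter> space (torus_measure d) \<in> sets (torus_measure d))"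
      proof (intro conjI ballI)
        show "cell m \<in> space (torus_measure d) \<rightarrow> lattice d"
          by (auto simp: cell_def)
        fix v assume v: "v \<in> lattice d"
        have "cell m -` {v} \<inter> space (torus_measure d)
            = {x \<in> space (torus_measure d). \<forall>j\<in>{..<d}. \<lfloor>real (Suc m) * (x j / (2 * pi))\<rfloor> = v j}"
          using v by (auto simp: cell_def fun_eq_iff PiE_def extensional_def)
        also have "\<dots> \<in> sets (torus_measure d)"
        proof (rule sets.sets_Collect_finite_All)
          fix j assume "j \<in> {..<d}"
          then have [measurable]: "(\<lambda>x. x j) \<in> borel_measurable (torus_measure d)"
            by (intro measurable_torus_coordinate) simp
          show "{x \<in> space (torus_measure d). \<lfloor>real (Suc m) * (x j / (2 * pi))\<rfloor> = v j} \<in> sets (torus_measure d)"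
            by measurable
        qed simp
        finally show "cell m -` {v} \<inter> space (torus_measure d) \<in> sets (torus_measure d)" .
      qed
    qed
    then show ?thesis by (simp add: case_prod_unfold)
  qed
  have step: "(\<lambda>(f, x). f (grid m (cell m x))) \<in> borel_measurable (M \<Otimes>\<^sub>M torus_measure d)" for m
  proof -
    have "(\<lambda>z. (\<lambda>v z. fst z (grid m v)) ((\<lambda>(f, x). cell m x) z) z) \<in> borel_measurable (M \<Otimes>\<^sub>M torus_measure d)"
    proof (rule measurable_compose_countable'[OF _ cell_meas])
      show "(\<lambda>z. fst z (grid m v)) \<in> borel_measurable (M \<Otimes>\<^sub>M torus_measure d)" for v
        using measurable_compose[OF measurable_fst eval] .
    qed (intro countable_PiE; auto)
    then show ?thesis by (simp add: case_prod_unfold)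
  qed
  show ?thesis
  proof (rule borel_measurable_LIMSEQ_real[OF _ step])
    fix z assume "z \<in> space (M \<Otimes>\<^sub>M torus_measure d)"
    then obtain f x where z: "z = (f, x)" and f: "f \<in> C_torus d" and x: "x \<in> torus d"
      by (cases z) (auto simp: space_pair_measure)
    have x01: "0 \<le> x j / (2 * pi)" "x j / (2 * pi) \<le> 1" if "j < d" for j
      using x that by (auto simp: torus_def PiE_def Pi_def)
    have grid_torus: "grid m (cell m x) \<in> torus d" for m
    proof -
      have "2 * pi * (real_of_int \<lfloor>real (Suc m) * (x j / (2 * pi))\<rfloor> / real (Suc m)) \<in> {0..2 * pi}" if "j < d" for j
      proof -
        define y where "y = x j / (2 * pi)"
        have y: "0 \<le> y" "y \<le> 1" using x01[OF that] by (auto simp: y_def)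
        have "real_of_int \<lfloor>real (Suc m) * y\<rfloor> \<le> real (Suc m) * 1"
          using y by (intro order_trans[OF of_int_floor_le] mult_left_mono) auto
        moreover have "0 \<le> \<lfloor>real (Suc m) * y\<rfloor>" using y by simp
        ultimately have "real_of_int \<lfloor>real (Suc m) * y\<rfloor> / real (Suc m) \<le> 1"
            "0 \<le> real_of_int \<lfloor>real (Suc m) * y\<rfloor> / real (Suc m)"
          by (auto simp: divide_le_eq)
        then have "2 * pi * (real_of_int \<lfloor>real (Suc m) * y\<rfloor> / real (Suc m)) \<le> 2 * pi * 1"
            "0 \<le> 2 * pi * (real_of_int \<lfloor>real (Suc m) * y\<rfloor> / real (Suc m))"
          by (intro mult_left_mono mult_nonneg_nonneg; simp)+
        then show ?thesis unfolding y_def[symmetric] by simp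
      qed
      then show ?thesis by (auto simp: torus_def grid_def cell_def)
    qed
    have "(\<lambda>m. grid m (cell m x)) \<longlonglongrightarrow> x"
    proof (rule tendsto_coordinatewise)
      fix j
      show "(\<lambda>m. grid m (cell m x) j) \<longlonglongrightarrow> x j"
      proof (cases "j < d")
        case False
        then have "x j = undefined" using x by (auto simp: torus_def PiE_def extensional_def)
        then show ?thesis using False by (simp add: grid_def)
      next
        case True
        define y where "y = x j / (2 * pi)"
        have "(\<lambda>m. real_of_int \<lfloor>real (Suc m) * y\<rfloor> / real (Suc m)) \<longlonglongrightarrow> y"
        proof (rule tendsto_sandwich)
          show "\<forall>\<^sub>F m in sequentially. y - 1 / real (Suc m) \<le> real_of_int \<lfloor>real (Suc m) * y\<rfloor> / real (Suc m)"
          proof (intro always_eventually allI)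
            fix m
            have "real (Suc m) * y - 1 \<le> real_of_int \<lfloor>real (Suc m) * y\<rfloor>" by linarith
            then have "(real (Suc m) * y - 1) / real (Suc m) \<le> real_of_int \<lfloor>real (Suc m) * y\<rfloor> / real (Suc m)"
              by (intro divide_right_mono) auto
            then show "y - 1 / real (Suc m) \<le> real_of_int \<lfloor>real (Suc m) * y\<rfloor> / real (Suc m)"
              by (simp add: diff_divide_distrib)
          qed
          show "\<forall>\<^sub>F m in sequentially. real_of_int \<lfloor>real (Suc m) * y\<rfloor> / real (Suc m) \<le> y"
          proof (intro always_eventually allI)
            fix m
            have "real_of_int \<lfloor>real (Suc m) * y\<rfloor> / real (Suc m) \<le> (real (Suc m) * y) / real (Suc m)"
              by (intro divide_right_mono) auto
            then show "real_of_int \<lfloor>real (Suc m) * y\<rfloor> / real (Suc m) \<le> y" by simp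
          qed
          have "(\<lambda>m. y - 1 / real (Suc m)) \<longlonglongrightarrow> y - 0"
            by (intro tendsto_diff tendsto_const LIMSEQ_Suc[OF lim_1_over_n])
          then show "(\<lambda>m. y - 1 / real (Suc m)) \<longlonglongrightarrow> y" by simp
        qed simp
        then have "(\<lambda>m. 2 * pi * (real_of_int \<lfloor>real (Suc m) * y\<rfloor> / real (Suc m))) \<longlonglongrightarrow> 2 * pi * y"
          by (intro tendsto_mult tendsto_const)
        then show ?thesis using True by (simp add: grid_def cell_def y_def)
      qed
    qed
    then have "(\<lambda>m. f (grid m (cell m x))) \<longlonglongrightarrow> f x"
      by (rule continuous_on_tendsto_compose[OF C_torus_continuous[OF f] _ x]) (simp add: grid_torus)
    then show "(\<lambda>m. case z of (f, x) \<Rightarrow> f (grid m (cell m x))) \<longlonglongrightarrow> (case z of (f, x) \<Rightarrow> f x)"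
      by (simp add: z)
  qed
qed

text \<open>
  The variances are kept abstract: the kernel is any Fourier series in \<open>x - y\<close> with summable
  nonnegative coefficients. The lower error estimate adds the assumption that they are at most \<open>1\<close>.
\<close>

locale stationary_gaussian = gaussian_C_torus +
  fixes lam :: "(nat \<Rightarrow> int) \<Rightarrow> real"
  assumes kernel: "has_covariance_kernel d M (\<lambda>x y. \<Sum>\<^sub>\<infinity>k\<in>lattice d.
      complex_of_real (lam k) * exp (\<i> * complex_of_real (\<Sum>j<d. real_of_int (k j) * (x j - y j))))"
    and lam_nonneg: "\<And>k. k \<in> lattice d \<Longrightarrow> 0 \<le> lam k"
    and lam_summable: "lam summable_on lattice d"
begin

definition total :: real where "total = infsum lam (lattice d)"

lemma kernel_characters:
  assumes "x \<in> torus d" "y \<in> torus d"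
  shows "complex_of_real (\<integral>f. f x * f y \<partial>M)
    = (\<Sum>\<^sub>\<infinity>k\<in>lattice d. complex_of_real (lam k) * (character d k x * cnj (character d k y)))"
proof -
  have "exp (\<i> * complex_of_real (\<Sum>j<d. real_of_int (k j) * (x j - y j))) = character d k x * cnj (character d k y)" for k
    unfolding character_def cis_conv_exp[symmetric]
    by (simp add: cis_cnj cis_mult sum_subtractf algebra_simps)
  then show ?thesis
    using kernel assms unfolding has_covariance_kernel_def by simp
qed

text \<open>
  By stationarity, the variance at a point is the sum of all \<open>lam k\<close>, whatever the point.
\<close>

lemma evaluation_power2:
  assumes "x \<in> torus d"
  shows "(\<integral>f. (f x)\<^sup>2 \<partial>M) = total"
proof -
  have "complex_of_real (\<integral>f. f x * f x \<partial>M) = (\<Sum>\<^sub>\<infinity>k\<in>lattice d. complex_of_real (lam k))"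
    unfolding kernel_characters[OF assms assms] complex_norm_square[symmetric] by simp
  also have "\<dots> = complex_of_real total"
    unfolding total_def using has_sum_of_real[OF has_sum_infsum[OF lam_summable]] by (rule infsumI)
  finally show ?thesis unfolding of_real_eq_iff power2_eq_square .
qed

lemma kernel_partial_sum:
  assumes x: "x \<in> torus d" and y: "y \<in> torus d" and F: "finite F" "F \<subseteq> lattice d"
  shows "cmod (complex_of_real (\<integral>f. f x * f y \<partial>M)
      - (\<Sum>k\<in>F. complex_of_real (lam k) * (character d k x * cnj (character d k y)))) \<le> total - sum lam F"
proof -
  define g where "g k = complex_of_real (lam k) * (character d k x * cnj (character d k y))" for k
  have ng: "norm (g k) = lam k" if "k \<in> lattice d" for k
    using lam_nonneg[OF that] by (simp add: g_def norm_mult)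
  have abs_all: "(\<lambda>k. norm (g k)) summable_on lattice d"
    using lam_summable ng by (simp cong: summable_on_cong)
  then have abs: "(\<lambda>k. norm (g k)) summable_on (lattice d - F)"
    by (rule summable_on_subset_banach) auto
  have gs: "g summable_on lattice d"
    using abs_all by (rule abs_summable_summable)
  have "infsum g (lattice d) - sum g F = infsum g (lattice d - F)"
    using gs F by (subst infsum_Diff) auto
  also have "norm \<dots> \<le> infsum (\<lambda>k. norm (g k)) (lattice d - F)"
    by (rule norm_infsum_bound[OF abs])
  also have "\<dots> = infsum lam (lattice d - F)"
    using ng by (intro infsum_cong) auto
  also have "\<dots> = total - sum lam F"
    unfolding total_def using lam_summable F by (subst infsum_Diff) auto
  finally show ?thesis
    unfolding kernel_characters[OF x y] g_def .
qed

abbreviation "T \<equiv> torus_measure d"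

lemma evaluation_square_integrable:
  "integrable (M \<Otimes>\<^sub>M T) (\<lambda>(f, x). (f x)\<^sup>2)"
proof -
  interpret T: prob_space T by (rule prob_space_torus_measure)
  interpret pair_prob_space M T ..
  note [measurable] = evaluation_jointly_measurable
  have m: "(\<lambda>(f, x). (f x)\<^sup>2) \<in> borel_measurable (M \<Otimes>\<^sub>M T)"
    using borel_measurable_power[OF evaluation_jointly_measurable, of 2] by (simp add: case_prod_unfold)
  have "(\<integral>\<^sup>+z. ennreal (norm (case z of (f, x) \<Rightarrow> (f x)\<^sup>2)) \<partial>(M \<Otimes>\<^sub>M T))
      = (\<integral>\<^sup>+x. (\<integral>\<^sup>+f. ennreal (norm (case (f, x) of (f, x) \<Rightarrow> (f x)\<^sup>2)) \<partial>M) \<partial>T)"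
    using m by (intro nn_integral_snd[symmetric]) measurable
  also have "\<dots> = (\<integral>\<^sup>+x. ennreal total \<partial>T)"
  proof (rule nn_integral_cong)
    fix x assume x: "x \<in> space T"
    then have "functional (\<lambda>f. f x)" by (intro evaluation_functional) simp
    then have "(\<integral>\<^sup>+f. ennreal ((f x)\<^sup>2) \<partial>M) = ennreal (\<integral>f. (f x)\<^sup>2 \<partial>M)"
      by (intro nn_integral_eq_integral integrable_functional_power2) auto
    then show "(\<integral>\<^sup>+f. ennreal (norm (case (f, x) of (f, x) \<Rightarrow> (f x)\<^sup>2)) \<partial>M) = ennreal total"
      using evaluation_power2 x by simp
  qed
  also have "\<dots> < \<infinity>" using T.emeasure_space_1 by simp
  finally show ?thesis by (intro integrableI_bounded m)
qed

lemma energy: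
  "integrable M (\<lambda>f. \<integral>x. (f x)\<^sup>2 \<partial>T)" "(\<integral>f. (\<integral>x. (f x)\<^sup>2 \<partial>T) \<partial>M) = total"
proof -
  interpret T: prob_space T by (rule prob_space_torus_measure)
  interpret pair_prob_space M T ..
  show "integrable M (\<lambda>f. \<integral>x. (f x)\<^sup>2 \<partial>T)"
    using integrable_fst'[OF evaluation_square_integrable] by simp
  have "(\<integral>f. (\<integral>x. (f x)\<^sup>2 \<partial>T) \<partial>M) = (\<integral>x. (\<integral>f. (f x)\<^sup>2 \<partial>M) \<partial>T)"
    using Fubini_integral[OF evaluation_square_integrable] by simp
  also have "\<dots> = (\<integral>x. total \<partial>T)"
    by (intro Bochner_Integration.integral_cong refl evaluation_power2) simp
  finally show "(\<integral>f. (\<integral>x. (f x)\<^sup>2 \<partial>T) \<partial>M) = total" using T.prob_space by simp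
qed

text \<open>
  Fubini for one random factor \<open>Z\<close> and one Fourier coefficient. Used twice, first with a point
  evaluation and then with a conjugated coefficient as \<open>Z\<close>, it yields the covariances of the
  coefficients without integrating over two copies of the torus at once.
\<close>

lemma expectation_mult_fourier:
  fixes Z :: "((nat \<Rightarrow> real) \<Rightarrow> real) \<Rightarrow> complex"
  assumes Z [measurable]: "Z \<in> borel_measurable M" and Z2: "integrable M (\<lambda>f. (cmod (Z f))\<^sup>2)"
  shows "integrable M (\<lambda>f. Z f * fourier d f k)"
    and "(\<integral>f. Z f * fourier d f k \<partial>M) = (\<integral>x. (\<integral>f. Z f * complex_of_real (f x) \<partial>M) * cnj (character d k x) \<partial>T)"
    and "integrable T (\<lambda>x. (\<integral>f. Z f * complex_of_real (f x) \<partial>M) * cnj (character d k x))"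
proof -
  interpret T: prob_space T by (rule prob_space_torus_measure)
  interpret pair_prob_space M T ..
  have ev [measurable]: "(\<lambda>z. fst z (snd z)) \<in> borel_measurable (M \<Otimes>\<^sub>M T)"
    using evaluation_jointly_measurable by (simp add: case_prod_unfold)
  have [measurable]: "(\<lambda>x. cnj (character d k x)) \<in> borel_measurable T"
    by (intro borel_measurable_continuous_on[of cnj] continuous_intros) measurable
  define h where "h z = Z (fst z) * (complex_of_real (fst z (snd z)) * cnj (character d k (snd z)))" for z
  have h_meas: "h \<in> borel_measurable (M \<Otimes>\<^sub>M T)"
    unfolding h_def[abs_def] by measurable
  have i1: "integrable (M \<Otimes>\<^sub>M T) (\<lambda>z. (cmod (Z (fst z)))\<^sup>2)"
    using Z2 by (intro Fubini_integrable) (auto simp: T.prob_space)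
  have i2: "integrable (M \<Otimes>\<^sub>M T) (\<lambda>z. (fst z (snd z))\<^sup>2)"
    using evaluation_square_integrable by (simp add: case_prod_unfold)
  have h_int: "integrable (M \<Otimes>\<^sub>M T) h"
  proof (rule Bochner_Integration.integrable_bound[OF Bochner_Integration.integrable_add[OF i1 i2] h_meas])
    have "norm (h z) \<le> norm ((cmod (Z (fst z)))\<^sup>2 + (fst z (snd z))\<^sup>2)" for z
    proof -
      define u v where "u = cmod (Z (fst z))" and "v = \<bar>fst z (snd z)\<bar>"
      have "2 * (u * v) \<le> u\<^sup>2 + v\<^sup>2"
        using zero_le_power2[of "u - v"] by (simp add: power2_eq_square algebra_simps)
      moreover have "0 \<le> u * v" by (simp add: u_def v_def)
      ultimately have "u * v \<le> u\<^sup>2 + v\<^sup>2" by linarith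
      then show ?thesis by (simp add: h_def norm_mult u_def v_def)
    qed
    then show "AE z in M \<Otimes>\<^sub>M T. norm (h z) \<le> norm ((cmod (Z (fst z)))\<^sup>2 + (fst z (snd z))\<^sup>2)"
      by (intro AE_I2)
  qed
  have inner: "(\<integral>x. h (f, x) \<partial>T) = Z f * fourier d f k" for f
    unfolding h_def fourier_def by simp
  have outer: "(\<integral>f. h (f, x) \<partial>M) = (\<integral>f. Z f * complex_of_real (f x) \<partial>M) * cnj (character d k x)" for x
    unfolding h_def by (simp add: mult.assoc[symmetric])
  show "integrable M (\<lambda>f. Z f * fourier d f k)"
    using integrable_fst'[OF h_int] unfolding inner .
  show "(\<integral>f. Z f * fourier d f k \<partial>M) = (\<integral>x. (\<integral>f. Z f * complex_of_real (f x) \<partial>M) * cnj (character d k x) \<partial>T)"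
    using Fubini_integral[of "\<lambda>f x. h (f, x)"] h_int unfolding inner outer by simp
  show "integrable T (\<lambda>x. (\<integral>f. Z f * complex_of_real (f x) \<partial>M) * cnj (character d k x))"
    using integrable_snd[of "\<lambda>f x. h (f, x)"] h_int unfolding outer by simp
qed

text \<open>
  Characters are eigenfunctions of the covariance operator. The kernel is approximated by its
  partial sums uniformly, with error \<open>total - sum lam F\<close>, and every partial sum that contains
  the frequency \<open>l\<close> has exactly the claimed coefficient.
\<close>

lemma expectation_evaluation_fourier:
  assumes x: "x \<in> torus d" and l: "l \<in> lattice d"
  shows "(\<integral>f. complex_of_real (f x) * fourier d f l \<partial>M) = complex_of_real (lam l) * cnj (character d l x)"
proof -
  interpret T: prob_space T by (rule prob_space_torus_measure)
  have fx: "functional (\<lambda>f. f x)" by (rule evaluation_functional[OF x])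
  note [measurable] = measurable_functional[OF fx]
  define K where "K y = complex_of_real (\<integral>f. f y * f x \<partial>M)" for y
  have meas: "(\<lambda>f. complex_of_real (f x)) \<in> borel_measurable M" by measurable
  have sq: "integrable M (\<lambda>f. (cmod (complex_of_real (f x)))\<^sup>2)"
    using integrable_functional_power2[OF fx] by simp
  have K: "(\<integral>f. complex_of_real (f x) * complex_of_real (f y) \<partial>M) = K y" for y
    unfolding K_def of_real_mult[symmetric] integral_complex_of_real by (simp add: mult.commute)
  \<comment> \<open>The defect \<open>D\<close> is bounded by all tails \<open>total - sum lam F\<close>, hence it is \<open>0\<close>.\<close>
  define D where "D = (\<integral>y. K y * cnj (character d l y) \<partial>T) - complex_of_real (lam l) * cnj (character d l x)"
  have E: "(\<integral>f. complex_of_real (f x) * fourier d f l \<partial>M) = (\<integral>y. K y * cnj (character d l y) \<partial>T)"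
    using expectation_mult_fourier(2)[OF meas sq, of l] unfolding K .
  have iK: "integrable T (\<lambda>y. K y * cnj (character d l y))"
    using expectation_mult_fourier(3)[OF meas sq, of l] unfolding K .
  have [measurable]: "(\<lambda>y. cnj (character d k y)) \<in> borel_measurable T" for k
    by (intro borel_measurable_continuous_on[of cnj] continuous_intros) measurable
  have bound: "cmod D \<le> total - sum lam F" if F: "finite F" "F \<subseteq> lattice d" "l \<in> F" for F
  proof -
    define KF where "KF y = (\<Sum>k\<in>F. complex_of_real (lam k) * (character d k y * cnj (character d k x)))" for y
    have i: "integrable T (\<lambda>y. character d k y * cnj (character d l y))" for k
      by (rule T.integrable_const_bound[of _ 1]) (auto simp: norm_mult)
    have KFe: "KF y * cnj (character d l y)
        = (\<Sum>k\<in>F. (complex_of_real (lam k) * cnj (character d k x)) * (character d k y * cnj (character d l y)))" for y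
      unfolding KF_def sum_distrib_right by (intro sum.cong) (auto simp: algebra_simps)
    have iKF: "integrable T (\<lambda>y. KF y * cnj (character d l y))"
      unfolding KFe by (intro Bochner_Integration.integrable_sum integrable_mult_right i)
    have "(\<integral>y. KF y * cnj (character d l y) \<partial>T)
        = (\<Sum>k\<in>F. (complex_of_real (lam k) * cnj (character d k x)) * (\<integral>y. character d k y * cnj (character d l y) \<partial>T))"
      unfolding KFe Bochner_Integration.integral_sum[OF integrable_mult_right[OF i]] integral_mult_right_zero ..
    also have "\<dots> = (\<Sum>k\<in>F. if k = l then complex_of_real (lam k) * cnj (character d k x) else 0)"
      using F l by (intro sum.cong refl) (auto simp: integral_character lattice_eq_iff subset_iff)
    also have "\<dots> = complex_of_real (lam l) * cnj (character d l x)"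
      using F by simp
    finally have "D = (\<integral>y. K y * cnj (character d l y) - KF y * cnj (character d l y) \<partial>T)"
      unfolding D_def using iK iKF by simp
    also have "cmod \<dots> \<le> (\<integral>y. total - sum lam F \<partial>T)"
    proof (rule order_trans[OF integral_norm_bound integral_mono])
      show "integrable T (\<lambda>y. norm (K y * cnj (character d l y) - KF y * cnj (character d l y)))"
        using iK iKF by (intro integrable_norm Bochner_Integration.integrable_diff)
      fix y assume "y \<in> space T"
      then have "cmod (K y - KF y) \<le> total - sum lam F"
        unfolding K_def KF_def using F x by (intro kernel_partial_sum) auto
      then show "norm (K y * cnj (character d l y) - KF y * cnj (character d l y)) \<le> total - sum lam F"
        by (simp add: norm_mult flip: left_diff_distrib)
    qed simp
    finally show ?thesis using T.prob_space by simp
  qed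
  have "cmod D \<le> 0 + e" if "e > 0" for e
  proof -
    obtain F where F: "finite F" "F \<subseteq> lattice d" "dist (sum lam F) total \<le> e"
      using infsum_finite_approximation[OF lam_summable \<open>e > 0\<close>] unfolding total_def by blast
    have "cmod D \<le> total - sum lam (insert l F)"
      using F l by (intro bound) auto
    also have "\<dots> \<le> total - sum lam F"
      using F lam_nonneg[OF l] by (cases "l \<in> F") (auto simp: insert_absorb)
    also have "\<dots> \<le> e" using F(3) by (simp add: dist_real_def)
    finally show ?thesis by simp
  qed
  then have "cmod D \<le> 0" by (rule field_le_epsilon)
  then show ?thesis unfolding E by (simp add: D_def)
qed

abbreviation coeff_re :: "(nat \<Rightarrow> int) \<Rightarrow> ((nat \<Rightarrow> real) \<Rightarrow> real) \<Rightarrow> real" where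
  "coeff_re k \<equiv> \<lambda>f. Re (fourier d f k)"

abbreviation coeff_im :: "(nat \<Rightarrow> int) \<Rightarrow> ((nat \<Rightarrow> real) \<Rightarrow> real) \<Rightarrow> real" where
  "coeff_im k \<equiv> \<lambda>f. Im (fourier d f k)"

lemma fourier_measurable [measurable]: "(\<lambda>f. fourier d f k) \<in> borel_measurable M"
  using measurable_functional[OF fourier_functionals(1)] measurable_functional[OF fourier_functionals(2)]
  by (subst borel_measurable_complex_iff) auto

lemma integrable_fourier_power2: "integrable M (\<lambda>f. (cmod (fourier d f k))\<^sup>2)"
  unfolding cmod_power2
  by (intro Bochner_Integration.integrable_add integrable_functional_power2 fourier_functionals)

lemma expectation_fourier_fourier:
  assumes k: "k \<in> lattice d" and l: "l \<in> lattice d"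
  shows "(\<integral>f. fourier d f k * cnj (fourier d f l) \<partial>M) = (if k = l then complex_of_real (lam k) else 0)"
    and "integrable M (\<lambda>f. fourier d f k * cnj (fourier d f l))"
proof -
  have m: "(\<lambda>f. cnj (fourier d f l)) \<in> borel_measurable M"
    by (intro borel_measurable_continuous_on[of cnj] continuous_intros) measurable
  have i: "integrable M (\<lambda>f. (cmod (cnj (fourier d f l)))\<^sup>2)"
    using integrable_fourier_power2 by simp
  have e: "(\<integral>f. cnj (fourier d f l) * complex_of_real (f x) \<partial>M) = complex_of_real (lam l) * character d l x"
    if "x \<in> torus d" for x
  proof -
    have "(\<integral>f. cnj (fourier d f l) * complex_of_real (f x) \<partial>M)
        = (\<integral>f. cnj (complex_of_real (f x) * fourier d f l) \<partial>M)"
      by (simp add: mult.commute)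
    also have "\<dots> = complex_of_real (lam l) * character d l x"
      unfolding Bochner_Integration.integral_cnj expectation_evaluation_fourier[OF that l] by simp
    finally show ?thesis .
  qed
  have "(\<integral>f. cnj (fourier d f l) * fourier d f k \<partial>M)
      = (\<integral>x. (\<integral>f. cnj (fourier d f l) * complex_of_real (f x) \<partial>M) * cnj (character d k x) \<partial>T)"
    by (rule expectation_mult_fourier(2)[OF m i])
  also have "\<dots> = (\<integral>x. complex_of_real (lam l) * (character d l x * cnj (character d k x)) \<partial>T)"
    using e by (intro Bochner_Integration.integral_cong) auto
  also have "\<dots> = (if k = l then complex_of_real (lam k) else 0)"
    using lattice_eq_iff[OF l k] by (auto simp: integral_character)
  finally show "(\<integral>f. fourier d f k * cnj (fourier d f l) \<partial>M) = (if k = l then complex_of_real (lam k) else 0)"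
    by (simp add: mult.commute)
  show "integrable M (\<lambda>f. fourier d f k * cnj (fourier d f l))"
    using expectation_mult_fourier(1)[OF m i, of k] by (simp add: mult.commute)
qed

lemma expectation_fourier_power2:
  assumes "k \<in> lattice d"
  shows "(\<integral>f. (cmod (fourier d f k))\<^sup>2 \<partial>M) = lam k"
proof -
  have "complex_of_real (\<integral>f. (cmod (fourier d f k))\<^sup>2 \<partial>M) = (\<integral>f. fourier d f k * cnj (fourier d f k) \<partial>M)"
    unfolding complex_norm_square[symmetric] of_real_power[symmetric] by (rule integral_complex_of_real[symmetric])
  also have "\<dots> = complex_of_real (lam k)"
    using expectation_fourier_fourier(1)[OF assms assms] by simp
  finally show ?thesis unfolding of_real_eq_iff .
qed

end

section \<open>Lower and upper bounds for the minimal errors\<close>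

context stationary_gaussian
begin

text \<open>
  Bessel's inequality for the uncorrelated complex variables \<open>fourier d f k\<close> of variance \<open>lam k \<le> 1\<close>,
  phrased with their real and imaginary parts. With \<open>W\<close> the sum of these parts weighted by their
  covariances with \<open>Z\<close>, and \<open>S\<close> the left-hand side, \<open>W\<close> has covariance \<open>S\<close> with \<open>Z\<close> and variance at most
  \<open>S\<close>; hence \<open>0 \<le> Var (Z - W) \<le> Var Z - S\<close>.
\<close>

lemma bessel_covariance:
  assumes Z: "functional Z" and F: "finite F" "F \<subseteq> lattice d" and le1: "\<And>k. k \<in> F \<Longrightarrow> lam k \<le> 1"
  shows "(\<Sum>k\<in>F. (covariance Z (coeff_re k))\<^sup>2 + (covariance Z (coeff_im k))\<^sup>2) \<le> covariance Z Z"
proof -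
  define c where "c k = covariance Z (coeff_re k)" for k
  define s where "s k = covariance Z (coeff_im k)" for k
  define W1 where "W1 f = (\<Sum>k\<in>F. c k * coeff_re k f)" for f
  define W2 where "W2 f = (\<Sum>k\<in>F. s k * coeff_im k f)" for f
  define W where "W f = 1 * W1 f + 1 * W2 f" for f
  define S where "S = (\<Sum>k\<in>F. (c k)\<^sup>2 + (s k)\<^sup>2)"
  have W12: "functional W1" "functional W2"
    unfolding W1_def[abs_def] W2_def[abs_def] using F by (auto intro!: functional_sum fourier_functionals)
  then have W: "functional W"
    unfolding W_def[abs_def] by (rule functional_lincomb)
  have comm: "covariance (coeff_re k) Z = c k" "covariance (coeff_im k) Z = s k" for k
    unfolding c_def s_def by (rule covariance_commute)+
  have W1Z: "covariance W1 Z = (\<Sum>k\<in>F. c k * c k)"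
    unfolding W1_def[abs_def] comm[symmetric] using F Z
    by (intro covariance_sum fourier_functionals)
  have W2Z: "covariance W2 Z = (\<Sum>k\<in>F. s k * s k)"
    unfolding W2_def[abs_def] comm[symmetric] using F Z
    by (intro covariance_sum fourier_functionals)
  have ZW: "covariance W Z = S"
    unfolding W_def[abs_def] covariance_lincomb[OF W12 Z] W1Z W2Z S_def
    by (simp add: sum.distrib power2_eq_square)
  define b where "b k = Complex (c k) (- s k)" for k
  have W_Re: "W f = Re (\<Sum>k\<in>F. b k * fourier d f k)" for f
    by (simp add: W_def W1_def W2_def b_def sum.distrib)
  have sq: "complex_of_real ((cmod (\<Sum>k\<in>F. b k * fourier d f k))\<^sup>2)
      = (\<Sum>k\<in>F. \<Sum>l\<in>F. b k * cnj (b l) * (fourier d f k * cnj (fourier d f l)))" for f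
    unfolding complex_norm_square cnj_sum sum_product
    by (intro sum.cong refl) (simp add: algebra_simps)
  have int: "integrable M (\<lambda>f. fourier d f k * cnj (fourier d f l))" if "k \<in> F" "l \<in> F" for k l
    using F that by (intro expectation_fourier_fourier) auto
  have int_sq: "integrable M (\<lambda>f. complex_of_real ((cmod (\<Sum>k\<in>F. b k * fourier d f k))\<^sup>2))"
    unfolding sq by (intro Bochner_Integration.integrable_sum integrable_mult_right int)
  have "complex_of_real (\<integral>f. (cmod (\<Sum>k\<in>F. b k * fourier d f k))\<^sup>2 \<partial>M)
      = (\<integral>f. complex_of_real ((cmod (\<Sum>k\<in>F. b k * fourier d f k))\<^sup>2) \<partial>M)"
    by (rule integral_complex_of_real[symmetric])
  also have "\<dots> = (\<Sum>k\<in>F. \<integral>f. (\<Sum>l\<in>F. b k * cnj (b l) * (fourier d f k * cnj (fourier d f l))) \<partial>M)"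
    unfolding sq by (intro Bochner_Integration.integral_sum Bochner_Integration.integrable_sum integrable_mult_right int)
  also have "\<dots> = (\<Sum>k\<in>F. \<Sum>l\<in>F. b k * cnj (b l) * (\<integral>f. fourier d f k * cnj (fourier d f l) \<partial>M))"
  proof (intro sum.cong refl)
    fix k assume k: "k \<in> F"
    have "(\<integral>f. (\<Sum>l\<in>F. b k * cnj (b l) * (fourier d f k * cnj (fourier d f l))) \<partial>M)
        = (\<Sum>l\<in>F. \<integral>f. b k * cnj (b l) * (fourier d f k * cnj (fourier d f l)) \<partial>M)"
      by (intro Bochner_Integration.integral_sum integrable_mult_right int k)
    then show "(\<integral>f. (\<Sum>l\<in>F. b k * cnj (b l) * (fourier d f k * cnj (fourier d f l))) \<partial>M)
        = (\<Sum>l\<in>F. b k * cnj (b l) * (\<integral>f. fourier d f k * cnj (fourier d f l) \<partial>M))"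
      by simp
  qed
  also have "\<dots> = (\<Sum>k\<in>F. \<Sum>l\<in>F. if k = l then b k * cnj (b l) * complex_of_real (lam k) else 0)"
    using F by (intro sum.cong refl) (auto simp: expectation_fourier_fourier(1) subset_iff)
  also have "\<dots> = (\<Sum>k\<in>F. b k * cnj (b k) * complex_of_real (lam k))"
    using F by simp
  also have "\<dots> = complex_of_real (\<Sum>k\<in>F. (cmod (b k))\<^sup>2 * lam k)"
    unfolding complex_norm_square[symmetric] by simp
  finally have EW: "(\<integral>f. (cmod (\<Sum>k\<in>F. b k * fourier d f k))\<^sup>2 \<partial>M) = (\<Sum>k\<in>F. (cmod (b k))\<^sup>2 * lam k)"
    unfolding of_real_eq_iff .
  have "covariance W W \<le> (\<integral>f. (cmod (\<Sum>k\<in>F. b k * fourier d f k))\<^sup>2 \<partial>M)"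
    unfolding covariance_self
  proof (rule integral_mono[OF integrable_functional_power2[OF W]])
    show "integrable M (\<lambda>f. (cmod (\<Sum>k\<in>F. b k * fourier d f k))\<^sup>2)"
      using int_sq by (simp only: complex_of_real_integrable_eq)
    fix f
    have "\<bar>W f\<bar> \<le> cmod (\<Sum>k\<in>F. b k * fourier d f k)"
      unfolding W_Re by (rule abs_Re_le_cmod)
    then have "\<bar>W f\<bar>\<^sup>2 \<le> (cmod (\<Sum>k\<in>F. b k * fourier d f k))\<^sup>2"
      by (rule power_mono) simp
    then show "(W f)\<^sup>2 \<le> (cmod (\<Sum>k\<in>F. b k * fourier d f k))\<^sup>2" by simp
  qed
  also have "\<dots> \<le> (\<Sum>k\<in>F. (cmod (b k))\<^sup>2 * 1)"
    unfolding EW using le1 by (intro sum_mono mult_left_mono) auto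
  also have "\<dots> = S" by (simp add: S_def b_def cmod_power2)
  finally have WW: "covariance W W \<le> S" .
  define V where "V = (\<lambda>f. 1 * Z f + (-1) * W f)"
  have V: "functional V" unfolding V_def by (rule functional_lincomb[OF Z W])
  have "covariance V V = covariance Z V - covariance W V"
    using covariance_lincomb[OF Z W V, of 1 "-1"] by (simp add: V_def)
  also have "covariance Z V = covariance Z Z - S"
    using covariance_lincomb_right[OF Z W Z, of 1 "-1"] ZW covariance_commute[of Z W] by (simp add: V_def)
  also have "covariance W V = S - covariance W W"
    using covariance_lincomb_right[OF Z W W, of 1 "-1"] ZW by (simp add: V_def)
  finally have "covariance V V = covariance Z Z - 2 * S + covariance W W" by simp
  moreover have "0 \<le> covariance V V"
    unfolding covariance_self by (intro integral_nonneg_AE) auto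
  ultimately have "0 \<le> covariance Z Z - 2 * S + covariance W W" by simp
  then show ?thesis using WW by (simp add: S_def c_def s_def)
qed

end

context gaussian_C_torus
begin

text \<open>
  Changing the sign of \<open>R\<close> preserves the variance of every linear combination of \<open>R\<close> and the \<open>L i\<close>, as
  the mixed terms vanish. Linear combinations are centered Gaussian, so their laws are preserved,
  and by Cramer--Wold so is the joint law.
\<close>

lemma uncorrelated_reflection:
  fixes n :: nat
  assumes R: "functional R" and L: "\<And>i. i < n \<Longrightarrow> functional (L i)"
    and orth: "\<And>i. i < n \<Longrightarrow> covariance R (L i) = 0"
  shows "distr M (\<Pi>\<^sub>M i\<in>{..<Suc n}. borel) (\<lambda>f. \<lambda>i\<in>{..<Suc n}. if i < n then L i f else R f)
       = distr M (\<Pi>\<^sub>M i\<in>{..<Suc n}. borel) (\<lambda>f. \<lambda>i\<in>{..<Suc n}. if i < n then L i f else - R f)"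
proof -
  define V where "V s = (\<lambda>f. \<lambda>i\<in>{..<Suc n}. if i < n then L i f else s * R f)" for s :: real
  have V: "V s \<in> measurable M (\<Pi>\<^sub>M i\<in>{..<Suc n}. borel)" for s
    unfolding V_def
  proof (rule measurable_restrict)
    fix i
    show "(\<lambda>f. if i < n then L i f else s * R f) \<in> borel_measurable M"
      using measurable_functional[OF R] measurable_functional[OF L, of i] by (cases "i < n") auto
  qed
  have "distr M (\<Pi>\<^sub>M i\<in>{..<Suc n}. borel) (V 1) = distr M (\<Pi>\<^sub>M i\<in>{..<Suc n}. borel) (V (-1))"
  proof (rule cramer_wold[where n="Suc n"])
    fix t :: "nat \<Rightarrow> real"
    define A where "A f = (\<Sum>i<n. t i * L i f)" for f
    define G where "G s = (\<lambda>f. 1 * A f + (t n * s) * R f)" for s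
    have A: "functional A" unfolding A_def[abs_def] using L by (intro functional_sum) auto
    have G: "functional (G s)" for s unfolding G_def by (intro functional_lincomb A R)
    have orth': "covariance (L i) R = 0" if "i < n" for i
      using orth[OF that] by (simp only: covariance_commute[of "L i"])
    have AR: "covariance A R = 0"
      unfolding A_def[abs_def] using L R orth' by (subst covariance_sum) auto
    have RA: "covariance R A = 0"
      using AR by (simp only: covariance_commute[of R A])
    have "covariance (G s) (G s) = covariance A A + (t n * s)\<^sup>2 * covariance R R" for s
    proof -
      have "covariance (G s) (G s) = covariance A (G s) + t n * s * covariance R (G s)"
        using covariance_lincomb[OF A R G[of s], of 1 "t n * s"] by (simp add: G_def)
      moreover have "covariance A (G s) = covariance A A"
        using covariance_lincomb_right[OF A R A, of 1 "t n * s"] AR by (simp add: G_def)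
      moreover have "covariance R (G s) = t n * s * covariance R R"
        using covariance_lincomb_right[OF A R R, of 1 "t n * s"] RA by (simp add: G_def)
      ultimately show ?thesis by (simp add: power2_eq_square)
    qed
    then have law: "distr M borel (G 1) = distr M borel (G (-1))"
      by (intro functional_law_eqI G) (simp flip: covariance_self)
    have G_sum: "(\<Sum>i<Suc n. t i * V s f i) = G s f" for s f
      by (simp add: V_def G_def A_def)
    have sum_meas: "(\<lambda>x. \<Sum>i<Suc n. t i * x i) \<in> borel_measurable (\<Pi>\<^sub>M i\<in>{..<Suc n}. borel)"
      by (intro borel_measurable_sum borel_measurable_times borel_measurable_const measurable_component_singleton)
    have iexp_meas: "(\<lambda>x. iexp x) \<in> borel_measurable borel"
      by measurable
    have "(\<integral>x. iexp (\<Sum>i<Suc n. t i * x i) \<partial>distr M (\<Pi>\<^sub>M i\<in>{..<Suc n}. borel) (V s)) = (\<integral>x. iexp x \<partial>distr M borel (G s))" for s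
      unfolding integral_distr[OF V measurable_compose[OF sum_meas iexp_meas]]
        integral_distr[OF measurable_functional[OF G] iexp_meas] G_sum ..
    then show "(\<integral>x. iexp (\<Sum>i<Suc n. t i * x i) \<partial>distr M (\<Pi>\<^sub>M i\<in>{..<Suc n}. borel) (V 1))
        = (\<integral>x. iexp (\<Sum>i<Suc n. t i * x i) \<partial>distr M (\<Pi>\<^sub>M i\<in>{..<Suc n}. borel) (V (-1)))"
      using law by simp
  qed (auto intro!: prob_space_distr V)
  then show ?thesis unfolding V_def mult_1_left mult_minus1 .
qed

text \<open>
  This is the only consequence of independence of \<open>R\<close> and the \<open>L i\<close> that the lower bound uses. The
  reflection \<open>R \<mapsto> - R\<close> preserves the expectation and reverses its sign.
\<close>

lemma uncorrelated_orthogonal: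
  fixes n :: nat
  assumes R: "functional R" and L: "\<And>i. i < n \<Longrightarrow> functional (L i)"
    and orth: "\<And>i. i < n \<Longrightarrow> covariance R (L i) = 0"
    and \<psi> [measurable]: "\<psi> \<in> borel_measurable (\<Pi>\<^sub>M i\<in>{..<n}. borel)"
  shows "(\<integral>f. R f * \<psi> (\<lambda>i\<in>{..<n}. L i f) \<partial>M) = 0"
proof -
  let ?P = "\<Pi>\<^sub>M i\<in>{..<Suc n}. (borel :: real measure)"
  define V where "V s = (\<lambda>f. \<lambda>i\<in>{..<Suc n}. if i < n then L i f else s * R f)" for s :: real
  have V: "V s \<in> measurable M ?P" for s
    unfolding V_def
  proof (rule measurable_restrict)
    fix i
    show "(\<lambda>f. if i < n then L i f else s * R f) \<in> borel_measurable M"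
      using measurable_functional[OF R] measurable_functional[OF L, of i] by (cases "i < n") auto
  qed
  have eq: "distr M ?P (V 1) = distr M ?P (V (-1))"
    unfolding V_def mult_1_left mult_minus1 by (rule uncorrelated_reflection[OF R L orth])
  define h where "h x = x n * \<psi> (restrict x {..<n})" for x
  have "(\<lambda>x. restrict x {..<n}) \<in> measurable ?P (\<Pi>\<^sub>M i\<in>{..<n}. borel)"
    by (rule measurable_restrict_subset) auto
  then have h: "h \<in> borel_measurable ?P"
    unfolding h_def[abs_def]
    by (intro borel_measurable_times measurable_component_singleton measurable_compose[OF _ \<psi>]) auto
  have hV: "h (V s f) = s * (R f * \<psi> (\<lambda>i\<in>{..<n}. L i f))" for s f
  proof -
    have "restrict (V s f) {..<n} = (\<lambda>i\<in>{..<n}. L i f)" by (auto simp: V_def)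
    then show ?thesis by (simp add: h_def V_def mult.assoc)
  qed
  have "(\<integral>x. h x \<partial>distr M ?P (V s)) = s * (\<integral>f. R f * \<psi> (\<lambda>i\<in>{..<n}. L i f) \<partial>M)" for s
    by (simp add: integral_distr[OF V h] hV)
  from this[of 1] this[of "-1"] eq show ?thesis by simp
qed

text \<open>
  No function of the information predicts \<open>X\<close> better than the projection of \<open>X\<close> to the \<open>Z i\<close>. The
  residual \<open>R\<close> is orthogonal to the prediction \<open>\<psi>\<close>, by \<open>uncorrelated_orthogonal\<close>, and to the projection \<open>Q\<close>;
  so the squared error is the variance of \<open>R\<close> plus the mean square of \<open>Q - \<psi>\<close>.
\<close>

lemma functional_prediction_error:
  fixes n :: nat
  assumes X: "functional X" and L: "\<And>i. i < n \<Longrightarrow> functional (L i)"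
    and Z: "\<And>i. i < n \<Longrightarrow> functional (Z i)"
    and R_def: "R = residual n Z X"
    and RZ: "\<And>i. i < n \<Longrightarrow> covariance R (Z i) = 0" and RL: "\<And>i. i < n \<Longrightarrow> covariance R (L i) = 0"
    and \<psi>: "\<psi> \<in> borel_measurable (\<Pi>\<^sub>M i\<in>{..<n}. borel)"
  shows "ennreal (covariance X X - (\<Sum>i<n. (covariance X (Z i))\<^sup>2))
    \<le> (\<integral>\<^sup>+f. ennreal ((X f - \<psi> (\<lambda>i\<in>{..<n}. L i f))\<^sup>2) \<partial>M)"
proof -
  define Y where "Y f = \<psi> (\<lambda>i\<in>{..<n}. L i f)" for f
  have "(\<lambda>f. \<lambda>i\<in>{..<n}. L i f) \<in> measurable M (\<Pi>\<^sub>M i\<in>{..<n}. borel)"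
    using measurable_functional[OF L] by (intro measurable_restrict) auto
  then have Ym: "Y \<in> borel_measurable M"
    unfolding Y_def[abs_def] by (rule measurable_compose[OF _ \<psi>])
  define Q where "Q f = (\<Sum>i<n. covariance X (Z i) * Z i f)" for f
  have Q: "functional Q" unfolding Q_def[abs_def] using Z by (intro functional_sum) auto
  have RXQ: "R = (\<lambda>f. 1 * X f + (-1) * Q f)" by (simp add: R_def Q_def)
  have R: "functional R" unfolding RXQ by (intro functional_lincomb X Q)
  have ZR: "covariance (Z i) R = 0" if "i < n" for i
    using RZ[OF that] by (simp only: covariance_commute[of "Z i"])
  have QR: "covariance Q R = 0"
    unfolding Q_def[abs_def] using Z R ZR by (subst covariance_sum) auto
  have QX: "covariance Q X = (\<Sum>i<n. (covariance X (Z i))\<^sup>2)"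
  proof -
    have "covariance Q X = (\<Sum>i<n. covariance X (Z i) * covariance (Z i) X)"
      unfolding Q_def[abs_def] using Z X by (intro covariance_sum) auto
    also have "\<dots> = (\<Sum>i<n. covariance X (Z i) * covariance X (Z i))"
      by (intro sum.cong refl arg_cong2[where f="(*)"] covariance_commute)
    finally show ?thesis by (simp add: power2_eq_square)
  qed
  have "covariance R R = covariance X R - covariance Q R"
    using covariance_lincomb[OF X Q R, of 1 "-1"] by (simp add: RXQ)
  also have "covariance X R = covariance X X - covariance Q X"
    using covariance_lincomb_right[OF X Q X, of 1 "-1"] covariance_commute[of X Q] by (simp add: RXQ)
  finally have RR: "covariance R R = covariance X X - (\<Sum>i<n. (covariance X (Z i))\<^sup>2)"
    by (simp add: QR QX)
  note [measurable] = measurable_functional[OF X] measurable_functional[OF Q] measurable_functional[OF R] Ym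
  show ?thesis
  proof (cases "(\<integral>\<^sup>+f. ennreal ((X f - Y f)\<^sup>2) \<partial>M) = \<infinity>")
    case True
    then show ?thesis unfolding Y_def by simp
  next
    case False
    have D: "integrable M (\<lambda>f. (X f - Y f)\<^sup>2)"
      using False by (intro integrableI_bounded) (auto simp: top.not_eq_extremum)
    have Y2: "integrable M (\<lambda>f. (Y f)\<^sup>2)"
    proof (rule Bochner_Integration.integrable_bound)
      show "integrable M (\<lambda>f. 2 * (X f)\<^sup>2 + 2 * (X f - Y f)\<^sup>2)"
        using D integrable_functional_power2[OF X] by simp
      have "(Y f)\<^sup>2 \<le> 2 * (X f)\<^sup>2 + 2 * (X f - Y f)\<^sup>2" for f
        using zero_le_power2[of "2 * X f - Y f"] by (simp add: power2_eq_square algebra_simps)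
      then show "AE f in M. norm ((Y f)\<^sup>2) \<le> norm (2 * (X f)\<^sup>2 + 2 * (X f - Y f)\<^sup>2)"
        by (intro AE_I2) simp
    qed measurable
    have iRY: "integrable M (\<lambda>f. R f * Y f)"
      using Y2 integrable_functional_power2[OF R] by (intro integrable_mult_square) measurable
    have iRQ: "integrable M (\<lambda>f. Q f * R f)"
      by (rule integrable_functional_mult[OF Q R])
    have iR2: "integrable M (\<lambda>f. (R f)\<^sup>2)" by (rule integrable_functional_power2[OF R])
    have ERY: "(\<integral>f. R f * Y f \<partial>M) = 0"
      unfolding Y_def using R L RL \<psi> by (rule uncorrelated_orthogonal)
    have ERQ: "(\<integral>f. Q f * R f \<partial>M) = 0" using QR by (simp add: covariance_def)
    have "covariance R R = (\<integral>f. (R f)\<^sup>2 + 2 * (Q f * R f) - 2 * (R f * Y f) \<partial>M)"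
      using iR2 iRQ iRY ERY ERQ by (simp add: covariance_self)
    also have "\<dots> \<le> (\<integral>f. (X f - Y f)\<^sup>2 \<partial>M)"
    proof (rule integral_mono[OF _ D])
      show "integrable M (\<lambda>f. (R f)\<^sup>2 + 2 * (Q f * R f) - 2 * (R f * Y f))"
        using iR2 iRQ iRY by simp
      fix f
      show "(R f)\<^sup>2 + 2 * (Q f * R f) - 2 * (R f * Y f) \<le> (X f - Y f)\<^sup>2"
        using zero_le_power2[of "Q f - Y f"] by (simp add: RXQ power2_eq_square algebra_simps)
    qed
    finally have "ennreal (covariance R R) \<le> ennreal (\<integral>f. (X f - Y f)\<^sup>2 \<partial>M)"
      by (rule ennreal_leI)
    also have "\<dots> = (\<integral>\<^sup>+f. ennreal ((X f - Y f)\<^sup>2) \<partial>M)"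
      using D by (intro nn_integral_eq_integral[symmetric]) auto
    finally show ?thesis unfolding RR Y_def .
  qed
qed

end

lemma ennreal_plus_le: "ennreal (x + y) \<le> ennreal x + ennreal y"
proof (cases "x \<ge> 0 \<and> y \<ge> 0")
  case False
  then have "x + y \<le> x \<and> y \<le> 0 \<or> x + y \<le> y \<and> x \<le> 0" by linarith
  then show ?thesis by (auto simp: ennreal_neg intro!: ennreal_leI)
qed simp

lemma ennreal_sqrt_ennreal: "ennreal_sqrt (ennreal x) = ennreal (sqrt x)"
proof (cases "x \<ge> 0")
  case False
  then have "ennreal x = 0" "ennreal (sqrt x) = 0" by (auto simp: ennreal_neg)
  then show ?thesis by (simp add: ennreal_sqrt_def)
qed (simp add: ennreal_sqrt_def)

lemma ennreal_sqrt_mono: "v \<le> w \<Longrightarrow> ennreal_sqrt v \<le> ennreal_sqrt w"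
  by (cases v; cases w) (auto simp: ennreal_sqrt_ennreal ennreal_sqrt_def top_unique)

context stationary_gaussian
begin

lemma initial_error: "min_avg_error d M 0 = ennreal (sqrt total)"
proof -
  have "(\<integral>\<^sup>+f. ennreal ((L2_norm d (\<lambda>x. f x - 0))\<^sup>2) \<partial>M) = (\<integral>\<^sup>+f. ennreal (\<integral>x. (f x)\<^sup>2 \<partial>T) \<partial>M)"
    by (intro nn_integral_cong) (simp add: L2_norm_power2 C_torus_L2)
  also have "\<dots> = ennreal (\<integral>f. (\<integral>x. (f x)\<^sup>2 \<partial>T) \<partial>M)"
    using energy(1) by (intro nn_integral_eq_integral) auto
  also have "\<dots> = ennreal total" by (simp only: energy(2))
  finally show ?thesis
    by (simp add: min_avg_error_def algorithms_def avg_error_def ennreal_sqrt_ennreal)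
qed

text \<open>
  By Bessel on the torus the squared error dominates the prediction errors of the coefficients in
  \<open>F\<close>. Predicting coefficient \<open>k\<close> removes at most \<open>\<Sum>\<^sub>i g k i\<close> from its variance \<open>lam k\<close>, and by Bessel in
  the space of random variables each \<open>g _ i\<close> sums to at most \<open>1\<close> over \<open>F\<close>.
\<close>

lemma algorithm_error_ge:
  assumes L: "\<And>i. i < n \<Longrightarrow> functional (L i)"
    and \<phi>: "\<phi> \<in> measurable (\<Pi>\<^sub>M i\<in>{..<n}. borel) (seminorm_borel (L2_torus d) (L2_norm d))"
    and F: "finite F" "F \<subseteq> lattice d" and le1: "\<And>k. k \<in> F \<Longrightarrow> lam k \<le> 1"
  shows "ennreal (sum lam F - real n)
    \<le> (\<integral>\<^sup>+f. ennreal ((L2_norm d (\<lambda>x. f x - \<phi> (\<lambda>i\<in>{..<n}. L i f) x))\<^sup>2) \<partial>M)"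
proof -
  obtain Z where Z0: "(\<forall>i<n. functional (Z i) \<and> covariance (Z i) (Z i) \<le> 1) \<and>
    (\<forall>X. functional X \<longrightarrow>
      (\<forall>j<n. covariance (residual n Z X) (Z j) = 0 \<and>
             covariance (residual n Z X) (L j) = 0))"
    using gram_schmidt[of n L, OF L] by (rule exE)
  have Z: "functional (Z i)" "covariance (Z i) (Z i) \<le> 1" if "i < n" for i
    using Z0 that by simp_all
  have R: "covariance (residual n Z X) (Z j) = 0"
     "covariance (residual n Z X) (L j) = 0" if "functional X" "j < n" for X j
    using Z0 that by simp_all
  define Y where "Y f = (\<lambda>i\<in>{..<n}. L i f)" for f
  let ?re = "\<lambda>k f. ennreal ((coeff_re k f - Re (fourier d (\<phi> (Y f)) k))\<^sup>2)"
  let ?im = "\<lambda>k f. ennreal ((coeff_im k f - Im (fourier d (\<phi> (Y f)) k))\<^sup>2)"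
  have Ym: "Y \<in> measurable M (\<Pi>\<^sub>M i\<in>{..<n}. borel)"
    unfolding Y_def[abs_def] using measurable_functional[OF L] by (intro measurable_restrict) auto
  have \<psi>m: "(\<lambda>y. Re (fourier d (\<phi> y) k)) \<in> borel_measurable (\<Pi>\<^sub>M i\<in>{..<n}. borel)"
      "(\<lambda>y. Im (fourier d (\<phi> y) k)) \<in> borel_measurable (\<Pi>\<^sub>M i\<in>{..<n}. borel)" for k
    using measurable_compose[OF \<phi> fourier_measurable_L2(1)] measurable_compose[OF \<phi> fourier_measurable_L2(2)] .
  have err: "ennreal (covariance X X - (\<Sum>i<n. (covariance X (Z i))\<^sup>2))
      \<le> (\<integral>\<^sup>+f. ennreal ((X f - \<psi> (Y f))\<^sup>2) \<partial>M)"
    if "functional X" "\<psi> \<in> borel_measurable (\<Pi>\<^sub>M i\<in>{..<n}. borel)" for X \<psi>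
    unfolding Y_def by (rule functional_prediction_error[where Z=Z, OF that(1) L Z(1) refl R(1)[OF that(1)] R(2)[OF that(1)] that(2)])
  have re_meas: "(\<lambda>f. ?re k f) \<in> borel_measurable M" for k
  proof -
    note [measurable] = measurable_functional[OF fourier_functionals(1)] measurable_compose[OF Ym \<psi>m(1)]
    show ?thesis by measurable
  qed
  have im_meas: "(\<lambda>f. ?im k f) \<in> borel_measurable M" for k
  proof -
    note [measurable] = measurable_functional[OF fourier_functionals(2)] measurable_compose[OF Ym \<psi>m(2)]
    show ?thesis by measurable
  qed
  define g where "g k i = (covariance (Z i) (coeff_re k))\<^sup>2 + (covariance (Z i) (coeff_im k))\<^sup>2" for k i
  have each: "ennreal (lam k - (\<Sum>i<n. g k i))
      \<le> (\<integral>\<^sup>+f. ?re k f + ?im k f \<partial>M)"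
    if k: "k \<in> F" for k
  proof -
    have err_re: "ennreal (covariance (coeff_re k) (coeff_re k) - (\<Sum>i<n. (covariance (coeff_re k) (Z i))\<^sup>2))
        \<le> (\<integral>\<^sup>+f. ?re k f \<partial>M)"
      by (rule err[of "coeff_re k" "\<lambda>y. Re (fourier d (\<phi> y) k)", OF fourier_functionals(1) \<psi>m(1)])
    have err_im: "ennreal (covariance (coeff_im k) (coeff_im k) - (\<Sum>i<n. (covariance (coeff_im k) (Z i))\<^sup>2))
        \<le> (\<integral>\<^sup>+f. ?im k f \<partial>M)"
      by (rule err[of "coeff_im k" "\<lambda>y. Im (fourier d (\<phi> y) k)", OF fourier_functionals(2) \<psi>m(2)])
    have "lam k = (\<integral>f. (coeff_re k f)\<^sup>2 + (coeff_im k f)\<^sup>2 \<partial>M)"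
      using expectation_fourier_power2[of k] k F by (auto simp: cmod_power2)
    also have "\<dots> = covariance (coeff_re k) (coeff_re k) + covariance (coeff_im k) (coeff_im k)"
      unfolding covariance_self by (intro Bochner_Integration.integral_add integrable_functional_power2 fourier_functionals)
    finally have lam_k: "lam k = covariance (coeff_re k) (coeff_re k) + covariance (coeff_im k) (coeff_im k)" .
    have split: "lam k - (\<Sum>i<n. g k i)
        = (covariance (coeff_re k) (coeff_re k) - (\<Sum>i<n. (covariance (coeff_re k) (Z i))\<^sup>2))
        + (covariance (coeff_im k) (coeff_im k) - (\<Sum>i<n. (covariance (coeff_im k) (Z i))\<^sup>2))"
    proof -
      have "g k i = (covariance (coeff_re k) (Z i))\<^sup>2 + (covariance (coeff_im k) (Z i))\<^sup>2" for i
        unfolding g_def covariance_commute[of "Z i" "coeff_re k"] covariance_commute[of "Z i" "coeff_im k"] ..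
      then show ?thesis by (simp add: sum.distrib lam_k)
    qed
    have "ennreal (lam k - (\<Sum>i<n. g k i)) \<le> ennreal (covariance (coeff_re k) (coeff_re k) - (\<Sum>i<n. (covariance (coeff_re k) (Z i))\<^sup>2))
        + ennreal (covariance (coeff_im k) (coeff_im k) - (\<Sum>i<n. (covariance (coeff_im k) (Z i))\<^sup>2))"
      unfolding split by (rule ennreal_plus_le)
    also have "\<dots> \<le> (\<integral>\<^sup>+f. ?re k f \<partial>M)
        + (\<integral>\<^sup>+f. ?im k f \<partial>M)"
      by (rule add_mono[OF err_re err_im])
    also have "\<dots> = (\<integral>\<^sup>+f. ?re k f + ?im k f \<partial>M)"
      by (intro nn_integral_add[symmetric] re_meas im_meas)
    finally show ?thesis .
  qed
  have "(\<Sum>k\<in>F. \<Sum>i<n. g k i) = (\<Sum>i<n. \<Sum>k\<in>F. g k i)" by (rule sum.swap)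
  also have "\<dots> \<le> (\<Sum>i<n. 1)"
  proof (rule sum_mono)
    fix i assume "i \<in> {..<n}"
    then show "(\<Sum>k\<in>F. g k i) \<le> 1"
      unfolding g_def using bessel_covariance[OF Z(1) F le1, of i] Z(2)[of i] by fastforce
  qed
  finally have "sum lam F - real n \<le> (\<Sum>k\<in>F. lam k - (\<Sum>i<n. g k i))"
    by (simp add: sum_subtractf)
  then have "ennreal (sum lam F - real n) \<le> ennreal (\<Sum>k\<in>F. lam k - (\<Sum>i<n. g k i))"
    by (rule ennreal_leI)
  also have "\<dots> \<le> (\<Sum>k\<in>F. ennreal (lam k - (\<Sum>i<n. g k i)))"
    using F(1)
  proof (induction F rule: finite_induct)
    case (insert k F)
    show ?case
      unfolding sum.insert[OF insert.hyps] by (rule order_trans[OF ennreal_plus_le add_left_mono[OF insert.IH]])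
  qed simp
  also have "\<dots> \<le> (\<Sum>k\<in>F. \<integral>\<^sup>+f. ?re k f + ?im k f \<partial>M)"
    by (intro sum_mono each)
  also have "\<dots> = (\<integral>\<^sup>+f. (\<Sum>k\<in>F. ?re k f + ?im k f) \<partial>M)"
    by (intro nn_integral_sum[symmetric] borel_measurable_add re_meas im_meas)
  also have "\<dots> \<le> (\<integral>\<^sup>+f. ennreal ((L2_norm d (\<lambda>x. f x - \<phi> (Y f) x))\<^sup>2) \<partial>M)"
  proof (rule nn_integral_mono)
    fix f assume f: "f \<in> space M"
    then have fL: "f \<in> L2_torus d" by (intro C_torus_L2) simp
    have \<phi>L: "\<phi> (Y f) \<in> L2_torus d"
      using measurable_space[OF \<phi> measurable_space[OF Ym f]] by (simp add: seminorm_borel_space)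
    have diff: "fourier d (\<lambda>x. f x - \<phi> (Y f) x) k = fourier d f k - fourier d (\<phi> (Y f)) k" for k
      using fourier_lincomb[OF fL \<phi>L, of "\<lambda>x. f x - \<phi> (Y f) x" 1 "-1"] by simp
    have "(\<Sum>k\<in>F. ?re k f + ?im k f)
        = ennreal (\<Sum>k\<in>F. (cmod (fourier d (\<lambda>x. f x - \<phi> (Y f) x) k))\<^sup>2)"
      by (simp add: diff cmod_power2 sum_ennreal flip: ennreal_plus)
    also have "\<dots> \<le> ennreal (\<integral>x. (f x - \<phi> (Y f) x)\<^sup>2 \<partial>T)"
      by (intro ennreal_leI fourier_bessel L2_torus_diff fL \<phi>L F)
    also have "\<dots> = ennreal ((L2_norm d (\<lambda>x. f x - \<phi> (Y f) x))\<^sup>2)"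
      by (simp only: L2_norm_power2[OF L2_torus_diff[OF fL \<phi>L]])
    finally show "(\<Sum>k\<in>F. ?re k f + ?im k f)
        \<le> ennreal ((L2_norm d (\<lambda>x. f x - \<phi> (Y f) x))\<^sup>2)" .
  qed
  finally show ?thesis unfolding Y_def .
qed

text \<open>
  The bound for one algorithm holds for every finite \<open>F\<close>; the supremum over \<open>F\<close> gives \<open>total\<close>.
\<close>

lemma min_avg_error_ge:
  assumes le1: "\<And>k. k \<in> lattice d \<Longrightarrow> lam k \<le> 1"
  shows "ennreal (sqrt (total - real n)) \<le> min_avg_error d M n"
proof (cases "n = 0")
  case True
  then show ?thesis by (simp add: initial_error)
next
  case False
  show ?thesis unfolding min_avg_error_def
  proof (rule INF_greatest)
    fix A assume "A \<in> algorithms d n"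
    then obtain L \<phi> where L: "\<And>i. i < n \<Longrightarrow> functional (L i)"
      and \<phi>: "\<phi> \<in> measurable (\<Pi>\<^sub>M i\<in>{..<n}. borel) (seminorm_borel (L2_torus d) (L2_norm d))"
      and A: "A = (\<lambda>f. \<phi> (\<lambda>i\<in>{..<n}. L i f))"
      using False unfolding algorithms_def by auto
    define v where "v = (\<integral>\<^sup>+f. ennreal ((L2_norm d (\<lambda>x. f x - A f x))\<^sup>2) \<partial>M)"
    have v: "ennreal (sum lam F - real n) \<le> v" if "finite F" "F \<subseteq> lattice d" for F
      unfolding v_def A using L \<phi> that by (rule algorithm_error_ge) (use le1 that in auto)
    have "ennreal (total - real n) \<le> v"
    proof (cases v)
      case (real w)
      have "sum lam F \<le> w + real n" if "finite F" "F \<subseteq> lattice d" for F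
        using v[OF that] real by (auto simp: ennreal_le_iff)
      then have "total \<le> w + real n"
        unfolding total_def by (intro infsum_le_finite_sums lam_summable)
      then show ?thesis using real by (simp add: ennreal_leI)
    qed simp
    then show "ennreal (sqrt (total - real n)) \<le> avg_error d M A"
      unfolding avg_error_def v_def[symmetric] ennreal_sqrt_ennreal[symmetric] by (rule ennreal_sqrt_mono)
  qed
qed

text \<open>
  The algorithm is the real part of the partial Fourier sum over \<open>F\<close>. Taking real parts does not
  increase the error because \<open>f\<close> is real, and \<open>F\<close> may be any finite set, not only a symmetric one.
\<close>

lemma min_avg_error_le:
  assumes F: "finite F" "F \<subseteq> lattice d" "F \<noteq> {}"
  shows "min_avg_error d M (2 * card F) \<le> ennreal (sqrt (total - sum lam F))"
proof -
  define m where "m = card F"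
  have m: "m > 0" using F by (simp add: m_def card_gt_0_iff)
  let ?P = "\<Pi>\<^sub>M i\<in>{..<2*m}. (borel :: real measure)"
  obtain g where g: "bij_betw g {0..<m} F"
    using ex_bij_betw_nat_finite[OF F(1)] unfolding m_def by blast
  have g_in: "g i \<in> lattice d" if "i < m" for i
    by (rule subsetD[OF F(2)]) (use bij_betwE[OF g] that in auto)
  \<comment> \<open>Information \<open>i < m\<close> is the real part of coefficient \<open>g i\<close>, information \<open>m + i\<close> its imaginary part; \<open>e i\<close> is the matching factor in the real part of the product.\<close>
  define L where "L i = (if i < m then coeff_re (g i) else coeff_im (g (i - m)))" for i
  define e where "e i x = (if i < m then Re (character d (g i) x) else - Im (character d (g (i - m)) x))" for i x
  define \<phi> where "\<phi> y x = (\<Sum>i<2*m. y i * e i x)" for y :: "nat \<Rightarrow> real" and x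
  have L: "functional (L i)" for i
    by (simp add: L_def fourier_functionals)
  have e_meas: "e i \<in> borel_measurable T" for i
    unfolding e_def[abs_def] by (cases "i < m") (simp_all, measurable)
  have e_le: "\<bar>e i x\<bar> \<le> 1" for i x
    using abs_Re_le_cmod[of "character d (g i) x"] abs_Im_le_cmod[of "character d (g (i - m)) x"]
    by (simp add: e_def)
  have \<phi>_abs: "\<bar>\<phi> y x\<bar> \<le> (\<Sum>i<2*m. \<bar>y i\<bar>)" for y x
    unfolding \<phi>_def using e_le
    by (intro order_trans[OF sum_abs] sum_mono) (simp add: abs_mult mult_left_le)
  have \<phi>_meas: "\<phi> y \<in> borel_measurable T" for y
    unfolding \<phi>_def[abs_def] using e_meas by (intro borel_measurable_sum borel_measurable_times) auto
  have \<phi>_L2: "\<phi> y \<in> L2_torus d" for y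
    by (rule bounded_L2_torus[OF \<phi>_meas \<phi>_abs])
  have \<phi>_dist: "L2_norm d (\<lambda>x. \<phi> z x - \<phi> y x) \<le> (\<Sum>i<2*m. \<bar>z i - y i\<bar>)" for y z
  proof -
    interpret T: prob_space T by (rule prob_space_torus_measure)
    have diff: "(\<lambda>x. \<phi> z x - \<phi> y x) = \<phi> (\<lambda>i. z i - y i)"
      by (auto simp: \<phi>_def sum_subtractf[symmetric] algebra_simps)
    define B where "B = (\<Sum>i<2*m. \<bar>z i - y i\<bar>)"
    have B: "B \<ge> 0" unfolding B_def by (intro sum_nonneg) auto
    have "(\<integral>x. (\<phi> (\<lambda>i. z i - y i) x)\<^sup>2 \<partial>T) \<le> (\<integral>x. B\<^sup>2 \<partial>T)"
    proof (rule integral_mono)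
      fix x
      have "\<bar>\<phi> (\<lambda>i. z i - y i) x\<bar>\<^sup>2 \<le> B\<^sup>2"
        unfolding B_def by (intro power_mono \<phi>_abs) simp
      then show "(\<phi> (\<lambda>i. z i - y i) x)\<^sup>2 \<le> B\<^sup>2" by simp
    qed (auto intro: L2_torusD(2)[OF \<phi>_L2])
    then have "(\<integral>x. (\<phi> (\<lambda>i. z i - y i) x)\<^sup>2 \<partial>T) \<le> B\<^sup>2" using T.prob_space by simp
    then show ?thesis unfolding diff L2_norm_def B_def[symmetric] using B
      by (simp add: real_sqrt_le_iff' real_le_lsqrt)
  qed
  have \<phi>_measurable: "\<phi> \<in> measurable ?P (seminorm_borel (L2_torus d) (L2_norm d))"
    unfolding seminorm_borel_def
  proof (rule measurable_measure_of)
    fix U assume "U \<in> {U. seminorm_open (L2_torus d) (L2_norm d) U}"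
    then have U: "seminorm_open (L2_torus d) (L2_norm d) U" by simp
    \<comment> \<open>The preimage is open in the product topology on all of \<^typ>\<open>nat \<Rightarrow> real\<close>, whose Borel sets restrict to those of \<open>?P\<close>.\<close>
    have op: "open {y. \<phi> y \<in> U}"
    proof (subst open_subopen, intro ballI)
      fix y assume "y \<in> {y. \<phi> y \<in> U}"
      then obtain r where r: "r > 0" "\<And>h. h \<in> L2_torus d \<Longrightarrow> L2_norm d (\<lambda>x. h x - \<phi> y x) < r \<Longrightarrow> h \<in> U"
        using U unfolding seminorm_open_def by blast
      have "open {z :: nat \<Rightarrow> real. (\<Sum>i<2*m. \<bar>z i - y i\<bar>) < r}"
        by (intro open_Collect_less continuous_intros continuous_on_product_coordinates)
      moreover have "y \<in> {z. (\<Sum>i<2*m. \<bar>z i - y i\<bar>) < r}" using r by simp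
      moreover have "{z. (\<Sum>i<2*m. \<bar>z i - y i\<bar>) < r} \<subseteq> {y. \<phi> y \<in> U}"
      proof
        fix z assume "z \<in> {z. (\<Sum>i<2*m. \<bar>z i - y i\<bar>) < r}"
        then have "L2_norm d (\<lambda>x. \<phi> z x - \<phi> y x) < r" using \<phi>_dist[of z y] by simp
        then show "z \<in> {y. \<phi> y \<in> U}" using r(2)[OF \<phi>_L2] by simp
      qed
      ultimately show "\<exists>V. open V \<and> y \<in> V \<and> V \<subseteq> {y. \<phi> y \<in> U}" by blast
    qed
    have incl: "(\<lambda>y. y) \<in> borel_measurable ?P"
    proof (rule measurable_coordinatewise_then_product)
      fix i :: nat
      show "(\<lambda>y. y i) \<in> borel_measurable ?P"
      proof (cases "i < 2 * m")
        case False
        then have "y i = undefined" if "y \<in> space ?P" for y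
          using that by (auto simp: space_PiM PiE_def extensional_def)
        then show ?thesis
          using measurable_cong[of ?P "\<lambda>y. y i" "\<lambda>_. undefined" borel] by simp
      qed (intro measurable_component_singleton, simp)
    qed
    have "(\<lambda>y. y) -` {y. \<phi> y \<in> U} \<inter> space ?P \<in> sets ?P"
      by (rule measurable_sets[OF incl borel_open[OF op]])
    then show "\<phi> -` U \<inter> space ?P \<in> sets ?P"
      by (simp add: vimage_def)
  qed (auto simp: \<phi>_L2 seminorm_open_def)
  define A where "A f = \<phi> (\<lambda>i\<in>{..<2*m}. L i f)" for f
  have "A \<in> algorithms d (2 * m)"
  proof -
    have "\<exists>L' \<phi>'. (\<forall>i<2 * m. functional (L' i)) \<and>
        \<phi>' \<in> measurable ?P (seminorm_borel (L2_torus d) (L2_norm d)) \<and>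
        A = (\<lambda>f. \<phi>' (\<lambda>i\<in>{..<2*m}. L' i f))"
      by (intro exI[of _ L] exI[of _ \<phi>] conjI allI impI L \<phi>_measurable) (simp add: A_def[abs_def])
    then show ?thesis using m unfolding algorithms_def by simp
  qed
  then have "min_avg_error d M (2 * m) \<le> avg_error d M A"
    unfolding min_avg_error_def by (rule INF_lower)
  also have "\<dots> \<le> ennreal_sqrt (ennreal (total - sum lam F))"
    unfolding avg_error_def
  proof (rule ennreal_sqrt_mono)
    have A_eq: "A f x = Re (\<Sum>k\<in>F. fourier d f k * character d k x)" for f x
    proof -
      have "A f x = (\<Sum>i<2*m. L i f * e i x)"
        by (simp add: A_def \<phi>_def)
      also have "\<dots> = (\<Sum>i\<in>{0..<m}. L i f * e i x) + (\<Sum>i\<in>{m..<m+m}. L i f * e i x)"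
        unfolding mult_2 lessThan_atLeast0 by (rule sum.atLeastLessThan_concat[symmetric]) auto
      also have "(\<Sum>i\<in>{m..<m+m}. L i f * e i x) = (\<Sum>i\<in>{0..<m}. L (i + m) f * e (i + m) x)"
        using sum.shift_bounds_nat_ivl[of "\<lambda>i. L i f * e i x" 0 m m] by simp
      also have "(\<Sum>i\<in>{0..<m}. L i f * e i x) + \<dots> = (\<Sum>i\<in>{0..<m}. Re (fourier d f (g i) * character d (g i) x))"
        unfolding sum.distrib[symmetric] by (intro sum.cong) (auto simp: L_def e_def)
      also have "\<dots> = (\<Sum>k\<in>F. Re (fourier d f k * character d k x))"
        by (rule sum.reindex_bij_betw[OF g])
      finally show ?thesis by simp
    qed
    have pointwise: "(L2_norm d (\<lambda>x. f x - A f x))\<^sup>2 \<le> (\<integral>x. (f x)\<^sup>2 \<partial>T) - (\<Sum>k\<in>F. (cmod (fourier d f k))\<^sup>2)"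
      if "f \<in> C_torus d" for f
    proof -
      interpret T: prob_space T by (rule prob_space_torus_measure)
      have fL: "f \<in> L2_torus d" using that by (rule C_torus_L2)
      note [measurable] = L2_torusD(1)[OF fL]
      define S where "S x = (\<Sum>k\<in>F. fourier d f k * character d k x)" for x
      have Sm [measurable]: "S \<in> borel_measurable T" unfolding S_def[abs_def] by measurable
      have AL: "A f \<in> L2_torus d" by (simp add: A_def \<phi>_L2)
      have le: "(f x - A f x)\<^sup>2 \<le> (cmod (complex_of_real (f x) - S x))\<^sup>2" for x
      proof -
        have "f x - A f x = Re (complex_of_real (f x) - S x)" by (simp add: A_eq S_def)
        then have "\<bar>f x - A f x\<bar> \<le> cmod (complex_of_real (f x) - S x)" using abs_Re_le_cmod by metis
        then have "\<bar>f x - A f x\<bar>\<^sup>2 \<le> (cmod (complex_of_real (f x) - S x))\<^sup>2" by (rule power_mono) simp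
        then show ?thesis by simp
      qed
      have "(L2_norm d (\<lambda>x. f x - A f x))\<^sup>2 = (\<integral>x. (f x - A f x)\<^sup>2 \<partial>T)"
        by (rule L2_norm_power2[OF L2_torus_diff[OF fL AL]])
      also have "\<dots> \<le> (\<integral>x. (cmod (complex_of_real (f x) - S x))\<^sup>2 \<partial>T)"
      proof (rule integral_mono[OF L2_torusD(2)[OF L2_torus_diff[OF fL AL]] _ le])
        define B where "B = sup_norm d f + (\<Sum>k\<in>F. cmod (fourier d f k))"
        have "cmod (complex_of_real (f x) - S x) \<le> B" if "x \<in> torus d" for x
        proof -
          have "cmod (complex_of_real (f x) - S x) \<le> cmod (complex_of_real (f x)) + cmod (S x)"
            by (rule norm_triangle_ineq4)
          also have "cmod (S x) \<le> (\<Sum>k\<in>F. cmod (fourier d f k * character d k x))"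
            unfolding S_def by (rule norm_sum)
          also have "\<dots> = (\<Sum>k\<in>F. cmod (fourier d f k))" by (simp add: norm_mult)
          finally show ?thesis
            using abs_le_sup_norm[OF \<open>f \<in> C_torus d\<close> that] by (simp add: B_def)
        qed
        then show "integrable T (\<lambda>x. (cmod (complex_of_real (f x) - S x))\<^sup>2)"
          by (intro T.integrable_const_bound[of _ "B\<^sup>2"] AE_I2) (auto intro!: power_mono)
      qed
      also have "\<dots> = (\<integral>x. (f x)\<^sup>2 \<partial>T) - (\<Sum>k\<in>F. (cmod (fourier d f k))\<^sup>2)"
        unfolding S_def by (rule fourier_residual[OF fL F(1,2)])
      finally show ?thesis .
    qed
    have iF: "integrable M (\<lambda>f. \<Sum>k\<in>F. (cmod (fourier d f k))\<^sup>2)"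
      by (intro Bochner_Integration.integrable_sum integrable_fourier_power2)
    have "(\<integral>\<^sup>+f. ennreal ((L2_norm d (\<lambda>x. f x - A f x))\<^sup>2) \<partial>M)
        \<le> (\<integral>\<^sup>+f. ennreal ((\<integral>x. (f x)\<^sup>2 \<partial>T) - (\<Sum>k\<in>F. (cmod (fourier d f k))\<^sup>2)) \<partial>M)"
      by (intro nn_integral_mono ennreal_leI pointwise) simp
    also have "\<dots> = ennreal (\<integral>f. (\<integral>x. (f x)\<^sup>2 \<partial>T) - (\<Sum>k\<in>F. (cmod (fourier d f k))\<^sup>2) \<partial>M)"
    proof (rule nn_integral_eq_integral)
      show "integrable M (\<lambda>f. (\<integral>x. (f x)\<^sup>2 \<partial>T) - (\<Sum>k\<in>F. (cmod (fourier d f k))\<^sup>2))"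
        by (intro Bochner_Integration.integrable_diff energy iF)
      show "AE f in M. 0 \<le> (\<integral>x. (f x)\<^sup>2 \<partial>T) - (\<Sum>k\<in>F. (cmod (fourier d f k))\<^sup>2)"
        using fourier_bessel[OF C_torus_L2 F(1,2)] by (intro AE_I2) simp
    qed
    also have "(\<integral>f. (\<integral>x. (f x)\<^sup>2 \<partial>T) - (\<Sum>k\<in>F. (cmod (fourier d f k))\<^sup>2) \<partial>M) = total - sum lam F"
    proof -
      have "(\<integral>f. (\<Sum>k\<in>F. (cmod (fourier d f k))\<^sup>2) \<partial>M) = (\<Sum>k\<in>F. lam k)"
        unfolding Bochner_Integration.integral_sum[OF integrable_fourier_power2]
        using F(2) expectation_fourier_power2 by (intro sum.cong) auto
      then show ?thesis
        using Bochner_Integration.integral_diff[OF energy(1) iF] energy(2) by simp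
    qed
    finally show "(\<integral>\<^sup>+f. ennreal ((L2_norm d (\<lambda>x. f x - A f x))\<^sup>2) \<partial>M) \<le> ennreal (total - sum lam F)" .
  qed
  finally show ?thesis unfolding ennreal_sqrt_ennreal m_def .
qed

end

section \<open>Information complexity and tractability\<close>

text \<open>
  Markov's inequality bounds the cardinality, and off the set \<open>(w k)\<^sup>2 \<le> (e / S) w k\<close>.
\<close>

lemma threshold_set:
  fixes w :: "'a \<Rightarrow> real"
  assumes w: "\<And>k. k \<in> A \<Longrightarrow> 0 \<le> w k" "w summable_on A" "(\<lambda>k. (w k)\<^sup>2) summable_on A"
    and S: "infsum w A = S" "S > 0" and e: "e > 0"
  defines "F \<equiv> {k \<in> A. e / S \<le> w k}"
  shows "finite F" "real (card F) \<le> S\<^sup>2 / e" "infsum (\<lambda>k. (w k)\<^sup>2) A - (\<Sum>k\<in>F. (w k)\<^sup>2) \<le> e"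
proof -
  have bound: "real (card G) \<le> S\<^sup>2 / e" if G: "finite G" "G \<subseteq> F" for G
  proof -
    have "real (card G) * (e / S) = (\<Sum>k\<in>G. e / S)" by simp
    also have "\<dots> \<le> sum w G" using G by (intro sum_mono) (auto simp: F_def)
    also have "\<dots> \<le> S"
      unfolding S(1)[symmetric] using w G by (intro finite_sum_le_infsum) (auto simp: F_def)
    finally show ?thesis using S(2) e by (simp add: field_simps power2_eq_square)
  qed
  show fin: "finite F"
  proof (rule finite_if_finite_subsets_card_bdd[THEN conjunct1, of _ "nat \<lceil>S\<^sup>2 / e\<rceil>"])
    fix G assume "G \<subseteq> F" "finite G"
    then show "card G \<le> nat \<lceil>S\<^sup>2 / e\<rceil>" using bound[of G] by linarith
  qed
  show "real (card F) \<le> S\<^sup>2 / e" using bound[OF fin] by simp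
  have sub: "A - F \<subseteq> A" by auto
  note s1 = summable_on_subset_banach[OF w(2) sub] and s2 = summable_on_subset_banach[OF w(3) sub]
  have "infsum (\<lambda>k. (w k)\<^sup>2) A - (\<Sum>k\<in>F. (w k)\<^sup>2) = infsum (\<lambda>k. (w k)\<^sup>2) (A - F)"
    using fin w(3) by (subst infsum_Diff) (auto simp: F_def)
  also have "\<dots> \<le> infsum (\<lambda>k. (e / S) * w k) (A - F)"
  proof (rule infsum_mono[OF s2 summable_on_cmult_right[OF s1]])
    fix k assume k: "k \<in> A - F"
    then show "(w k)\<^sup>2 \<le> e / S * w k"
      unfolding power2_eq_square using w(1)[of k] by (intro mult_right_mono) (auto simp: F_def)
  qed
  also have "\<dots> = (e / S) * infsum w (A - F)"
    by (rule infsum_cmult_right[OF s1])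
  also have "\<dots> \<le> (e / S) * S"
    unfolding S(1)[symmetric] using S e w s1 by (intro mult_left_mono infsum_mono2) auto
  finally show "infsum (\<lambda>k. (w k)\<^sup>2) A - (\<Sum>k\<in>F. (w k)\<^sup>2) \<le> e" using S(2) by simp
qed

lemma gevrey_weight_square: "(gevrey_weight \<alpha> c p d k)\<^sup>2 = gevrey_weight \<alpha> (2 * c) p d k"
  by (simp add: gevrey_weight_def power2_eq_square flip: exp_add)

lemma gevrey_summable:
  assumes "\<alpha> > 0" "c > 0" "p > 0" "d \<ge> 1"
  shows "gevrey_weight \<alpha> c p d summable_on lattice d"
proof -
  obtain N where "N > 0" "real N * \<alpha> \<ge> 2" using lattice_exponent_exists assms by metis
  then show ?thesis using gevrey_sum_le(1)[OF assms] by blast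
qed

lemma stationary_gaussian_gevrey:
  assumes "\<alpha> > 0" "\<beta> > 0" "p > 0" "d \<ge> 1"
    and "zero_mean_gaussian d M" "has_covariance_kernel d M (gevrey_kernel d \<alpha> \<beta> p)"
  shows "stationary_gaussian d M (gevrey_weight \<alpha> (2 * \<beta>) p d)"
proof
  show "zero_mean_gaussian d M" by fact
  have "gevrey_kernel d \<alpha> \<beta> p = (\<lambda>x y. \<Sum>\<^sub>\<infinity>k\<in>lattice d. complex_of_real (gevrey_weight \<alpha> (2 * \<beta>) p d k) *
      exp (\<i> * complex_of_real (\<Sum>j<d. real_of_int (k j) * (x j - y j))))"
    by (intro ext) (simp add: gevrey_kernel_def gevrey_weight_def)
  then show "has_covariance_kernel d M (\<lambda>x y. \<Sum>\<^sub>\<infinity>k\<in>lattice d. complex_of_real (gevrey_weight \<alpha> (2 * \<beta>) p d k) *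
      exp (\<i> * complex_of_real (\<Sum>j<d. real_of_int (k j) * (x j - y j))))"
    using assms(6) by simp
  show "gevrey_weight \<alpha> (2 * \<beta>) p d summable_on lattice d"
    using assms by (intro gevrey_summable) auto
qed (rule less_imp_le[OF gevrey_weight_pos])

text \<open>
  The squared tolerance is at least \<open>\<epsilon>\<^sup>2\<close> and at most \<open>\<epsilon>\<^sup>2\<close> times the squared initial error under
  both criteria, because that error is at least \<open>1\<close>; so the two criteria are treated at once.
\<close>

lemma info_complexity_bounds:
  assumes "\<alpha> > 0" "\<beta> > 0" "p > 0" "d \<ge> 1" and \<epsilon>: "0 < \<epsilon>" "\<epsilon> < 1"
    and "zero_mean_gaussian d (\<mu> d)" "has_covariance_kernel d (\<mu> d) (gevrey_kernel d \<alpha> \<beta> p)"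
  obtains m where "info_complexity crit \<mu> \<epsilon> d = enat m"
    "(1 - \<epsilon>\<^sup>2) * gevrey_sum \<alpha> (2 * \<beta>) p d \<le> real m"
    "real m \<le> 2 * (gevrey_sum \<alpha> \<beta> p d)\<^sup>2 / \<epsilon>\<^sup>2"
proof -
  interpret stationary_gaussian d "\<mu> d" "gevrey_weight \<alpha> (2 * \<beta>) p d"
    using assms by (intro stationary_gaussian_gevrey)
  have total1: "total \<ge> 1"
    unfolding total_def using assms by (intro gevrey_sum_ge_1) auto
  have CRI: "CRI crit d (\<mu> d) = ennreal (if crit = ABS then 1 else sqrt total)"
    by (cases crit) (simp_all add: initial_error)
  define c where "c = (if crit = ABS then 1 else sqrt total)"
  have c: "1 \<le> c" "c \<le> sqrt total" using total1 by (auto simp: c_def)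
  have crit: "ennreal \<epsilon> * CRI crit d (\<mu> d) = ennreal (\<epsilon> * c)"
    unfolding CRI c_def[symmetric] using \<epsilon> c by (simp add: ennreal_mult)
  define S where "S = {n. min_avg_error d (\<mu> d) n \<le> ennreal \<epsilon> * CRI crit d (\<mu> d)}"
  define B where "B = gevrey_sum \<alpha> \<beta> p d"
  have B1: "B \<ge> 1" unfolding B_def using assms by (intro gevrey_sum_ge_1) auto
  define F where "F = {k \<in> lattice d. \<epsilon>\<^sup>2 / B \<le> gevrey_weight \<alpha> \<beta> p d k}"
  have F: "finite F" "real (card F) \<le> B\<^sup>2 / \<epsilon>\<^sup>2"
    "infsum (\<lambda>k. (gevrey_weight \<alpha> \<beta> p d k)\<^sup>2) (lattice d) - (\<Sum>k\<in>F. (gevrey_weight \<alpha> \<beta> p d k)\<^sup>2) \<le> \<epsilon>\<^sup>2"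
    unfolding F_def
    by (rule threshold_set[OF less_imp_le[OF gevrey_weight_pos]];
        use assms B1 in \<open>simp add: B_def[symmetric] gevrey_weight_square gevrey_summable\<close>)+
  have "(\<lambda>j\<in>{..<d}. 0) \<in> F"
  proof -
    have "\<epsilon>\<^sup>2 \<le> 1" using \<epsilon> by (simp add: power_le_one)
    then have "\<epsilon>\<^sup>2 / B \<le> 1" using B1 by (simp add: divide_le_eq)
    then show ?thesis using assms by (simp add: F_def gevrey_weight_def p_norm_def)
  qed
  then have "F \<noteq> {}" by blast
  then have "min_avg_error d (\<mu> d) (2 * card F) \<le> ennreal (sqrt (total - sum (gevrey_weight \<alpha> (2 * \<beta>) p d) F))"
    using F(1) by (intro min_avg_error_le) (auto simp: F_def)
  also have "\<dots> \<le> ennreal (\<epsilon> * c)"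
  proof (rule ennreal_leI)
    have "sqrt (total - sum (gevrey_weight \<alpha> (2 * \<beta>) p d) F) \<le> sqrt (\<epsilon>\<^sup>2)"
      using F(3) unfolding total_def by (intro real_sqrt_le_mono) (simp add: gevrey_weight_square)
    also have "\<dots> = \<epsilon> * 1" using \<epsilon> by simp
    also have "\<dots> \<le> \<epsilon> * c" using c \<epsilon> by (intro mult_left_mono) auto
    finally show "sqrt (total - sum (gevrey_weight \<alpha> (2 * \<beta>) p d) F) \<le> \<epsilon> * c" .
  qed
  finally have inS: "2 * card F \<in> S" by (simp add: S_def crit)
  have "Inf (enat ` S) \<in> enat ` S"
    unfolding Inf_enat_def using inS by (auto intro: LeastI)
  then obtain m where m: "m \<in> S" "Inf (enat ` S) = enat m" by auto
  have "Inf (enat ` S) \<le> enat (2 * card F)" using inS by (intro Inf_lower) auto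
  then have m_le: "m \<le> 2 * card F" unfolding m(2) by simp
  show thesis
  proof
    show "info_complexity crit \<mu> \<epsilon> d = enat m"
      unfolding info_complexity_def S_def[symmetric] by (rule m(2))
    have "real m \<le> real (2 * card F)" using m_le by (simp only: of_nat_le_iff)
    also have "\<dots> \<le> 2 * (B\<^sup>2 / \<epsilon>\<^sup>2)" using F(2) by simp
    finally show "real m \<le> 2 * (gevrey_sum \<alpha> \<beta> p d)\<^sup>2 / \<epsilon>\<^sup>2"
      by (simp add: B_def)
    have "ennreal (sqrt (total - real m)) \<le> min_avg_error d (\<mu> d) m"
      using assms by (intro min_avg_error_ge gevrey_weight_le_1) auto
    also have "\<dots> \<le> ennreal (\<epsilon> * c)" using m(1) by (simp add: S_def crit)
    finally have "sqrt (total - real m) \<le> \<epsilon> * c" using \<epsilon> c by (simp add: ennreal_le_iff)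
    also have "\<dots> \<le> \<epsilon> * sqrt total" using \<epsilon> c by (intro mult_left_mono) auto
    also have "\<dots> = sqrt (\<epsilon>\<^sup>2 * total)" using \<epsilon> by (simp add: real_sqrt_mult)
    finally have "total - real m \<le> \<epsilon>\<^sup>2 * total" by simp
    then show "(1 - \<epsilon>\<^sup>2) * gevrey_sum \<alpha> (2 * \<beta>) p d \<le> real m"
      unfolding total_def[symmetric] by (simp add: algebra_simps)
  qed
qed

text \<open>
  The logarithm of the bound splits into \<open>2 ln (B d)\<close> and \<open>2 ln (1/\<epsilon>)\<close>. Each is at most a small multiple
  of its own term in the denominator \<open>\<epsilon>\<^bsup>-s\<^esup> + d\<^sup>t\<close> plus a constant, and the denominator tends to infinity
  with \<open>1/\<epsilon> + d\<close>.
\<close>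

lemma weak_tractability_if_ln_small:
  fixes n :: "real \<Rightarrow> nat \<Rightarrow> enat" and B :: "nat \<Rightarrow> real"
  assumes s: "s > 0" and t: "t > 0"
    and n: "\<And>\<epsilon> d. 0 < \<epsilon> \<Longrightarrow> \<epsilon> < 1 \<Longrightarrow> d \<ge> 1 \<Longrightarrow> \<exists>m\<ge>1. n \<epsilon> d = enat m \<and> real m \<le> 2 * (B d)\<^sup>2 / \<epsilon>\<^sup>2"
    and B: "\<And>d. d \<ge> 1 \<Longrightarrow> B d \<ge> 1" and lim: "(\<lambda>d. ln (B d) / real d powr t) \<longlonglongrightarrow> 0"
  shows "ALG_WT_st s t n"
proof -
  let ?F = "(\<lambda>(\<epsilon>, d). 1 / \<epsilon> + real d) going_to at_top within {0<..<1::real} \<times> {1::nat..}"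
  define h where "h = (\<lambda>(\<epsilon>, d). ln (real (the_enat (n \<epsilon> d))) / (\<epsilon> powr (- s) + real d powr t))"
  have "(h \<longlongrightarrow> 0) ?F"
  proof (rule tendstoI)
    fix e :: real assume e: "e > 0"
    have "\<forall>\<^sub>F d in sequentially. \<bar>ln (B d) / real d powr t\<bar> < e / 8"
      using tendstoD[OF lim, of "e / 8"] e by (simp add: dist_real_def)
    then obtain D where D: "\<And>d. d \<ge> D \<Longrightarrow> \<bar>ln (B d) / real d powr t\<bar> < e / 8"
      unfolding eventually_sequentially by blast
    define K where "K = (\<Sum>d<D. \<bar>2 * ln (B d)\<bar>)"
    have K0: "K \<ge> 0" unfolding K_def by (intro sum_nonneg) auto
    have K: "2 * ln (B d) \<le> e / 4 * real d powr t + K" if "d \<ge> 1" for d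
    proof (cases "d < D")
      case True
      then have "\<bar>2 * ln (B d)\<bar> \<le> K" unfolding K_def by (intro member_le_sum) auto
      moreover have "0 \<le> e / 4 * real d powr t" using e by simp
      ultimately show ?thesis by linarith
    next
      case False
      then have "ln (B d) / real d powr t < e / 8"
        by (intro le_less_trans[OF abs_ge_self D]) simp
      then have "ln (B d) < e / 8 * real d powr t" using that by (simp add: divide_less_eq)
      then show ?thesis using K0 by linarith
    qed
    have "((\<lambda>x::real. ln x / x powr s) \<longlongrightarrow> 0) at_top" using s by real_asymp
    then have "\<forall>\<^sub>F x::real in at_top. \<bar>ln x / x powr s\<bar> < e / 8"
      using tendstoD[of "\<lambda>x::real. ln x / x powr s" 0 at_top "e / 8"] e by (simp add: dist_real_def)
    then obtain X where X: "\<And>x::real. x \<ge> X \<Longrightarrow> \<bar>ln x / x powr s\<bar> < e / 8"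
      unfolding eventually_at_top_linorder by blast
    define K' where "K' = 2 * ln (max 1 X)"
    have K'0: "K' \<ge> 0" by (simp add: K'_def)
    have K': "2 * ln x \<le> e / 4 * x powr s + K'" if x: "x \<ge> 1" for x :: real
    proof (cases "x < X")
      case True
      then have "2 * ln x \<le> K'" unfolding K'_def using x by simp
      moreover have "0 \<le> e / 4 * x powr s" using e by simp
      ultimately show ?thesis by linarith
    next
      case False
      then have "ln x / x powr s < e / 8"
        by (intro le_less_trans[OF abs_ge_self X]) simp
      then have "ln x < e / 8 * x powr s" using x by (simp add: divide_less_eq)
      then show ?thesis using K'0 by linarith
    qed
    define Kt where "Kt = ln 2 + K + K'"
    have Kt: "Kt > 0" using K0 K'0 by (simp add: Kt_def add_pos_nonneg)
    define r where "r = min s t"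
    have r: "r > 0" "r \<le> s" "r \<le> t" using s t by (auto simp: r_def)
    \<comment> \<open>If \<open>1/\<epsilon>\<close> or \<open>d\<close> is at least \<open>Q\<close>, the denominator is at least \<open>2 Kt / e\<close>, so the constant \<open>Kt\<close> contributes at most \<open>e/2\<close>.\<close>
    define Q where "Q = max 1 ((2 * Kt / e) powr (1 / r))"
    have Q1: "Q \<ge> 1" by (simp add: Q_def)
    have Q: "Q powr r \<ge> 2 * Kt / e"
    proof -
      have "((2 * Kt / e) powr (1 / r)) powr r \<le> Q powr r"
        using r by (intro powr_mono2) (auto simp: Q_def)
      then show ?thesis using Kt e r by (simp add: powr_powr)
    qed
    show "\<forall>\<^sub>F x in ?F. dist (h x) 0 < e"
      unfolding eventually_going_to_at_top_linorder
    proof (intro exI[of _ "2 * Q"] ballI impI)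
      fix z :: "real \<times> nat" assume z: "z \<in> {0<..<1} \<times> {1..}" "2 * Q \<le> (case z of (\<epsilon>, d) \<Rightarrow> 1 / \<epsilon> + real d)"
      obtain \<epsilon> d where zd: "z = (\<epsilon>, d)" by (cases z)
      have \<epsilon>: "0 < \<epsilon>" "\<epsilon> < 1" and d: "d \<ge> 1" and big: "2 * Q \<le> 1 / \<epsilon> + real d"
        using z by (auto simp: zd)
      define x where "x = 1 / \<epsilon>"
      have x: "x \<ge> 1" "\<epsilon> powr (- s) = x powr s" using \<epsilon> by (auto simp: x_def powr_divide powr_minus_divide)
      obtain m where m: "m \<ge> 1" "n \<epsilon> d = enat m" "real m \<le> 2 * (B d)\<^sup>2 / \<epsilon>\<^sup>2"
        using n[OF \<epsilon> d] by blast
      have "ln (real m) \<le> ln (2 * (B d)\<^sup>2 * x\<^sup>2)"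
        using m by (intro iffD2[OF ln_le_cancel_iff]) (auto simp: x_def power_divide)
      also have "\<dots> = ln 2 + 2 * ln (B d) + 2 * ln x"
        using B[OF d] x by (simp add: ln_mult ln_realpow)
      also have "\<dots> \<le> ln 2 + (e / 4 * real d powr t + K) + (e / 4 * x powr s + K')"
        using K[OF d] K'[OF x(1)] by linarith
      finally have ln_m: "ln (real m) \<le> e / 4 * (x powr s + real d powr t) + Kt"
        by (simp add: Kt_def algebra_simps)
      have "Q \<le> x \<or> Q \<le> real d" using big unfolding x_def by linarith
      then have "Q powr r \<le> x powr s + real d powr t"
      proof
        assume "Q \<le> x"
        then have "Q powr r \<le> x powr r" using Q1 r by (intro powr_mono2) auto
        also have "\<dots> \<le> x powr s" using x r by (intro powr_mono) auto
        finally show ?thesis by (simp add: add_increasing2)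
      next
        assume "Q \<le> real d"
        then have "Q powr r \<le> real d powr r" using Q1 r by (intro powr_mono2) auto
        also have "\<dots> \<le> real d powr t" using d r by (intro powr_mono) auto
        finally show ?thesis by (simp add: add_increasing)
      qed
      then have den: "2 * Kt / e \<le> x powr s + real d powr t" using Q by linarith
      define y where "y = x powr s + real d powr t"
      have y: "y > 0" unfolding y_def using x by (intro add_pos_nonneg) auto
      have "Kt \<le> e / 2 * y" using den e by (simp add: y_def field_simps)
      then have "ln (real m) \<le> e * (3 / 4) * y" using ln_m by (simp add: y_def[symmetric])
      also have "\<dots> < e * y" using e y by simp
      finally have "ln (real m) / y < e" using y by (simp add: divide_less_eq)
      moreover have "0 \<le> ln (real m) / y" using m y by simp
      ultimately show "dist (h z) 0 < e"
        by (simp add: zd h_def m(2) x(2) y_def[symmetric])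
    qed
  qed
  then have "((\<lambda>x. ereal (h x)) \<longlongrightarrow> ereal 0) ?F" by (rule tendsto_ereal)
  moreover have "\<forall>\<^sub>F x in ?F. ereal (h x) = (case x of (\<epsilon>, d) \<Rightarrow> ln_enat (n \<epsilon> d) / ereal (\<epsilon> powr (- s) + real d powr t))"
    unfolding eventually_going_to_at_top_linorder
  proof (intro exI[of _ 0] ballI impI)
    fix z :: "real \<times> nat" assume z: "z \<in> {0<..<1} \<times> {1..}"
    obtain \<epsilon> d where zd: "z = (\<epsilon>, d)" by (cases z)
    have \<epsilon>: "0 < \<epsilon>" "\<epsilon> < 1" and d: "d \<ge> 1" using z by (auto simp: zd)
    obtain m where m: "m \<ge> 1" "n \<epsilon> d = enat m" using n[OF \<epsilon> d] by blast
    have "\<epsilon> powr (- s) + real d powr t \<noteq> 0"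
      using \<epsilon> add_pos_nonneg[of "\<epsilon> powr (- s)" "real d powr t"] by simp
    then show "ereal (h z) = (case z of (\<epsilon>, d) \<Rightarrow> ln_enat (n \<epsilon> d) / ereal (\<epsilon> powr (- s) + real d powr t))"
      using m by (simp add: zd h_def)
  qed
  ultimately show ?thesis
    unfolding ALG_WT_st_def zero_ereal_def by (rule Lim_transform_eventually)
qed

text \<open>
  Fix \<open>\<epsilon>\<close>. Along infinitely many \<open>d\<close> the logarithm of the complexity grows at least linearly with slope
  \<open>ln (1 + \<gamma>)\<close>, while the denominator is at most \<open>d\<close> plus a constant.
\<close>

lemma curse_imp_not_weakly_tractable:
  assumes curse: "curse_of_dimensionality n" and t: "0 < t" "t \<le> 1"
  shows "\<not> ALG_WT_st s t n"
proof
  assume wt: "ALG_WT_st s t n"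
  from curse obtain C \<epsilon>0 \<gamma> where C: "C > 0" and e0: "\<epsilon>0 > 0" and \<gamma>: "\<gamma> > 0"
    and inf: "\<And>\<epsilon>. 0 < \<epsilon> \<Longrightarrow> \<epsilon> \<le> \<epsilon>0 \<Longrightarrow> \<epsilon> < 1 \<Longrightarrow>
        infinite {d. d \<ge> 1 \<and> ereal (C * (1 + \<gamma>) ^ d) \<le> ereal_of_enat (n \<epsilon> d)}"
    unfolding curse_of_dimensionality_def by blast
  define \<epsilon> where "\<epsilon> = min \<epsilon>0 (1 / 2)"
  have \<epsilon>: "0 < \<epsilon>" "\<epsilon> \<le> \<epsilon>0" "\<epsilon> < 1" using e0 by (auto simp: \<epsilon>_def)
  define g where "g = ln (1 + \<gamma>)"
  have g: "g > 0" using \<gamma> by (simp add: g_def)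
  \<comment> \<open>Any bound below \<open>g\<close> on the quotient would do; \<open>g / 4\<close> leaves slope \<open>3/4 g\<close>, which leaves only \<open>d \<le> R\<close> among the \<open>d \<ge> C0\<close>.\<close>
  have "\<forall>\<^sub>F x in (\<lambda>(\<epsilon>, d). 1 / \<epsilon> + real d) going_to at_top within {0<..<1} \<times> {1..}.
      (case x of (\<epsilon>, d) \<Rightarrow> ln_enat (n \<epsilon> d) / ereal (\<epsilon> powr (- s) + real d powr t)) < ereal (g / 4)"
    using wt g unfolding ALG_WT_st_def by (intro order_tendstoD(2)) auto
  then obtain C0 where C0: "\<And>z. z \<in> {0<..<1} \<times> {1..} \<Longrightarrow> C0 \<le> (case z of (\<epsilon>, d) \<Rightarrow> 1 / \<epsilon> + real d) \<Longrightarrow>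
      (case z of (\<epsilon>, d) \<Rightarrow> ln_enat (n \<epsilon> d) / ereal (\<epsilon> powr (- s) + real d powr t)) < ereal (g / 4)"
    unfolding eventually_going_to_at_top_linorder by blast
  define R where "R = (g / 4 * \<epsilon> powr (- s) - ln C) / (3 / 4 * g)"
  have "d \<le> nat \<lceil>max C0 R\<rceil>" if d: "d \<ge> 1" "ereal (C * (1 + \<gamma>) ^ d) \<le> ereal_of_enat (n \<epsilon> d)" for d
  proof (rule ccontr)
    assume "\<not> d \<le> nat \<lceil>max C0 R\<rceil>"
    then have big: "C0 \<le> real d" "R < real d" by linarith+
    define y where "y = \<epsilon> powr (- s) + real d powr t"
    have y: "y > 0" unfolding y_def using \<epsilon> by (intro add_pos_nonneg) auto
    have "C0 \<le> 1 / \<epsilon> + real d" using big(1) \<epsilon> by (simp add: add_increasing)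
    then have q: "ln_enat (n \<epsilon> d) / ereal y < ereal (g / 4)"
      using C0[of "(\<epsilon>, d)"] \<epsilon> d by (simp add: y_def)
    obtain m where m: "n \<epsilon> d = enat m"
      using q y by (cases "n \<epsilon> d") auto
    have pos: "0 < C * (1 + \<gamma>) ^ d" using C \<gamma> by simp
    have le: "C * (1 + \<gamma>) ^ d \<le> real m" using d(2) m by simp
    then have "m \<noteq> 0" using pos by (cases m) auto
    then have "ln (real m) / y < g / 4" using q y m by simp
    then have "ln (real m) < g / 4 * y" using y by (simp add: divide_less_eq)
    moreover have "ln C + real d * g \<le> ln (real m)"
    proof -
      have "ln C + real d * g = ln (C * (1 + \<gamma>) ^ d)"
        using C \<gamma> by (simp add: ln_mult ln_realpow g_def)
      also have "\<dots> \<le> ln (real m)" using le pos by (intro iffD2[OF ln_le_cancel_iff]) auto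
      finally show ?thesis .
    qed
    moreover have "g / 4 * y \<le> g / 4 * \<epsilon> powr (- s) + g / 4 * real d"
    proof -
      have "real d powr t \<le> real d powr 1" using d t by (intro powr_mono) auto
      then have "g / 4 * y \<le> g / 4 * (\<epsilon> powr (- s) + real d)"
        unfolding y_def using g d by (intro mult_left_mono add_left_mono) auto
      then show ?thesis by (simp add: algebra_simps)
    qed
    ultimately have "real d * (3 / 4 * g) < g / 4 * \<epsilon> powr (- s) - ln C" by (simp add: algebra_simps)
    then have "real d < R" using g by (simp add: R_def less_divide_eq)
    then show False using big by simp
  qed
  then have "{d. d \<ge> 1 \<and> ereal (C * (1 + \<gamma>) ^ d) \<le> ereal_of_enat (n \<epsilon> d)} \<subseteq> {..nat \<lceil>max C0 R\<rceil>}"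
    by auto
  then show False using inf[OF \<epsilon>] finite_subset by blast
qed

text \<open>
  A polynomial bound of degree \<open>a\<close> contradicts the lower bound by \<open>d choose m \<ge> (d/m)\<^sup>m\<close> as soon as
  \<open>m \<ge> a + 1\<close>.
\<close>

lemma superpolynomial_at_half:
  fixes n :: "real \<Rightarrow> nat \<Rightarrow> enat"
  assumes n: "\<And>d m. d \<ge> 1 \<Longrightarrow> ereal (c m * real (d choose m)) \<le> ereal_of_enat (n (1 / 2) d)"
    and c: "\<And>m. c m > 0"
    and poly: "\<And>d. d \<ge> 1 \<Longrightarrow> ereal_of_enat (n (1 / 2) d) \<le> ereal (C * real d powr a)"
  shows False
proof -
  define m where "m = nat \<lceil>a\<rceil> + 1"
  have m: "real m \<ge> a + 1" "m \<ge> 1" unfolding m_def by linarith+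
  define K where "K = max 1 (C * real m ^ m / c m)"
  define d where "d = m + nat \<lceil>K\<rceil> + 1"
  have d: "d \<ge> m" "d \<ge> 1" "real d > K" unfolding d_def by linarith+
  have "ereal (c m * real (d choose m)) \<le> ereal (C * real d powr a)"
    using n[OF d(2)] poly[OF d(2)] by (rule order_trans)
  then have le: "c m * real (d choose m) \<le> C * real d powr a" by simp
  have "c m * (real d / real m) ^ m \<le> c m * real (d choose m)"
    using binomial_ge_n_over_k_pow_k[OF d(1), where 'a=real] c[of m] by (intro mult_left_mono) auto
  also note le
  finally have "c m * real d ^ m \<le> C * real m ^ m * real d powr a"
    using m(2) by (simp add: power_divide field_simps)
  then have "real d ^ m \<le> C * real m ^ m / c m * real d powr a"
    using c[of m] by (simp add: field_simps)
  also have "\<dots> \<le> K * real d powr a" unfolding K_def by (intro mult_right_mono) auto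
  also have "\<dots> < real d * real d powr a" using d by (intro mult_strict_right_mono) auto
  also have "\<dots> = real d powr (a + 1)" using d by (simp add: powr_add)
  also have "\<dots> \<le> real d powr real m" using d m by (intro powr_mono) auto
  also have "\<dots> = real d ^ m" using d by (simp add: powr_realpow)
  finally show False by simp
qed

theorem theorem2p2:
  fixes \<alpha> \<beta> p :: real
    and \<mu> :: "nat \<Rightarrow> ((nat \<Rightarrow> real) \<Rightarrow> real) measure"
    and crit :: error_criterion
  assumes "\<alpha> > 0" and "\<beta> > 0" and "p > 0"
    and "\<And>d. d \<ge> 1 \<Longrightarrow> zero_mean_gaussian d (\<mu> d)"
    and "\<And>d. d \<ge> 1 \<Longrightarrow> has_covariance_kernel d (\<mu> d) (gevrey_kernel d \<alpha> \<beta> p)"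
  defines "n \<equiv> info_complexity crit \<mu>"
  shows "(\<forall>s t. s > 0 \<and> t > 1 \<longrightarrow> ALG_WT_st s t n)
    \<and> (\<forall>s t. s > 0 \<and> 0 < t \<and> t \<le> 1 \<longrightarrow>
         (ALG_WT_st s t n \<longleftrightarrow> \<alpha> > p) \<and> (ALG_WT n \<longleftrightarrow> \<alpha> > p) \<and> (ALG_UWT n \<longleftrightarrow> \<alpha> > p))
    \<and> (\<not> ALG_QPT n \<and> \<not> ALG_PT n \<and> \<not> ALG_SPT n)
    \<and> (curse_of_dimensionality n \<longleftrightarrow> \<alpha> \<le> p)"
proof -
  define A where "A d = gevrey_sum \<alpha> (2 * \<beta>) p d" for d
  define B where "B d = gevrey_sum \<alpha> \<beta> p d" for d
  have A1: "A d \<ge> 1" if "d \<ge> 1" for d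
    unfolding A_def using assms(1-3) that by (intro gevrey_sum_ge_1) auto
  have B1: "B d \<ge> 1" if "d \<ge> 1" for d
    unfolding B_def using assms(1-3) that by (intro gevrey_sum_ge_1) auto
  have bounds: "\<exists>m. n \<epsilon> d = enat m \<and> (1 - \<epsilon>\<^sup>2) * A d \<le> real m \<and> real m \<le> 2 * (B d)\<^sup>2 / \<epsilon>\<^sup>2"
    if \<epsilon>: "0 < \<epsilon>" "\<epsilon> < 1" and d: "d \<ge> 1" for \<epsilon> d
  proof -
    obtain m where "info_complexity crit \<mu> \<epsilon> d = enat m"
      "(1 - \<epsilon>\<^sup>2) * gevrey_sum \<alpha> (2 * \<beta>) p d \<le> real m"
      "real m \<le> 2 * (gevrey_sum \<alpha> \<beta> p d)\<^sup>2 / \<epsilon>\<^sup>2"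
      using info_complexity_bounds[where \<mu>=\<mu> and crit=crit, OF assms(1-3) d \<epsilon> assms(4)[OF d] assms(5)[OF d]] .
    then show ?thesis unfolding n_def A_def B_def by blast
  qed
  have lower: "ereal (3 / 4 * A d) \<le> ereal_of_enat (n \<epsilon> d)" if \<epsilon>: "0 < \<epsilon>" "\<epsilon> \<le> 1 / 2" and d: "d \<ge> 1" for \<epsilon> d
  proof -
    obtain m where m: "n \<epsilon> d = enat m" "(1 - \<epsilon>\<^sup>2) * A d \<le> real m"
      using bounds[of \<epsilon> d] \<epsilon> d by auto
    have "\<epsilon>\<^sup>2 \<le> (1 / 2)\<^sup>2" using \<epsilon> by (intro power_mono) auto
    then have "3 / 4 * A d \<le> (1 - \<epsilon>\<^sup>2) * A d"
      using A1[OF d] by (intro mult_right_mono) (auto simp: power2_eq_square)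
    then show ?thesis using m by simp
  qed
  have wt: "ALG_WT_st s t n" if "s > 0" "t > 1 \<or> (\<alpha> > p \<and> t > 0)" for s t
  proof (rule weak_tractability_if_ln_small[where B=B])
    show "s > 0" "t > 0" using that by auto
    show "\<exists>m\<ge>1. n \<epsilon> d = enat m \<and> real m \<le> 2 * (B d)\<^sup>2 / \<epsilon>\<^sup>2" if \<epsilon>: "0 < \<epsilon>" "\<epsilon> < 1" and d: "d \<ge> 1" for \<epsilon> d
    proof -
      obtain m where m: "n \<epsilon> d = enat m" "(1 - \<epsilon>\<^sup>2) * A d \<le> real m" "real m \<le> 2 * (B d)\<^sup>2 / \<epsilon>\<^sup>2"
        using bounds[OF \<epsilon> d] by blast
      have "\<epsilon>\<^sup>2 < 1" using \<epsilon> by (simp add: power_less_one_iff)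
      then have "0 < (1 - \<epsilon>\<^sup>2) * A d" using A1[OF d] by (intro mult_pos_pos) auto
      then have "m \<ge> 1" using m(2) by (cases m) auto
      then show ?thesis using m by blast
    qed
    show "(\<lambda>d. ln (B d) / real d powr t) \<longlonglongrightarrow> 0"
      unfolding B_def by (rule ln_gevrey_sum_small_o[OF assms(1-3) that(2)])
  qed (rule B1)
  have curse: "curse_of_dimensionality n" if "\<alpha> \<le> p"
    unfolding curse_of_dimensionality_def
  proof (rule exI[of _ "3 / 4"], rule exI[of _ "1 / 2"], rule exI[of _ "2 * exp (- (2 * \<beta>))"], intro conjI allI impI)
    fix \<epsilon> :: real assume \<epsilon>: "0 < \<epsilon> \<and> \<epsilon> \<le> 1 / 2 \<and> \<epsilon> < 1"
    have "ereal (3 / 4 * (1 + 2 * exp (- (2 * \<beta>))) ^ d) \<le> ereal_of_enat (n \<epsilon> d)" if d: "d \<ge> 1" for d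
    proof -
      have "(1 + 2 * exp (- (2 * \<beta>))) ^ d \<le> A d"
        unfolding A_def using assms(1-3) d \<open>\<alpha> \<le> p\<close> by (intro gevrey_sum_exponential) auto
      then have "ereal (3 / 4 * (1 + 2 * exp (- (2 * \<beta>))) ^ d) \<le> ereal (3 / 4 * A d)" by simp
      also have "\<dots> \<le> ereal_of_enat (n \<epsilon> d)" using \<epsilon> d by (intro lower) auto
      finally show ?thesis .
    qed
    then have "{d. d \<ge> 1 \<and> ereal (3 / 4 * (1 + 2 * exp (- (2 * \<beta>))) ^ d) \<le> ereal_of_enat (n \<epsilon> d)} = {1..}"
      by auto
    then show "infinite {d. d \<ge> 1 \<and> ereal (3 / 4 * (1 + 2 * exp (- (2 * \<beta>))) ^ d) \<le> ereal_of_enat (n \<epsilon> d)}"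
      by (simp add: infinite_Ici)
  qed auto
  have not_poly: False if poly: "\<And>d. d \<ge> 1 \<Longrightarrow> ereal_of_enat (n (1 / 2) d) \<le> ereal (C * real d powr a)" for C a
  proof (rule superpolynomial_at_half[where n=n and c="\<lambda>m. 3 / 4 * exp (- (2 * \<beta>) * real m powr (\<alpha> / p))", OF _ _ poly])
    fix d m :: nat assume d: "d \<ge> 1"
    have "real (d choose m) * exp (- (2 * \<beta>) * real m powr (\<alpha> / p)) \<le> A d"
      unfolding A_def using assms(1-3) d by (intro gevrey_sum_ge_binomial) auto
    then have "ereal (3 / 4 * exp (- (2 * \<beta>) * real m powr (\<alpha> / p)) * real (d choose m)) \<le> ereal (3 / 4 * A d)"
      by (simp add: mult.commute)
    also have "\<dots> \<le> ereal_of_enat (n (1 / 2) d)" using d by (intro lower) auto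
    finally show "ereal (3 / 4 * exp (- (2 * \<beta>) * real m powr (\<alpha> / p)) * real (d choose m)) \<le> ereal_of_enat (n (1 / 2) d)" .
  qed auto
  have half: "(1 / 2 :: real) \<in> {0<..<1}" by simp
  have qpt: "\<not> ALG_QPT n"
  proof
    assume "ALG_QPT n"
    then obtain C a where C: "\<And>d \<epsilon>. d \<ge> 1 \<Longrightarrow> \<epsilon> \<in> {0<..<1} \<Longrightarrow>
        ereal_of_enat (n \<epsilon> d) \<le> ereal (C * exp (a * (1 + ln (real d)) * (1 + ln (1 / \<epsilon>))))"
      unfolding ALG_QPT_def by blast
    define b where "b = a * (1 + ln 2)"
    have "ereal_of_enat (n (1 / 2) d) \<le> ereal (C * exp b * real d powr b)" if "d \<ge> 1" for d
    proof -
      have "exp (a * (1 + ln (real d)) * (1 + ln (1 / (1 / 2)))) = exp b * real d powr b"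
        using that by (simp add: b_def powr_def algebra_simps flip: exp_add)
      then show ?thesis using C[OF that half] by (simp add: mult.assoc)
    qed
    then show False by (rule not_poly)
  qed
  have pt: "\<not> ALG_PT n"
  proof
    assume "ALG_PT n"
    then obtain C a b where C: "\<And>d \<epsilon>. d \<ge> 1 \<Longrightarrow> \<epsilon> \<in> {0<..<1} \<Longrightarrow>
        ereal_of_enat (n \<epsilon> d) \<le> ereal (C * real d powr b * \<epsilon> powr (- a))"
      unfolding ALG_PT_def by blast
    have "ereal_of_enat (n (1 / 2) d) \<le> ereal (C * (1 / 2) powr (- a) * real d powr b)" if "d \<ge> 1" for d
      using C[OF that half] by (simp only: ac_simps)
    then show False by (rule not_poly)
  qed
  have spt: "\<not> ALG_SPT n"
  proof
    assume "ALG_SPT n"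
    then obtain C a where C: "\<And>d \<epsilon>. d \<ge> 1 \<Longrightarrow> \<epsilon> \<in> {0<..<1} \<Longrightarrow>
        ereal_of_enat (n \<epsilon> d) \<le> ereal (C * \<epsilon> powr (- a))"
      unfolding ALG_SPT_def by blast
    have "ereal_of_enat (n (1 / 2) d) \<le> ereal (C * (1 / 2) powr (- a) * real d powr 0)" if "d \<ge> 1" for d
      using C[OF that half] that by simp
    then show False by (rule not_poly)
  qed
  have WT: "ALG_WT_st s t n \<longleftrightarrow> \<alpha> > p" if "s > 0" "0 < t" "t \<le> 1" for s t
    using wt[of s t] curse curse_imp_not_weakly_tractable[of n t s] that by (cases "\<alpha> > p") auto
  have UWT: "ALG_UWT n \<longleftrightarrow> \<alpha> > p"
  proof
    assume "ALG_UWT n"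
    then have "ALG_WT_st 1 1 n" by (simp add: ALG_UWT_def)
    then show "\<alpha> > p" using WT[of 1 1] by simp
  next
    assume "\<alpha> > p"
    then show "ALG_UWT n" using wt by (simp add: ALG_UWT_def)
  qed
  have CD: "curse_of_dimensionality n \<longleftrightarrow> \<alpha> \<le> p"
    using curse WT[of 1 1] curse_imp_not_weakly_tractable[of n 1 1] by (cases "\<alpha> \<le> p") auto
  show ?thesis
    using wt WT UWT CD qpt pt spt by (auto simp: ALG_WT_def)
qed

end
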